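(* Let $(K,q,\mathcal G)$ be a pseudoisometric and topologically ergodic groupoid action. Then there is a unique relatively invariant measure for $(K,q,\mathcal G)$. Moreover, this relatively invariant measure is fully supported.
   Context: All compact spaces are Hausdorff. A groupoid $\mathcal G$ has source $s(g)=g^{-1}g$, range $r(g)=gg^{-1}$, unit space $\mathcal G^{(0)}$; $gh$ is defined iff $s(g)=r(h)$. A topological groupoid carries a Hausdorff topology making product and inversion continuous. A groupoid action $(K,q,\mathcal G)$ of a topological groupoid $\mathcal G$ on a compact space $K$ consists of a continuous open surjection $q\colon K\to\mathcal G^{(0)}$ (so $\mathcal G^{(0)}$ is compact) and a continuous map $\varphi\colon\{(g,x)\in\mathcal G\times K: s(g)=q(x)\}\to K$, $(g,x)\mapsto\varphi_g(x)=gx$, with $q(gx)=r(g)$, $(g_1g_2)x=g_1(g_2x)$ whenever defined, and $ux=x$ for $u\in\mathcal G^{(0)}$, $x\in K_u:=q^{-1}(u)$. Thus $\varphi_g\colon K_{s(g)}\to K_{r(g)}$. The action is topologically ergodic if, whenever $\pi\colon K\to M$ is a continuous surjection onto a compact space with $\pi(gx)=\pi(x)$ for all $g\in\mathcal G$, $x\in K_{s(g)}$, $M$ is a point. (Equivalently: every $f\in\mathrm C(K)$ with $f(gx)=f(x)$ for all such $g,x$ is constant.) The action is pseudoisometric if there is a set $P$ of continuous maps $p\colon\{(x,y)\in K\times K:q(x)=q(y)\}\to[0,\infty)$ such that for every $u\in\mathcal G^{(0)}$ each $p|_{K_u\times K_u}$ ($p\in P$) is a pseudometric, these pseudometrics generate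 the topology of $K_u$, and $p(gx,gy)=p(x,y)$ for all $p\in P$, $g\in\mathcal G$, $x,y\in K_{s(g)}$. $\mathrm P(K)$ is the set of regular Borel probability measures on $K$ with the weak* topology. A relatively invariant measure for $(K,q,\mathcal G)$ is a continuous map $\mu\colon\mathcal G^{(0)}\to\mathrm P(K)$, $u\mapsto\mu_u$, such that $q_*\mu_u=\delta_u$ for all $u\in\mathcal G^{(0)}$ (so $\mu_u$ is concentrated on $K_u$) and $(\varphi_g)_*\mu_{s(g)}=\mu_{r(g)}$ for all $g\in\mathcal G$. It is fully supported if $\operatorname{supp}\mu_u=K_u$ for every $u$. *)

theory Defs
  imports "HOL-Probability.Probability"
begin

text \<open>
  The arrows form a whole type. The product is a total function in HOL, but only its values
  on composable pairs (source of the left factor = range of the right factor) are constrained.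
\<close>

locale groupoid_operations =
  fixes mul :: "'g \<Rightarrow> 'g \<Rightarrow> 'g" (infixl "\<cdot>" 70)
    and ginv :: "'g \<Rightarrow> 'g"
begin

definition source :: "'g \<Rightarrow> 'g" where
  "source g = ginv g \<cdot> g"

definition range_of :: "'g \<Rightarrow> 'g" where
  "range_of g = g \<cdot> ginv g"

definition units :: "'g set" where
  "units = range source"

end

locale topological_groupoid = groupoid_operations mul ginv
  for mul :: "'g::t2_space \<Rightarrow> 'g \<Rightarrow> 'g" (infixl "\<cdot>" 70) and ginv :: "'g \<Rightarrow> 'g" +
  assumes ginv_ginv: "ginv (ginv g) = g"
    and source_mul: "source g = range_of h \<Longrightarrow> source (g \<cdot> h) = source h"
    and range_mul: "source g = range_of h \<Longrightarrow> range_of (g \<cdot> h) = range_of g"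
    and assoc: "source g = range_of h \<Longrightarrow> source h = range_of k \<Longrightarrow> (g \<cdot> h) \<cdot> k = g \<cdot> (h \<cdot> k)"
    and ginv_mul_cancel: "source g = range_of h \<Longrightarrow> ginv g \<cdot> (g \<cdot> h) = h"
    and mul_ginv_cancel: "source g = range_of h \<Longrightarrow> (g \<cdot> h) \<cdot> ginv h = g"
    and continuous_mul: "continuous_on {(g, h). source g = range_of h} (\<lambda>(g, h). g \<cdot> h)"
    and continuous_ginv: "continuous_on UNIV ginv"

definition regular_borel_prob :: "'a::t2_space measure \<Rightarrow> bool" where
  "regular_borel_prob M \<longleftrightarrow> prob_space M \<and> sets M = sets borel \<and>
     (\<forall>A\<in>sets M.
        emeasure M A = (SUP C\<in>{C. compact C \<and> C \<subseteq> A}. emeasure M C) \<and>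
        emeasure M A = (INF U\<in>{U. open U \<and> A \<subseteq> U}. emeasure M U))"

text \<open>
  The initial topology on the regular Borel probability measures for integration against
  continuous functions. Real-valued functions suffice: splitting a complex-valued one into real
  and imaginary part shows that it gives nothing new. The functions are not required to be bounded;
  the definition is meant for compact spaces.
\<close>

definition weak_star :: "'a::t2_space measure topology" where
  "weak_star = topology_generated_by
     {{M. regular_borel_prob M \<and> (LINT x|M. f x) \<in> U} | (f :: 'a \<Rightarrow> real) U.
        continuous_on UNIV f \<and> open U}"

definition measure_support :: "'a::t2_space measure \<Rightarrow> 'a set" where
  "measure_support M = {x. \<forall>U. open U \<longrightarrow> x \<in> U \<longrightarrow> emeasure M U > 0}"

definition pseudometric_on :: "'a set \<Rightarrow> ('a \<times> 'a \<Rightarrow> real) \<Rightarrow> bool" where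
  "pseudometric_on S p \<longleftrightarrow>
     (\<forall>x\<in>S. \<forall>y\<in>S. p (x, y) \<ge> 0 \<and> p (x, y) = p (y, x)) \<and>
     (\<forall>x\<in>S. p (x, x) = 0) \<and>
     (\<forall>x\<in>S. \<forall>y\<in>S. \<forall>z\<in>S. p (x, z) \<le> p (x, y) + p (y, z))"

text \<open>
  The set S itself is put into the subbase so that the empty family of pseudometrics
  generates the indiscrete topology on S.
\<close>

definition pseudometric_topology :: "'a set \<Rightarrow> ('a \<times> 'a \<Rightarrow> real) set \<Rightarrow> 'a topology" where
  "pseudometric_topology S P = topology_generated_by
     (insert S {{y \<in> S. p (x, y) < e} | p x e. p \<in> P \<and> x \<in> S \<and> e > 0})"

locale groupoid_action = topological_groupoid mul ginv
  for mul :: "'g::t2_space \<Rightarrow> 'g \<Rightarrow> 'g" (infixl "\<cdot>" 70) and ginv :: "'g \<Rightarrow> 'g" +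
  fixes q :: "'k::t2_space \<Rightarrow> 'g"
    and act :: "'g \<Rightarrow> 'k \<Rightarrow> 'k"
  assumes compact_space: "compact (UNIV :: 'k set)"
    and continuous_q: "continuous_map euclidean (top_of_set units) q"
    and open_q: "open_map euclidean (top_of_set units) q"
    and surj_q: "range q = units"
    and continuous_act: "continuous_on {(g, x). source g = q x} (\<lambda>(g, x). act g x)"
    and q_act: "source g = q x \<Longrightarrow> q (act g x) = range_of g"
    and act_mul: "source g = range_of h \<Longrightarrow> source h = q x \<Longrightarrow> act (g \<cdot> h) x = act g (act h x)"
    and act_unit: "u \<in> units \<Longrightarrow> q x = u \<Longrightarrow> act u x = x"
begin

definition fibre :: "'g \<Rightarrow> 'k set" where
  "fibre u = q -` {u}"

text \<open>
  HOL cannot quantify over spaces of all types here. This is no restriction: the target of a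
  surjection from K can be transported along an injection into K, so it may be taken to be
  a topology whose carrier is a subset of the type of points of K.
\<close>

definition topologically_ergodic :: bool where
  "topologically_ergodic \<longleftrightarrow>
     (\<forall>(M :: 'k topology) \<pi>.
        compact_space M \<and> Hausdorff_space M \<and>
        continuous_map euclidean M \<pi> \<and> range \<pi> = topspace M \<and>
        (\<forall>g. \<forall>x\<in>fibre (source g). \<pi> (act g x) = \<pi> x)
        \<longrightarrow> (\<exists>m. topspace M = {m}))"

definition pseudoisometric :: bool where
  "pseudoisometric \<longleftrightarrow>
     (\<exists>P :: ('k \<times> 'k \<Rightarrow> real) set.
        (\<forall>p\<in>P. continuous_on {(x, y). q x = q y} p) \<and>
        (\<forall>u\<in>units.
           (\<forall>p\<in>P. pseudometric_on (fibre u) p) \<and>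
           pseudometric_topology (fibre u) P = top_of_set (fibre u)) \<and>
        (\<forall>p\<in>P. \<forall>g. \<forall>x\<in>fibre (source g). \<forall>y\<in>fibre (source g).
           p (act g x, act g y) = p (x, y)))"

text \<open>
  Membership in \<^term>\<open>extensional units\<close> makes a HOL function represent a map with domain
  \<^term>\<open>units\<close>: its values elsewhere carry no information. Since \<^term>\<open>act g\<close> is only meaningful
  on the fibre over the source of g, the measure there is restricted to this fibre
  before it is pushed forward.
\<close>

definition relatively_invariant_measure :: "('g \<Rightarrow> 'k measure) \<Rightarrow> bool" where
  "relatively_invariant_measure \<mu> \<longleftrightarrow>
     \<mu> \<in> extensional units \<and>
     continuous_map (top_of_set units) weak_star \<mu> \<and>
     (\<forall>u\<in>units. distr (\<mu> u) (restrict_space borel units) q = return (restrict_space borel units) u) \<and>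
     (\<forall>g. distr (restrict_space (\<mu> (source g)) (fibre (source g))) borel (act g) = \<mu> (range_of g))"

definition fully_supported :: "('g \<Rightarrow> 'k measure) \<Rightarrow> bool" where
  "fully_supported \<mu> \<longleftrightarrow> (\<forall>u\<in>units. measure_support (\<mu> u) = fibre u)"

end

end

theory Submission
  imports Defs
begin

text \<open>
  Existence follows Weil's construction of Haar measure, carried out on all fibres at once. The
  pseudometrics give kernels k on \<open>K \<times> K\<close> that are invariant under the groupoid, symmetric on fibres, positive on
  the diagonal, and concentrated as close to the diagonal as desired. For a continuous
  nonnegative f, the covering number of f on the fibre over u is the least total weight of a combination
  of translates \<open>k (x, \<cdot>)\<close>, x in that fibre, that dominates f. Divided by the covering number of 1 it is
  monotone, subadditive and invariant, and it becomes additive as k concentrates near the diagonal.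
  A cluster point for finer and finer kernels, taken simultaneously for all fibres by Tychonoff's theorem,
  is a family of positive normalized functionals; the Riesz representation theorem, for which the measure
  is built here from an outer measure, turns it into a family of regular probability measures.

  The construction alone does not give continuity in u, and the action may be far from transitive on
  fibres. Both gaps are filled by one consequence of ergodicity: for every invariant kernel \<open>\<psi>\<close> the
  integral of \<open>\<psi> (x, \<cdot>)\<close> over the fibre of x has the same value for all x in K. For the limit functional
  this is true because, for each fixed k, the covering number of \<open>\<psi> (x, \<cdot>)\<close> is an invariant continuous
  function of x (continuity uses that the anchor map q is open), hence constant, and constants survive in
  the limit. For an arbitrary relatively invariant measure the integral itself is continuous and
  invariant, hence constant.

  This property of constant kernel integrals determines everything. Given f, take \<open>\<psi>\<close> so concentrated that f
  hardly varies on its support. Replace the measure on one fibre by a finite combination of point masses, so that the corresponding sum of translates of \<open>\<psi>\<close> is almost constant.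
  For any measure \<open>\<nu>\<close> with constant kernel integrals on a nearby fibre, the integral of f times the
  transported sum of translates is, on the one hand, almost a multiple of the integral of f, and on the
  other hand almost the same multiple of an average of values of f. Thus integrals over nearby
  fibres, possibly for different families of measures, are close to each other
  (\<open>constant_kernel_integrals_close\<close>). On a single fibre this is uniqueness, for a single family it
  is weak* continuity. Full support holds because the common integral of a kernel cannot be 0: finitely many
  translates of the kernel dominate 1 on a fibre.
\<close>

section \<open>Continuous functions on compact Hausdorff spaces\<close>

lemma normal_space_compact_type:
  assumes "compact (UNIV :: 'a::t2_space set)"
  shows "normal_space (euclidean :: 'a topology)"
proof (rule compact_Hausdorff_or_regular_imp_normal_space)
  show "compact_space (euclidean :: 'a topology)" using assms by (simp add: compact_space_def)
  have "Hausdorff_space (euclidean :: 'a topology)"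
    unfolding Hausdorff_space_def disjnt_def using hausdorff by (metis open_openin)
  then show "Hausdorff_space (euclidean :: 'a topology) \<or> regular_space (euclidean :: 'a topology)" ..
qed

lemma Urysohn_compact_type:
  fixes S T :: "'a::t2_space set"
  assumes "compact (UNIV :: 'a set)" "closed S" "closed T" "S \<inter> T = {}"
  obtains f :: "'a \<Rightarrow> real" where "continuous_on UNIV f" "\<And>x. 0 \<le> f x" "\<And>x. f x \<le> 1"
    "\<And>x. x \<in> S \<Longrightarrow> f x = 0" "\<And>x. x \<in> T \<Longrightarrow> f x = 1"
proof -
  obtain f where f: "continuous_map euclidean (top_of_set {0..1::real}) f" "f ` S \<subseteq> {0}" "f ` T \<subseteq> {1}"
    using Urysohn_lemma[OF normal_space_compact_type[OF assms(1)], of S T 0 1] assms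
    by (auto simp: disjnt_def)
  have "continuous_on UNIV f" "\<And>x. f x \<in> {0..1}"
    using f(1) by (auto simp: continuous_map_in_subtopology image_subset_iff)
  then show ?thesis using f(2,3) by (intro that[of f]) auto
qed

lemma Tietze_nonneg_compact_type:
  fixes f :: "'a::t2_space \<Rightarrow> real"
  assumes "compact (UNIV :: 'a set)" "closed S" "continuous_on S f" "\<And>x. x \<in> S \<Longrightarrow> 0 \<le> f x"
  obtains g where "continuous_on UNIV g" "\<And>x. 0 \<le> g x" "\<And>x. x \<in> S \<Longrightarrow> g x = f x"
proof -
  obtain g where "continuous_map euclidean euclideanreal g" "g ` UNIV \<subseteq> {0..}" "\<And>x. x \<in> S \<Longrightarrow> g x = f x"
    using Tietze_extension_realinterval[OF normal_space_compact_type[OF assms(1)], of S "{0..}" f] assms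
    by (auto simp: is_interval_ci)
  then show ?thesis using that[of g] by auto
qed

lemma bounded_continuous_compact_type:
  fixes f :: "'a::t2_space \<Rightarrow> real"
  assumes "compact (UNIV :: 'a set)" "continuous_on UNIV f"
  obtains B where "B > 0" "\<And>x. \<bar>f x\<bar> \<le> B"
proof -
  have "bounded (range f)" using compact_continuous_image[OF assms(2,1)] by (rule compact_imp_bounded)
  then obtain B where "B > 0" "\<forall>y\<in>range f. norm y \<le> B" by (auto simp: bounded_pos)
  then show ?thesis using that[of B] by auto
qed

lemma integrable_continuous_compact_type:
  fixes f :: "'a::t2_space \<Rightarrow> real"
  assumes "compact (UNIV :: 'a set)" "continuous_on UNIV f" "finite_measure M" "sets M = sets borel"
  shows "integrable M f"
proof -
  obtain B where B: "\<And>x. \<bar>f x\<bar> \<le> B" using bounded_continuous_compact_type[OF assms(1,2)] by blast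
  have "f \<in> borel_measurable M" using borel_measurable_continuous_onI[OF assms(2)]
    by (subst measurable_cong_sets[OF assms(4) refl])
  moreover have "AE x in M. norm (f x) \<le> B" using B by simp
  ultimately show ?thesis using finite_measure.integrable_const_bound[OF assms(3)] by blast
qed

section \<open>The Riesz representation theorem on a compact Hausdorff space\<close>

text \<open>
  The functional is regarded on the cone of nonnegative continuous functions, the domain on which
  covering numbers are additive in the limit.
\<close>

locale normalized_positive_functional =
  fixes \<Lambda> :: "('a::t2_space \<Rightarrow> real) \<Rightarrow> real"
  assumes compact: "compact (UNIV :: 'a set)"
    and nonneg: "continuous_on UNIV f \<Longrightarrow> (\<And>x. 0 \<le> f x) \<Longrightarrow> 0 \<le> \<Lambda> f"
    and add: "continuous_on UNIV f \<Longrightarrow> continuous_on UNIV g \<Longrightarrow> (\<And>x. 0 \<le> f x) \<Longrightarrow> (\<And>x. 0 \<le> g x) \<Longrightarrow>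
      \<Lambda> (\<lambda>x. f x + g x) = \<Lambda> f + \<Lambda> g"
    and scale: "continuous_on UNIV f \<Longrightarrow> (\<And>x. 0 \<le> f x) \<Longrightarrow> 0 \<le> c \<Longrightarrow> \<Lambda> (\<lambda>x. c * f x) = c * \<Lambda> f"
    and one: "\<Lambda> (\<lambda>_. 1) = 1"
begin

lemma mono:
  assumes "continuous_on UNIV f" "continuous_on UNIV g" "\<And>x. 0 \<le> f x" "\<And>x. f x \<le> g x"
  shows "\<Lambda> f \<le> \<Lambda> g"
proof -
  have c: "continuous_on UNIV (\<lambda>x. g x - f x)" using assms by (intro continuous_intros)
  have "\<Lambda> (\<lambda>x. f x + (g x - f x)) = \<Lambda> f + \<Lambda> (\<lambda>x. g x - f x)"
    using assms c by (intro add) auto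
  moreover have "0 \<le> \<Lambda> (\<lambda>x. g x - f x)" using assms c by (intro nonneg) auto
  ultimately show ?thesis by simp
qed

lemma const: "0 \<le> c \<Longrightarrow> \<Lambda> (\<lambda>_. c) = c"
  using scale[of "\<lambda>_. 1" c] one by simp

lemma sum:
  assumes "finite I" "\<And>i. i \<in> I \<Longrightarrow> continuous_on UNIV (f i)" "\<And>i x. i \<in> I \<Longrightarrow> 0 \<le> f i x"
  shows "\<Lambda> (\<lambda>x. \<Sum>i\<in>I. f i x) = (\<Sum>i\<in>I. \<Lambda> (f i))"
  using assms
proof (induction I rule: finite_induct)
  case empty
  then show ?case using const[of 0] by simp
next
  case (insert i I)
  have "\<Lambda> (\<lambda>x. f i x + (\<Sum>i\<in>I. f i x)) = \<Lambda> (f i) + \<Lambda> (\<lambda>x. \<Sum>i\<in>I. f i x)"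
    using insert by (intro add) (auto intro!: continuous_intros sum_nonneg)
  then show ?case using insert by simp
qed

definition subordinate :: "'a set \<Rightarrow> ('a \<Rightarrow> real) set" where
  "subordinate U = {f. continuous_on UNIV f \<and> (\<forall>x. 0 \<le> f x \<and> f x \<le> 1) \<and> (\<forall>x. x \<notin> U \<longrightarrow> f x = 0)}"

text \<open>
  The values a representing measure must have on open sets, and the outer measure that they generate.
\<close>

definition open_value :: "'a set \<Rightarrow> ennreal" where
  "open_value U = (SUP f\<in>subordinate U. ennreal (\<Lambda> f))"

definition outer_value :: "'a set \<Rightarrow> ennreal" where
  "outer_value A = (INF U\<in>{U. open U \<and> A \<subseteq> U}. open_value U)"

lemma zero_subordinate: "(\<lambda>_. 0) \<in> subordinate U"
  by (simp add: subordinate_def)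

lemma le_open_value: "f \<in> subordinate U \<Longrightarrow> ennreal (\<Lambda> f) \<le> open_value U"
  unfolding open_value_def by (rule SUP_upper)

lemma subordinate_mono: "U \<subseteq> V \<Longrightarrow> subordinate U \<subseteq> subordinate V"
  by (auto simp: subordinate_def)

lemma open_value_mono: "U \<subseteq> V \<Longrightarrow> open_value U \<le> open_value V"
  unfolding open_value_def by (rule SUP_subset_mono) (use subordinate_mono in auto)

lemma outer_value_open: "open U \<Longrightarrow> outer_value U = open_value U"
  unfolding outer_value_def by (intro antisym INF_lower INF_greatest) (auto intro: open_value_mono)

lemma outer_value_mono: "A \<subseteq> B \<Longrightarrow> outer_value A \<le> outer_value B"
  unfolding outer_value_def by (rule INF_superset_mono) auto

lemma outer_value_less: "outer_value A < c \<Longrightarrow> \<exists>U. open U \<and> A \<subseteq> U \<and> open_value U < c"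
  unfolding outer_value_def INF_less_iff by auto

lemma open_value_empty: "open_value {} = 0"
proof -
  have "f = (\<lambda>_. 0)" if "f \<in> subordinate {}" for f using that by (auto simp: subordinate_def)
  then have "subordinate {} = {\<lambda>_. 0}" using zero_subordinate by auto
  then show ?thesis by (simp add: open_value_def const)
qed

lemma open_value_UNIV: "open_value UNIV = 1"
proof (rule antisym)
  have "ennreal (\<Lambda> f) \<le> 1" if "f \<in> subordinate UNIV" for f
    using mono[of f "\<lambda>_. 1"] that one by (auto simp: subordinate_def)
  then show "open_value UNIV \<le> 1" unfolding open_value_def by (rule SUP_least)
  have "(\<lambda>_. 1) \<in> subordinate UNIV" by (simp add: subordinate_def)
  from le_open_value[OF this] show "1 \<le> open_value UNIV" by (simp add: one)
qed

text \<open>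
  A function subordinate to U need not have its support inside U; cutting off its values below e
  costs at most e and leaves a function that vanishes off a compact subset of U.
\<close>

definition cut :: "real \<Rightarrow> ('a \<Rightarrow> real) \<Rightarrow> 'a \<Rightarrow> real" where
  "cut e f = (\<lambda>x. max 0 (f x - e))"

lemma cut_subordinate:
  assumes "f \<in> subordinate U" "0 < e"
  shows "cut e f \<in> subordinate {x. e \<le> f x}" "{x. e \<le> f x} \<subseteq> U" "closed {x. e \<le> f x}"
    "\<Lambda> f \<le> \<Lambda> (cut e f) + e"
proof -
  have f: "continuous_on UNIV f" "\<And>x. 0 \<le> f x" "\<And>x. f x \<le> 1" "\<And>x. x \<notin> U \<Longrightarrow> f x = 0"
    using assms by (auto simp: subordinate_def)
  have c: "continuous_on UNIV (cut e f)" unfolding cut_def by (intro continuous_intros f)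
  show "cut e f \<in> subordinate {x. e \<le> f x}"
    unfolding subordinate_def
  proof (intro CollectI conjI allI impI)
    show "cut e f x \<le> 1" for x using f(3)[of x] assms(2) by (simp add: cut_def)
    show "cut e f x = 0" if "x \<notin> {x. e \<le> f x}" for x using that by (simp add: cut_def)
  qed (use c in \<open>auto simp: cut_def\<close>)
  show "{x. e \<le> f x} \<subseteq> U" using f(4) assms(2) by force
  show "closed {x. e \<le> f x}" using f(1) by (intro closed_Collect_le continuous_intros)
  have "\<Lambda> f \<le> \<Lambda> (\<lambda>x. cut e f x + e)"
    using assms(2) by (intro mono f c continuous_intros) (auto simp: cut_def)
  also have "\<dots> = \<Lambda> (cut e f) + \<Lambda> (\<lambda>_. e)"
    using assms(2) by (intro add c) (auto simp: cut_def)
  finally show "\<Lambda> f \<le> \<Lambda> (cut e f) + e" using const assms(2) by simp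
qed

lemma subordinate_nonneg: "f \<in> subordinate U \<Longrightarrow> 0 \<le> \<Lambda> f"
  by (rule nonneg) (auto simp: subordinate_def)

text \<open>
  After cutting, a function subordinate to the union lives on a compact set C. A Urysohn function
  that is 0 on C - U and 1 on C - V splits it into a part subordinate to U and a part subordinate to V.
\<close>

lemma open_value_Un:
  assumes "open U" "open V"
  shows "open_value (U \<union> V) \<le> open_value U + open_value V"
  unfolding open_value_def[of "U \<union> V"]
proof (rule SUP_least, rule ennreal_le_epsilon)
  fix f and e :: real assume f: "f \<in> subordinate (U \<union> V)" and e: "0 < e"
  define C where "C = {x. e \<le> f x}"
  note cut = cut_subordinate[OF f e, folded C_def]
  have "closed (C - U)" "closed (C - V)" "(C - U) \<inter> (C - V) = {}"
    using cut assms by (auto intro: closed_Diff)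
  then obtain h where h: "continuous_on UNIV h" "\<And>x. 0 \<le> h x" "\<And>x. h x \<le> 1"
      "\<And>x. x \<in> C - U \<Longrightarrow> h x = 0" "\<And>x. x \<in> C - V \<Longrightarrow> h x = (1::real)"
    using Urysohn_compact_type[OF compact, of "C - U" "C - V"] by blast
  let ?c = "cut e f"
  have c: "continuous_on UNIV ?c" "\<And>x. 0 \<le> ?c x" "\<And>x. ?c x \<le> 1" "\<And>x. x \<notin> C \<Longrightarrow> ?c x = 0"
    using cut(1) by (auto simp: subordinate_def)
  have h': "x \<notin> U \<Longrightarrow> ?c x = 0 \<or> h x = 0" "x \<notin> V \<Longrightarrow> ?c x = 0 \<or> h x = 1" for x
    using c(4)[of x] h(4,5)[of x] by blast+
  have 1: "(\<lambda>x. ?c x * h x) \<in> subordinate U"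
    unfolding subordinate_def using c(1-3) h(1-3) h'(1)
    by (auto intro!: mult_le_one continuous_on_mult)
  have 2: "(\<lambda>x. ?c x * (1 - h x)) \<in> subordinate V"
    unfolding subordinate_def using c(1-3) h(1-3) h'(2)
    by (auto intro!: mult_le_one continuous_on_mult continuous_on_diff)
  have "\<Lambda> f \<le> \<Lambda> (\<lambda>x. ?c x * h x + ?c x * (1 - h x)) + e"
    using cut(4) by (simp add: algebra_simps)
  also have "\<Lambda> (\<lambda>x. ?c x * h x + ?c x * (1 - h x)) = \<Lambda> (\<lambda>x. ?c x * h x) + \<Lambda> (\<lambda>x. ?c x * (1 - h x))"
    using 1 2 by (intro add) (auto simp: subordinate_def)
  finally have "ennreal (\<Lambda> f) \<le> ennreal (\<Lambda> (\<lambda>x. ?c x * h x) + \<Lambda> (\<lambda>x. ?c x * (1 - h x)) + e)"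
    by (rule ennreal_leI)
  also have "\<dots> = ennreal (\<Lambda> (\<lambda>x. ?c x * h x)) + ennreal (\<Lambda> (\<lambda>x. ?c x * (1 - h x))) + ennreal e"
    using subordinate_nonneg[OF 1] subordinate_nonneg[OF 2] e by (simp add: ennreal_plus)
  also have "\<dots> \<le> open_value U + open_value V + ennreal e"
    using le_open_value[OF 1] le_open_value[OF 2] by (intro add_mono) auto
  finally show "ennreal (\<Lambda> f) \<le> open_value U + open_value V + ennreal e" .
qed

text \<open>
  Compactness of the set on which the cut function lives reduces countable unions to finite ones.
\<close>

lemma open_value_UN:
  fixes U :: "nat \<Rightarrow> 'a set"
  assumes "\<And>n. open (U n)"
  shows "open_value (\<Union>n. U n) \<le> (\<Sum>n. open_value (U n))"
  unfolding open_value_def[of "\<Union>n. U n"]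
proof (rule SUP_least, rule ennreal_le_epsilon)
  fix f and e :: real assume f: "f \<in> subordinate (\<Union>n. U n)" and e: "0 < e"
  define C where "C = {x. e \<le> f x}"
  note cut = cut_subordinate[OF f e, folded C_def]
  have fin: "open_value (\<Union>n<N. U n) \<le> (\<Sum>n<N. open_value (U n))" for N
  proof (induction N)
    case (Suc N)
    have "open_value (\<Union>n<Suc N. U n) \<le> open_value (U N) + open_value (\<Union>n<N. U n)"
      unfolding lessThan_Suc by (simp, rule open_value_Un) (use assms in auto)
    also have "\<dots> \<le> open_value (U N) + (\<Sum>n<N. open_value (U n))"
      using Suc by (intro add_mono) auto
    finally show ?case by (simp add: add.commute)
  qed (simp add: open_value_empty)
  have "compact C" using compact_Int_closed[OF compact cut(3)] by simp
  then obtain T where T: "finite T" "C \<subseteq> (\<Union>n\<in>T. U n)"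
    using compactE_image[of C UNIV U, OF _ assms cut(2)] by metis
  obtain N where "T \<subseteq> {..<N}" using finite_nat_iff_bounded T(1) by blast
  then have "C \<subseteq> (\<Union>n<N. U n)" using T(2) by blast
  then have "cut e f \<in> subordinate (\<Union>n<N. U n)" using cut(1) subordinate_mono by blast
  then have "ennreal (\<Lambda> (cut e f)) \<le> (\<Sum>n<N. open_value (U n))"
    using fin[of N] le_open_value order_trans by blast
  also have "\<dots> \<le> (\<Sum>n. open_value (U n))" by (rule sum_le_suminf) auto
  finally have *: "ennreal (\<Lambda> (cut e f)) \<le> (\<Sum>n. open_value (U n))" .
  have "ennreal (\<Lambda> f) \<le> ennreal (\<Lambda> (cut e f)) + ennreal e"
    using ennreal_leI[OF cut(4)] subordinate_nonneg[OF cut(1)] e by (simp add: ennreal_plus)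
  also have "\<dots> \<le> (\<Sum>n. open_value (U n)) + ennreal e" using * by (rule add_right_mono)
  finally show "ennreal (\<Lambda> f) \<le> (\<Sum>n. open_value (U n)) + ennreal e" .
qed

lemma outer_measure_space_outer_value: "outer_measure_space UNIV outer_value"
  unfolding outer_measure_space_def
proof (intro conjI)
  show "positive UNIV outer_value"
    by (simp add: positive_def outer_value_open open_value_empty)
  show "increasing UNIV outer_value" by (simp add: increasing_def outer_value_mono)
  show "countably_subadditive UNIV outer_value"
    unfolding countably_subadditive_def
  proof (intro allI impI, rule ennreal_le_epsilon)
    fix A :: "nat \<Rightarrow> 'a set" and e :: real
    assume e: "0 < e" and fin: "(\<Sum>n. outer_value (A n)) < top"
    have "outer_value (A n) < top" for n using fin by (metis ennreal_suminf_lessD)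
    then have "outer_value (A n) < outer_value (A n) + e * (1/2)^Suc n" for n
      using e by (simp add: less_top)
    note outer_value_less[OF this]
    then obtain U where U: "\<And>n. open (U n)" "\<And>n. A n \<subseteq> U n"
        "\<And>n. open_value (U n) < outer_value (A n) + e * (1/2)^Suc n"
      by metis
    have "outer_value (\<Union>n. A n) \<le> outer_value (\<Union>n. U n)"
      using U(2) by (intro outer_value_mono) blast
    also have "\<dots> \<le> (\<Sum>n. open_value (U n))"
      using U(1) by (simp add: outer_value_open open_UN open_value_UN)
    also have "\<dots> \<le> (\<Sum>n. outer_value (A n) + e * (1/2) ^ Suc n)"
      using U(3) by (intro suminf_le summableI) (auto intro: less_imp_le)
    also have "\<dots> = (\<Sum>n. outer_value (A n)) + (\<Sum>n. ennreal e * ennreal ((1/2) ^ Suc n))"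
      using e by (subst suminf_add[symmetric])
                 (auto simp del: ennreal_suminf_cmult simp add: ennreal_mult[symmetric])
    also have "\<dots> = (\<Sum>n. outer_value (A n)) + e"
      unfolding ennreal_suminf_cmult
      by (subst suminf_ennreal_eq[OF zero_le_power power_half_series]) auto
    finally show "outer_value (\<Union>n. A n) \<le> (\<Sum>n. outer_value (A n)) + ennreal e" .
  qed
qed

text \<open>
  Caratheodory's criterion for open U: if f lives on a compact subset C of \<open>V \<inter> U\<close> and g
  is subordinate to \<open>V - C\<close>, then \<open>f + g\<close> is subordinate to V, so \<open>\<Lambda> f + \<Lambda> g\<close> is at most the value of V.
\<close>

lemma open_in_lambda_system:
  assumes U: "open U"
  shows "U \<in> lambda_system UNIV UNIV outer_value"
proof -
  have split: "open_value (V \<inter> U) + outer_value (V - U) \<le> open_value V" if V: "open V" for V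
  proof -
    have "ennreal (\<Lambda> f) + outer_value (V - U) \<le> open_value V" if f: "f \<in> subordinate (V \<inter> U)" for f
    proof (rule ennreal_le_epsilon)
      fix e :: real assume e: "0 < e"
      define C where "C = {x. e \<le> f x}"
      note cut = cut_subordinate[OF f e, folded C_def]
      have "ennreal (\<Lambda> (cut e f)) + ennreal (\<Lambda> g) \<le> open_value V" if g: "g \<in> subordinate (V - C)" for g
      proof -
        have "(\<lambda>x. cut e f x + g x) \<in> subordinate V"
          unfolding subordinate_def
        proof (intro CollectI conjI allI impI)
          show "continuous_on UNIV (\<lambda>x. cut e f x + g x)"
            using cut(1) g by (intro continuous_on_add) (auto simp: subordinate_def)
          show "0 \<le> cut e f x + g x" for x using cut(1) g by (auto simp: subordinate_def)
          show "cut e f x + g x \<le> 1" for x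
            using cut(1) g by (cases "x \<in> C") (auto simp: subordinate_def)
          show "cut e f x + g x = 0" if "x \<notin> V" for x
            using that cut(1,2) g by (auto simp: subordinate_def)
        qed
        from le_open_value[OF this]
        have "ennreal (\<Lambda> (\<lambda>x. cut e f x + g x)) \<le> open_value V" .
        moreover have "\<Lambda> (\<lambda>x. cut e f x + g x) = \<Lambda> (cut e f) + \<Lambda> g"
          using cut(1) g by (intro add) (auto simp: subordinate_def)
        ultimately show ?thesis
          using subordinate_nonneg[OF cut(1)] subordinate_nonneg[OF g] by (simp add: ennreal_plus)
      qed
      then have "(SUP g\<in>subordinate (V - C). ennreal (\<Lambda> (cut e f)) + ennreal (\<Lambda> g)) \<le> open_value V"
        by (rule SUP_least)
      then have *: "ennreal (\<Lambda> (cut e f)) + open_value (V - C) \<le> open_value V"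
        unfolding open_value_def[of "V - C"] using zero_subordinate
        by (subst ennreal_SUP_add_right) auto
      have "outer_value (V - U) \<le> open_value (V - C)"
        using cut(2,3) V by (subst outer_value_open[symmetric]) (auto intro!: outer_value_mono)
      moreover have "ennreal (\<Lambda> f) \<le> ennreal (\<Lambda> (cut e f)) + ennreal e"
        using ennreal_leI[OF cut(4)] subordinate_nonneg[OF cut(1)] e by (simp add: ennreal_plus)
      ultimately have "ennreal (\<Lambda> f) + outer_value (V - U)
          \<le> (ennreal (\<Lambda> (cut e f)) + ennreal e) + open_value (V - C)"
        by (intro add_mono)
      also have "\<dots> = (ennreal (\<Lambda> (cut e f)) + open_value (V - C)) + ennreal e"
        by (simp add: ac_simps)
      also have "\<dots> \<le> open_value V + ennreal e" using * by (rule add_right_mono)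
      finally show "ennreal (\<Lambda> f) + outer_value (V - U) \<le> open_value V + ennreal e" .
    qed
    then have "(SUP f\<in>subordinate (V \<inter> U). ennreal (\<Lambda> f) + outer_value (V - U)) \<le> open_value V"
      by (rule SUP_least)
    then show ?thesis
      unfolding open_value_def[of "V \<inter> U"] using zero_subordinate
      by (subst (asm) ennreal_SUP_add_left) auto
  qed
  have "outer_value (U \<inter> A) + outer_value ((UNIV - U) \<inter> A) = outer_value A" for A
  proof (rule antisym)
    have "outer_value (U \<inter> A) + outer_value ((UNIV - U) \<inter> A) \<le> open_value V" if V: "open V" "A \<subseteq> V" for V
    proof -
      have "outer_value (U \<inter> A) + outer_value ((UNIV - U) \<inter> A) \<le> outer_value (V \<inter> U) + outer_value (V - U)"
        using V by (intro add_mono outer_value_mono) auto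
      then show ?thesis using split[OF V(1)] U V by (simp add: outer_value_open open_Int)
    qed
    then show "outer_value (U \<inter> A) + outer_value ((UNIV - U) \<inter> A) \<le> outer_value A"
      unfolding outer_value_def[of A] by (intro INF_greatest) auto
    have "subadditive (UNIV :: 'a set set) outer_value"
    proof (rule ring_of_sets.countably_subadditive_subadditive)
      show "ring_of_sets UNIV (UNIV :: 'a set set)" by (rule ring_of_setsI) auto
    qed (use outer_measure_space_outer_value in \<open>auto simp: outer_measure_space_def\<close>)
    then have "outer_value ((U \<inter> A) \<union> ((UNIV - U) \<inter> A)) \<le> outer_value (U \<inter> A) + outer_value ((UNIV - U) \<inter> A)"
      by (rule subadditiveD) auto
    moreover have "(U \<inter> A) \<union> ((UNIV - U) \<inter> A) = A" by blast
    ultimately show "outer_value A \<le> outer_value (U \<inter> A) + outer_value ((UNIV - U) \<inter> A)" by simp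
  qed
  then show ?thesis by (simp add: lambda_system_def)
qed

definition riesz_measure :: "'a measure" where
  "riesz_measure = measure_of UNIV (sets borel) outer_value"

lemma emeasure_riesz_measure:
  assumes "A \<in> sets borel"
  shows "emeasure riesz_measure A = outer_value A"
proof -
  interpret P: sigma_algebra UNIV "UNIV :: 'a set set" 
    using sigma_algebra_Pow[of "UNIV :: 'a set"] unfolding Pow_UNIV .
  have ms: "measure_space UNIV (lambda_system UNIV UNIV outer_value) outer_value"
    by (rule P.caratheodory_lemma[OF outer_measure_space_outer_value])
  then interpret L: sigma_algebra UNIV "lambda_system UNIV UNIV outer_value"
    by (simp add: measure_space_def)
  have "sigma_sets UNIV {S. open S} \<subseteq> lambda_system UNIV UNIV outer_value"
    by (rule L.sigma_sets_subset) (use open_in_lambda_system in blast)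
  moreover have "sets borel = sigma_sets UNIV {S :: 'a set. open S}"
    unfolding borel_def by (rule sets_measure_of) simp
  ultimately have sub: "sets borel \<subseteq> lambda_system UNIV UNIV outer_value" by simp
  have sa: "sigma_algebra (UNIV :: 'a set) (sets borel)"
    using sets.sigma_algebra_axioms[of "borel :: 'a measure"] unfolding space_borel .
  have "measure_space UNIV (sets borel) outer_value" by (rule measure_down[OF ms sa sub])
  then have "positive (sets borel) outer_value" "countably_additive (sets borel) outer_value"
    unfolding measure_space_def by blast+
  then show ?thesis
    unfolding riesz_measure_def by (rule emeasure_measure_of_sigma[OF sa _ _ assms])
qed

end

section \<open>Regular Borel probability measures\<close>

lemma regular_borel_prob_space:
  assumes "regular_borel_prob M"
  shows "prob_space M" "sets M = sets borel" "space M = UNIV"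
  using assms sets_eq_imp_space_eq[of M borel] by (auto simp: regular_borel_prob_def)

text \<open>
  On a compact space the complement of an open set is compact; therefore outer approximation of the
  complement of A is inner approximation of A.
\<close>

lemma regular_borel_prob_outerI:
  fixes M :: "'a::t2_space measure"
  assumes K: "compact (UNIV :: 'a set)" and M: "prob_space M" "sets M = sets borel"
    and outer: "\<And>A e. A \<in> sets borel \<Longrightarrow> 0 < e \<Longrightarrow> \<exists>U. open U \<and> A \<subseteq> U \<and> measure M U \<le> measure M A + e"
  shows "regular_borel_prob M"
proof -
  interpret prob_space M by fact
  have space: "space M = UNIV" using sets_eq_imp_space_eq[OF M(2)] by simp
  have 1: "emeasure M A = (INF U\<in>{U. open U \<and> A \<subseteq> U}. emeasure M U)" if A: "A \<in> sets borel" for A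
  proof (rule ennreal_approx_INF)
    show "emeasure M A \<le> emeasure M U" if "U \<in> {U. open U \<and> A \<subseteq> U}" for U
      using that M(2) by (intro emeasure_mono) auto
    fix e :: real assume "0 < e"
    from outer[OF A this] obtain U where U: "open U" "A \<subseteq> U" "measure M U \<le> measure M A + e" by blast
    then have "emeasure M U \<le> emeasure M A + ennreal e"
      using \<open>0 < e\<close> by (simp add: emeasure_eq_measure flip: ennreal_plus)
    then show "\<exists>U\<in>{U. open U \<and> A \<subseteq> U}. emeasure M U \<le> emeasure M A + ennreal e"
      using U(1,2) by blast
  qed
  have 2: "emeasure M A = (SUP C\<in>{C. compact C \<and> C \<subseteq> A}. emeasure M C)" if A: "A \<in> sets borel" for A
  proof (rule ennreal_approx_SUP)
    show "emeasure M C \<le> emeasure M A" if "C \<in> {C. compact C \<and> C \<subseteq> A}" for C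
      using that M(2) A by (intro emeasure_mono) auto
    fix e :: real assume "0 < e"
    from outer[OF _ this, of "- A"] A obtain U
      where U: "open U" "- A \<subseteq> U" "measure M U \<le> measure M (- A) + e" by auto
    have "compact (- U)" using compact_Int_closed[OF K, of "- U"] U(1) by (simp add: closed_Compl)
    moreover have "- U \<subseteq> A" using U(2) by blast
    moreover have "measure M (- U) = 1 - measure M U" "measure M (- A) = 1 - measure M A"
      using prob_compl[of U] prob_compl[of A] A U(1) M(2) by (simp_all add: space Compl_eq_Diff_UNIV)
    then have "emeasure M A \<le> emeasure M (- U) + ennreal e"
      using U(3) \<open>0 < e\<close> by (simp add: emeasure_eq_measure flip: ennreal_plus)
    ultimately show "\<exists>C\<in>{C. compact C \<and> C \<subseteq> A}. emeasure M A \<le> emeasure M C + ennreal e" by blast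
  qed
  show ?thesis unfolding regular_borel_prob_def M(2) using 1 2 M(1) by blast
qed

lemma regular_borel_prob_innerI:
  fixes M :: "'a::t2_space measure"
  assumes K: "compact (UNIV :: 'a set)" and M: "prob_space M" "sets M = sets borel"
    and inner: "\<And>A e. A \<in> sets borel \<Longrightarrow> 0 < e \<Longrightarrow> \<exists>C. compact C \<and> C \<subseteq> A \<and> measure M A \<le> measure M C + e"
  shows "regular_borel_prob M"
proof (rule regular_borel_prob_outerI[OF K M])
  fix A :: "'a set" and e :: real assume A: "A \<in> sets borel" and e: "0 < e"
  interpret prob_space M by fact
  have space: "space M = UNIV" using sets_eq_imp_space_eq[OF M(2)] by simp
  from inner[OF _ e, of "- A"] A obtain C where
    C: "compact C" "C \<subseteq> - A" "measure M (- A) \<le> measure M C + e" by auto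
  have "closed C" using C(1) by (rule compact_imp_closed)
  moreover have "measure M (- C) = 1 - measure M C" "measure M (- A) = 1 - measure M A"
    using prob_compl[of C] prob_compl[of A] A \<open>closed C\<close> M(2) by (simp_all add: space Compl_eq_Diff_UNIV)
  ultimately show "\<exists>U. open U \<and> A \<subseteq> U \<and> measure M U \<le> measure M A + e"
    using C(2,3) by (intro exI[of _ "- C"]) auto
qed

lemma regular_borel_prob_inner:
  assumes "regular_borel_prob M" "A \<in> sets borel" "0 < e"
  shows "\<exists>C. compact C \<and> C \<subseteq> A \<and> measure M A \<le> measure M C + e"
proof -
  interpret prob_space M using assms by (simp add: regular_borel_prob_def)
  have "emeasure M A = (SUP C\<in>{C. compact C \<and> C \<subseteq> A}. emeasure M C)"
    using assms by (auto simp: regular_borel_prob_def)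
  from SUP_approx_ennreal[OF assms(3) _ this] obtain C where
    C: "compact C" "C \<subseteq> A" "emeasure M A < emeasure M C + ennreal e"
    using compact_empty by (auto simp: emeasure_eq_measure)
  then have "measure M A \<le> measure M C + e"
    using assms(3) by (simp add: emeasure_eq_measure ennreal_less_iff flip: ennreal_plus)
  then show ?thesis using C by blast
qed

text \<open>Urysohn functions squeeze in between a compact set and an open superset.\<close>

lemma regular_borel_prob_eqI:
  fixes M N :: "'a::t2_space measure"
  assumes K: "compact (UNIV :: 'a set)" and M: "regular_borel_prob M" and N: "regular_borel_prob N"
    and eq: "\<And>f. continuous_on UNIV f \<Longrightarrow> (\<And>x. 0 \<le> f x) \<Longrightarrow> (LINT x|M. f x) = (LINT x|N. f x :: real)"
  shows "M = N"
proof -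
  have le: "emeasure M U \<le> emeasure N U" if U: "open U"
    and M: "regular_borel_prob M" and N: "regular_borel_prob N"
    and eq: "\<And>f. continuous_on UNIV f \<Longrightarrow> (\<And>x. 0 \<le> f x) \<Longrightarrow> (LINT x|M. f x) = (LINT x|N. f x :: real)"
  for U :: "'a set" and M N :: "'a measure"
  proof -
    interpret M: prob_space M using regular_borel_prob_space[OF M] by simp
    interpret N: prob_space N using regular_borel_prob_space[OF N] by simp
    note sM = regular_borel_prob_space(2,3)[OF M] and sN = regular_borel_prob_space(2,3)[OF N]
    have "emeasure M C \<le> emeasure N U" if C: "compact C" "C \<subseteq> U" for C
    proof -
      obtain f where f: "continuous_on UNIV f" "\<And>x. 0 \<le> f x" "\<And>x. f x \<le> 1"
        "\<And>x. x \<in> - U \<Longrightarrow> f x = (0::real)" "\<And>x. x \<in> C \<Longrightarrow> f x = 1"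
        using Urysohn_compact_type[OF K, of "- U" C] compact_imp_closed[OF C(1)] U C(2) by blast
      have int: "integrable M f" "integrable N f"
        using integrable_continuous_compact_type[OF K f(1)] sM sN
        by (simp_all add: M.finite_measure_axioms N.finite_measure_axioms)
      have ind: "integrable M (indicator C :: _ \<Rightarrow> real)" "integrable N (indicator U :: _ \<Rightarrow> real)"
        using C(1) U sM sN
        by (auto intro!: integrable_real_indicator simp: M.emeasure_eq_measure N.emeasure_eq_measure
            compact_imp_closed borel_closed)
      have "measure M C = (LINT x|M. indicator C x)" using sM C by simp
      also have "\<dots> \<le> (LINT x|M. f x)"
        using f by (intro integral_mono int ind) (auto simp: indicator_def)
      also have "\<dots> = (LINT x|N. f x)" using f by (intro eq)
      also have "\<dots> \<le> (LINT x|N. indicator U x)"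
        using f by (intro integral_mono int ind) (auto simp: indicator_def)
      also have "\<dots> = measure N U" using sN U by simp
      finally show ?thesis by (simp add: M.emeasure_eq_measure N.emeasure_eq_measure)
    qed
    moreover have "emeasure M U = (SUP C\<in>{C. compact C \<and> C \<subseteq> U}. emeasure M C)"
      using M U by (auto simp: regular_borel_prob_def)
    ultimately show ?thesis by (auto intro: SUP_least)
  qed
  have op: "emeasure M U = emeasure N U" if "open U" for U
    using le[OF that M N eq] le[OF that N M eq[symmetric]] by (rule antisym)
  show ?thesis
  proof (rule measure_eqI)
    show sets: "sets M = sets N" using regular_borel_prob_space[OF M] regular_borel_prob_space[OF N] by simp
    fix A assume "A \<in> sets M"
    then have "emeasure M A = (INF U\<in>{U. open U \<and> A \<subseteq> U}. emeasure M U)"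
        "emeasure N A = (INF U\<in>{U. open U \<and> A \<subseteq> U}. emeasure N U)"
      using M N sets unfolding regular_borel_prob_def by blast+
    moreover have "(INF U\<in>{U. open U \<and> A \<subseteq> U}. emeasure M U) = (INF U\<in>{U. open U \<and> A \<subseteq> U}. emeasure N U)"
      by (rule INF_cong) (auto simp: op)
    ultimately show "emeasure M A = emeasure N A" by simp
  qed
qed

text \<open>
  Continuity on a compact set carrying all the mass is enough for the image measure to be regular:
  images of compact subsets of that set are compact.
\<close>

lemma regular_borel_prob_distr:
  fixes M :: "'a::t2_space measure" and h :: "'a \<Rightarrow> 'b::t2_space"
  assumes K: "compact (UNIV :: 'b set)" and M: "regular_borel_prob M"
    and S: "compact S" "measure M S = 1" and h: "continuous_on S h"
  shows "regular_borel_prob (distr (restrict_space M S) borel h)"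
proof -
  interpret prob_space M using regular_borel_prob_space[OF M] by simp
  note sM = regular_borel_prob_space(2,3)[OF M]
  have Sb: "S \<in> sets borel" using S(1) by (simp add: compact_imp_closed borel_closed)
  then have SM: "S \<inter> space M \<in> sets M" using sM by simp
  have hm: "h \<in> restrict_space M S \<rightarrow>\<^sub>M borel"
    using borel_measurable_continuous_on_restrict[OF h] sets_restrict_space_cong[OF sM(1)]
    by (simp cong: measurable_cong_sets)
  have rp: "prob_space (restrict_space M S)"
    by (rule prob_spaceI) (use S SM sM in \<open>simp add: emeasure_restrict_space space_restrict_space emeasure_eq_measure\<close>)
  let ?D = "distr (restrict_space M S) borel h"
  have D: "measure ?D A = measure M (h -` A \<inter> S)" if "A \<in> sets borel" for A
    using that hm SM sM by (simp add: measure_distr measure_restrict_space space_restrict_space Int_commute)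
  show ?thesis
  proof (rule regular_borel_prob_innerI[OF K])
    show "prob_space ?D" by (rule prob_space.prob_space_distr[OF rp hm])
    show "sets ?D = sets borel" by simp
    fix A :: "'b set" and e :: real assume A: "A \<in> sets borel" and e: "0 < e"
    have "h -` A \<inter> space (restrict_space M S) \<in> sets (restrict_space M S)"
      by (rule measurable_sets[OF hm A])
    then have A': "h -` A \<inter> S \<in> sets borel"
      using sM Sb by (auto simp: space_restrict_space sets_restrict_space_iff)
    from regular_borel_prob_inner[OF M A' e] obtain C where
      C: "compact C" "C \<subseteq> h -` A \<inter> S" "measure M (h -` A \<inter> S) \<le> measure M C + e" by blast
    have hC: "compact (h ` C)"
      using compact_continuous_image[OF continuous_on_subset[OF h] C(1)] C(2) by blast
    then have hCb: "h ` C \<in> sets borel" by (simp add: compact_imp_closed borel_closed)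
    have "measure M C \<le> measure M (h -` (h ` C) \<inter> S)"
    proof (rule finite_measure_mono)
      show "C \<subseteq> h -` h ` C \<inter> S" using C(2) by blast
      have "h -` (h ` C) \<inter> space (restrict_space M S) \<in> sets (restrict_space M S)"
        by (rule measurable_sets[OF hm hCb])
      then show "h -` h ` C \<inter> S \<in> sets M"
        using sM Sb by (auto simp: space_restrict_space sets_restrict_space_iff)
    qed
    then have "measure ?D A \<le> measure ?D (h ` C) + e" using C(3) D[OF A] D[OF hCb] by simp
    moreover have "h ` C \<subseteq> A" using C(2) by blast
    ultimately show "\<exists>C. compact C \<and> C \<subseteq> A \<and> measure ?D A \<le> measure ?D C + e" using hC by blast
  qed
qed

section \<open>Integrals against the Riesz measure\<close>

context normalized_positive_functional
begin

lemma space_riesz_measure [simp]: "space riesz_measure = UNIV"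
  unfolding riesz_measure_def by (rule space_measure_of) simp

lemma sets_riesz_measure [simp]: "sets riesz_measure = sets borel"
  using sets.sigma_sets_eq[of "borel :: 'a measure"] unfolding riesz_measure_def space_borel
  by (subst sets_measure_of) auto

lemma emeasure_riesz_open: "open U \<Longrightarrow> emeasure riesz_measure U = open_value U"
  by (simp add: emeasure_riesz_measure outer_value_open)

lemma prob_space_riesz_measure: "prob_space riesz_measure"
  by (rule prob_spaceI) (simp add: emeasure_riesz_open open_value_UNIV)

lemma regular_riesz_measure: "regular_borel_prob riesz_measure"
proof (rule regular_borel_prob_outerI[OF compact prob_space_riesz_measure])
  fix A :: "'a set" and e :: real assume A: "A \<in> sets borel" and e: "0 < e"
  interpret prob_space riesz_measure by (rule prob_space_riesz_measure)
  have "outer_value A < outer_value A + e"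
    using e emeasure_eq_measure[of A] A
    by (simp add: emeasure_riesz_measure ennreal_less_iff flip: ennreal_plus)
  from outer_value_less[OF this] obtain U where U: "open U" "A \<subseteq> U" "open_value U < outer_value A + e"
    by blast
  then have "measure riesz_measure U \<le> measure riesz_measure A + e"
    using A e by (simp add: emeasure_riesz_measure[OF A, symmetric] emeasure_riesz_open[symmetric]
        emeasure_eq_measure ennreal_less_iff flip: ennreal_plus)
  then show "\<exists>U. open U \<and> A \<subseteq> U \<and> measure riesz_measure U \<le> measure riesz_measure A + e"
    using U by blast
qed simp

lemma le_measure_riesz:
  assumes "f \<in> subordinate U" "open U"
  shows "\<Lambda> f \<le> measure riesz_measure U"
proof -
  interpret prob_space riesz_measure by (rule prob_space_riesz_measure)
  show ?thesis
    using le_open_value[OF assms(1)] by (simp add: emeasure_riesz_open[OF assms(2), symmetric] emeasure_eq_measure)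
qed

lemma integrable_riesz: "continuous_on UNIV f \<Longrightarrow> integrable riesz_measure (f :: 'a \<Rightarrow> real)"
  using integrable_continuous_compact_type[OF compact, of f riesz_measure] prob_space_riesz_measure
  by (simp add: prob_space.finite_measure)

text \<open>
  The layers \<^term>\<open>\<lambda>x. max 0 (min 1 (n * f x - j))\<close>, for j < n, add up to n f, and each is subordinate
  to the open set where n f exceeds j. The number of these sets containing x is at most n f x + 1.
\<close>

lemma riesz_upper:
  assumes f: "continuous_on UNIV f" "\<And>x. 0 \<le> f x" "\<And>x. f x \<le> 1"
  shows "\<Lambda> f \<le> (LINT x|riesz_measure. f x)"
proof (rule field_le_epsilon)
  interpret prob_space riesz_measure by (rule prob_space_riesz_measure)
  fix e :: real assume "0 < e"
  then obtain n where n: "0 < n" "1 / real n < e" using nat_approx_posE[of e] by (metis zero_less_Suc)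
  let ?n = "real n"
  let ?l = "\<lambda>j x. max 0 (min 1 (?n * f x - real j))"
  let ?U = "\<lambda>j. {x. real j < ?n * f x}"
  have layers: "(\<Sum>j<m. max 0 (min 1 (t - real j))) = min t (real m)" if "0 \<le> t" for t m
    using that by (induction m) auto
  have count: "(\<Sum>j<m. of_bool (real j < t)) \<le> min (real m) (t + 1)" if "0 \<le> t" for t :: real and m
    using that by (induction m) auto
  have U: "open (?U j)" for j using f(1) by (intro open_Collect_less continuous_intros)
  have l: "?l j \<in> subordinate (?U j)" for j
    unfolding subordinate_def using f(1) by (auto intro!: continuous_intros)
  have "(\<lambda>x. \<Sum>j<n. ?l j x) = (\<lambda>x. ?n * f x)"
    using f n by (subst layers) (auto simp: min_def mult_le_cancel_left1)
  then have "?n * \<Lambda> f = \<Lambda> (\<lambda>x. \<Sum>j<n. ?l j x)" using scale[of f ?n] f by simp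
  also have "\<dots> = (\<Sum>j<n. \<Lambda> (?l j))" using l by (intro sum) (auto simp: subordinate_def)
  also have "\<dots> \<le> (\<Sum>j<n. measure riesz_measure (?U j))" using l U by (intro sum_mono le_measure_riesz)
  also have "\<dots> = (\<Sum>j<n. LINT x|riesz_measure. indicator (?U j) x)" using U by (intro sum.cong) auto
  also have "\<dots> = (LINT x|riesz_measure. (\<Sum>j<n. indicator (?U j) x))"
    using U by (subst Bochner_Integration.integral_sum) (auto simp: emeasure_eq_measure)
  also have "\<dots> \<le> (LINT x|riesz_measure. ?n * f x + 1)"
  proof (rule integral_mono)
    show "integrable riesz_measure (\<lambda>x. \<Sum>j<n. indicator (?U j) x :: real)"
      using U by (intro Bochner_Integration.integrable_sum) (auto simp: emeasure_eq_measure)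
    show "integrable riesz_measure (\<lambda>x. ?n * f x + 1)"
      using f(1) by (intro integrable_riesz continuous_intros)
    show "(\<Sum>j<n. indicator (?U j) x) \<le> ?n * f x + 1" for x
      using count[of "?n * f x" n] f(2)[of x] by (simp add: indicator_def of_bool_def)
  qed
  also have "\<dots> = ?n * (LINT x|riesz_measure. f x) + 1"
    using integrable_riesz[OF f(1)] prob_space by simp
  finally have "\<Lambda> f \<le> (LINT x|riesz_measure. f x) + 1 / ?n" using n(1) by (simp add: field_simps)
  then show "\<Lambda> f \<le> (LINT x|riesz_measure. f x) + e" using n(2) by linarith
qed

text \<open>
  The upper estimate, applied to g and to 1 - g for a rescaled g, leaves no room for strict inequality.
\<close>

lemma integral_riesz_measure:
  assumes f: "continuous_on UNIV f" "\<And>x. 0 \<le> f x"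
  shows "(LINT x|riesz_measure. f x) = \<Lambda> f"
proof -
  interpret prob_space riesz_measure by (rule prob_space_riesz_measure)
  obtain B where B: "B > 0" "\<And>x. \<bar>f x\<bar> \<le> B" using bounded_continuous_compact_type[OF compact f(1)] by blast
  let ?g = "\<lambda>x. f x / B"
  have g: "continuous_on UNIV ?g" "\<And>x. 0 \<le> ?g x" "\<And>x. ?g x \<le> 1"
    using f B by (auto intro!: continuous_intros simp: abs_le_iff)
  have g': "continuous_on UNIV (\<lambda>x. 1 - ?g x)" using g(1) by (intro continuous_on_diff continuous_on_const)
  have "1 = \<Lambda> (\<lambda>x. ?g x + (1 - ?g x))" using one by simp
  also have "\<dots> = \<Lambda> ?g + \<Lambda> (\<lambda>x. 1 - ?g x)" using g g' by (intro add) auto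
  finally have "\<Lambda> ?g + \<Lambda> (\<lambda>x. 1 - ?g x) = 1" by simp
  moreover have "\<Lambda> ?g \<le> (LINT x|riesz_measure. ?g x)" using g by (rule riesz_upper)
  moreover have "\<Lambda> (\<lambda>x. 1 - ?g x) \<le> (LINT x|riesz_measure. 1 - ?g x)" using g g' by (intro riesz_upper) auto
  moreover have "(LINT x|riesz_measure. 1 - ?g x) = 1 - (LINT x|riesz_measure. ?g x)"
    using integrable_riesz[OF g(1)] prob_space by simp
  ultimately have "(LINT x|riesz_measure. ?g x) = \<Lambda> ?g" by simp
  moreover have "\<Lambda> ?g = \<Lambda> f / B" using scale[of f "1 / B"] f B by simp
  ultimately show ?thesis using B(1) by simp
qed

end

section \<open>Fibres of a groupoid action\<close>

context groupoid_action
begin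

lemma source_ginv: "source (ginv g) = range_of g"
  by (simp add: source_def range_of_def ginv_ginv)

lemma range_ginv: "range_of (ginv g) = source g"
  by (simp add: source_def range_of_def ginv_ginv)

lemma source_in_units: "source g \<in> units"
  by (simp add: units_def)

lemma range_in_units: "range_of g \<in> units"
  using source_in_units[of "ginv g"] by (simp add: source_ginv)

lemma q_in_units: "q x \<in> units"
  using surj_q by auto

lemma mem_fibre [simp]: "x \<in> fibre u \<longleftrightarrow> q x = u"
  by (auto simp: fibre_def)

lemma fibre_nonempty: "u \<in> units \<Longrightarrow> \<exists>x. q x = u"
  using surj_q by (metis rangeE)

lemma act_inverse: "q x = source g \<Longrightarrow> act (ginv g) (act g x) = x"
  using act_mul[of "ginv g" g x, OF source_ginv] act_unit[of "source g" x] source_in_units[of g]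
    source_def[of g] by metis

lemma act_onto_fibre:
  assumes "q y = range_of g"
  obtains x where "q x = source g" "act g x = y"
proof
  show "q (act (ginv g) y) = source g" using q_act[of "ginv g" y] assms by (simp add: source_ginv range_ginv)
  show "act g (act (ginv g) y) = y" using act_inverse[of y "ginv g"] assms by (simp add: source_ginv ginv_ginv)
qed

lemma continuous_on_q: "continuous_on UNIV q"
  using continuous_q by (simp add: continuous_map_in_subtopology)

lemma continuous_act_fibre: "continuous_on (fibre (source g)) (act g)"
proof -
  have "continuous_on (fibre (source g)) ((\<lambda>(g, x). act g x) \<circ> (\<lambda>x. (g, x)))"
    by (rule continuous_on_compose[OF _ continuous_on_subset[OF continuous_act]])
      (auto intro!: continuous_intros)
  then show ?thesis by (simp add: o_def)
qed

lemma closed_fibre: "closed (fibre u)"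
  unfolding fibre_def using continuous_closed_vimage[of "{u}" q] continuous_on_q
  by (simp add: continuous_on_eq_continuous_at)

lemma compact_fibre: "compact (fibre u)"
  using compact_Int_closed[OF compact_space closed_fibre] by simp

lemma closed_units: "closed units"
  using compact_continuous_image[OF continuous_on_q compact_space] surj_q by (simp add: compact_imp_closed)

text \<open>
  This is where openness of the anchor map enters.
\<close>

lemma open_meeting_fibres:
  assumes "open V"
  shows "open {x. fibre (q x) \<inter> V \<noteq> {}}"
proof -
  have "openin (top_of_set units) (q ` V)" using open_q assms by (simp add: open_map_def)
  then have "openin euclidean {x \<in> topspace euclidean. q x \<in> q ` V}"
    by (rule openin_continuous_map_preimage[OF continuous_q])
  moreover have "q x \<in> q ` V \<longleftrightarrow> fibre (q x) \<inter> V \<noteq> {}" for x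
    unfolding ex_in_conv[symmetric] image_iff Bex_def by (metis Int_iff mem_fibre)
  ultimately show ?thesis by simp
qed

lemma open_containing_fibres:
  assumes "open V"
  shows "open {x. fibre (q x) \<subseteq> V}"
proof -
  have "compact (- V)" using compact_Int_closed[OF compact_space, of "- V"] assms by (simp add: closed_Compl)
  then have "closed (q ` (- V))"
    using compact_continuous_image[OF continuous_on_subset[OF continuous_on_q]] compact_imp_closed by blast
  then have "closed (q -` (q ` (- V)))"
    using continuous_closed_vimage[of "q ` (- V)" q] continuous_on_q by (simp add: continuous_on_eq_continuous_at)
  moreover have "fibre (q x) \<subseteq> V \<longleftrightarrow> q x \<notin> q ` (- V)" for x
    unfolding subset_iff image_iff Bex_def mem_fibre Compl_iff by metis
  then have "{x. fibre (q x) \<subseteq> V} = - (q -` (q ` (- V)))" by auto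
  ultimately show ?thesis by (simp only: open_Compl)
qed

text \<open>
  A relation that holds between any two points of some neighbourhood of each point plays the part of
  an entourage of the uniformity of the compact space.
\<close>

definition entourage :: "('k \<Rightarrow> 'k \<Rightarrow> bool) \<Rightarrow> bool" where
  "entourage R \<longleftrightarrow> (\<forall>x. \<exists>V. open V \<and> x \<in> V \<and> (\<forall>y\<in>V. \<forall>z\<in>V. R y z))"

lemma entourage_conj:
  assumes "entourage R" "entourage S"
  shows "entourage (\<lambda>x y. R x y \<and> S x y)"
  unfolding entourage_def
proof
  fix x
  obtain V where V: "open V" "x \<in> V" "\<forall>y\<in>V. \<forall>z\<in>V. R y z"
    using assms(1) unfolding entourage_def by blast
  obtain W where W: "open W" "x \<in> W" "\<forall>y\<in>W. \<forall>z\<in>W. S y z"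
    using assms(2) unfolding entourage_def by blast
  show "\<exists>V. open V \<and> x \<in> V \<and> (\<forall>y\<in>V. \<forall>z\<in>V. R y z \<and> S y z)"
    using V W by (intro exI[of _ "V \<inter> W"]) auto
qed

lemma entourage_eventually: "entourage R \<Longrightarrow> eventually (\<lambda>x. R x x0 \<and> R x0 x) (nhds x0)"
  unfolding entourage_def eventually_nhds by metis

lemma abs_diff_less_halves: "\<bar>a - c\<bar> < e / 2 \<Longrightarrow> \<bar>b - c\<bar> < e / 2 \<Longrightarrow> \<bar>a - b\<bar> < (e :: real)"
  by linarith

lemma entourage_continuous:
  assumes "continuous_on UNIV (f :: 'k \<Rightarrow> real)" "0 < e"
  shows "entourage (\<lambda>x y. \<bar>f x - f y\<bar> < e)"
  unfolding entourage_def
proof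
  fix x
  have "open {y. \<bar>f y - f x\<bar> < e / 2}" using assms(1) by (intro open_Collect_less continuous_intros)
  then show "\<exists>V. open V \<and> x \<in> V \<and> (\<forall>y\<in>V. \<forall>z\<in>V. \<bar>f y - f z\<bar> < e)"
    using assms(2) by (intro exI[of _ "{y. \<bar>f y - f x\<bar> < e / 2}"]) (auto intro: abs_diff_less_halves)
qed

lemma entourage_finite_cover:
  assumes "entourage R"
  obtains \<V> where "finite \<V>" "\<Union>\<V> = UNIV" "\<And>V. V \<in> \<V> \<Longrightarrow> open V"
    "\<And>V y z. V \<in> \<V> \<Longrightarrow> y \<in> V \<Longrightarrow> z \<in> V \<Longrightarrow> R y z"
proof -
  let ?C = "{V. open V \<and> (\<forall>y\<in>V. \<forall>z\<in>V. R y z)}"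
  have "UNIV \<subseteq> \<Union>?C" using assms unfolding entourage_def by blast
  then obtain \<V> where "\<V> \<subseteq> ?C" "finite \<V>" "UNIV \<subseteq> \<Union>\<V>"
    using compactE[OF compact_space, of ?C] by blast
  then show ?thesis using that[of \<V>] by blast
qed

text \<open>
  Openness of the anchor map makes a fibre depend lower semicontinuously on its base point,
  compactness makes it depend upper semicontinuously.
\<close>

lemma eventually_fibres_close:
  assumes "entourage R"
  shows "eventually (\<lambda>x. (\<forall>y\<in>fibre (q x0). \<exists>z\<in>fibre (q x). R y z \<and> R z y) \<and>
      (\<forall>z\<in>fibre (q x). \<exists>y\<in>fibre (q x0). R y z \<and> R z y)) (nhds x0)"
proof -
  obtain \<V> where \<V>: "finite \<V>" "\<Union>\<V> = UNIV" "\<And>V. V \<in> \<V> \<Longrightarrow> open V"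
    "\<And>V y z. V \<in> \<V> \<Longrightarrow> y \<in> V \<Longrightarrow> z \<in> V \<Longrightarrow> R y z"
    using entourage_finite_cover[OF assms] by blast
  define \<W> where "\<W> = {V \<in> \<V>. fibre (q x0) \<inter> V \<noteq> {}}"
  have "eventually (\<lambda>x. fibre (q x) \<inter> V \<noteq> {}) (nhds x0)" if "V \<in> \<W>" for V
    using eventually_nhds_in_open[OF open_meeting_fibres, of V x0] that \<V>(3) by (simp add: \<W>_def)
  then have "eventually (\<lambda>x. \<forall>V\<in>\<W>. fibre (q x) \<inter> V \<noteq> {}) (nhds x0)"
    using \<V>(1) by (subst eventually_ball_finite_distrib) (auto simp: \<W>_def)
  moreover have "eventually (\<lambda>x. fibre (q x) \<subseteq> \<Union>\<W>) (nhds x0)"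
  proof -
    have "fibre (q x0) \<subseteq> \<Union>\<W>"
    proof
      fix y assume "y \<in> fibre (q x0)"
      moreover obtain V where "V \<in> \<V>" "y \<in> V" using \<V>(2) by blast
      ultimately show "y \<in> \<Union>\<W>" unfolding \<W>_def by blast
    qed
    moreover have "open (\<Union>\<W>)" using \<V>(3) unfolding \<W>_def by (intro open_Union) blast
    ultimately show ?thesis using eventually_nhds_in_open[OF open_containing_fibres, of "\<Union>\<W>" x0] by simp
  qed
  ultimately show ?thesis
  proof eventually_elim
    case (elim x)
    have "\<exists>z\<in>fibre (q x). R y z \<and> R z y" if y: "y \<in> fibre (q x0)" for y
    proof -
      obtain V where V: "V \<in> \<V>" "y \<in> V" using \<V>(2) by blast
      then have "V \<in> \<W>" using y unfolding \<W>_def by blast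
      then obtain z where "z \<in> fibre (q x)" "z \<in> V" using elim(1) by blast
      then show ?thesis using \<V>(4)[OF V(1)] V(2) by blast
    qed
    moreover have "\<exists>y\<in>fibre (q x0). R y z \<and> R z y" if z: "z \<in> fibre (q x)" for z
    proof -
      obtain V where V: "V \<in> \<W>" "z \<in> V" using elim(2) z by blast
      then obtain y where "y \<in> fibre (q x0)" "y \<in> V" unfolding \<W>_def by blast
      then show ?thesis using \<V>(4)[of V] V unfolding \<W>_def by blast
    qed
    ultimately show ?case by blast
  qed
qed

definition near :: "('k \<times> 'k \<Rightarrow> real) \<Rightarrow> real \<Rightarrow> 'k \<Rightarrow> 'k \<Rightarrow> bool" where
  "near \<Phi> e x y \<longleftrightarrow> (\<forall>z. \<bar>\<Phi> (x, z) - \<Phi> (y, z)\<bar> < e \<and> \<bar>\<Phi> (z, x) - \<Phi> (z, y)\<bar> < e)"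

lemma continuous_on_sections:
  assumes "continuous_on UNIV (\<Phi> :: 'k \<times> 'k \<Rightarrow> real)"
  shows "continuous_on UNIV (\<lambda>y. \<Phi> (x, y))" "continuous_on UNIV (\<lambda>y. \<Phi> (y, x))"
  by (auto intro!: continuous_on_compose2[OF assms] continuous_intros)

lemma entourage_near:
  assumes \<Phi>: "continuous_on UNIV \<Phi>" and e: "0 < e"
  shows "entourage (near \<Phi> e)"
  unfolding entourage_def
proof
  fix x
  have tube: "\<exists>V. open V \<and> x \<in> V \<and> (\<forall>y\<in>V. \<forall>z. \<bar>\<Psi> (y, z) - \<Psi> (x, z)\<bar> < e / 2)"
    if "continuous_on UNIV (\<Psi> :: 'k \<times> 'k \<Rightarrow> real)" for \<Psi>
  proof -
    define W where "W = {p. \<bar>\<Psi> p - \<Psi> (x, snd p)\<bar> < e / 2}"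
    have "continuous_on UNIV (\<lambda>p. \<Psi> (x, snd p))"
      by (rule continuous_on_compose2[OF that continuous_on_Pair[OF continuous_on_const
            continuous_on_snd[OF continuous_on_id]]]) simp
    then have W: "open W" unfolding W_def using that by (intro open_Collect_less continuous_intros)
    have "{x} \<times> UNIV \<subseteq> W" using e by (auto simp: W_def)
    from Elementary_Topology.tube_lemma[OF compact_space W this]
    obtain V where V: "x \<in> V" "open V" "V \<times> UNIV \<subseteq> W" by blast
    then have "(y, z) \<in> W" if "y \<in> V" for y z using that by blast
    then show ?thesis using V(1,2) unfolding W_def by (intro exI[of _ V]) simp
  qed
  obtain V where V: "open V" "x \<in> V" "\<And>y z. y \<in> V \<Longrightarrow> \<bar>\<Phi> (y, z) - \<Phi> (x, z)\<bar> < e / 2"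
    using tube[OF \<Phi>] by blast
  have "continuous_on UNIV (\<lambda>p. \<Phi> (snd p, fst p))"
    by (rule continuous_on_compose2[OF \<Phi> continuous_on_Pair[OF continuous_on_snd[OF continuous_on_id]
          continuous_on_fst[OF continuous_on_id]]]) simp
  from tube[OF this] obtain W where
    W: "open W" "x \<in> W" "\<And>y z. y \<in> W \<Longrightarrow> \<bar>\<Phi> (z, y) - \<Phi> (z, x)\<bar> < e / 2" by auto
  have "near \<Phi> e y z" if "y \<in> V \<inter> W" "z \<in> V \<inter> W" for y z
    unfolding near_def
  proof
    fix w
    show "\<bar>\<Phi> (y, w) - \<Phi> (z, w)\<bar> < e \<and> \<bar>\<Phi> (w, y) - \<Phi> (w, z)\<bar> < e"
      using that abs_diff_less_halves[OF V(3)[of y w] V(3)[of z w]]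
        abs_diff_less_halves[OF W(3)[of y w] W(3)[of z w]] by blast
  qed
  then show "\<exists>V. open V \<and> x \<in> V \<and> (\<forall>y\<in>V. \<forall>z\<in>V. near \<Phi> e y z)"
    using V W by (intro exI[of _ "V \<inter> W"]) auto
qed

text \<open>
  Collapsing the level sets of an invariant function to representatives produces an invariant
  quotient of the kind that ergodicity speaks about.
\<close>

lemma ergodic_invariant_constant:
  assumes erg: topologically_ergodic and f: "continuous_on UNIV (f :: 'k \<Rightarrow> real)"
    and inv: "\<And>g x. q x = source g \<Longrightarrow> f (act g x) = f x"
  shows "f x = f y"
proof -
  define r where "r = (\<lambda>x. SOME y. f y = f x)"
  have fr: "f (r x) = f x" for x unfolding r_def by (rule someI[of _ x]) simp
  have rr: "r x = r y" if "f x = f y" for x y using that by (simp add: r_def)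
  define M where "M = pullback_topology (range r) f euclideanreal"
  have top: "topspace M = range r" by (simp add: M_def topspace_pullback_topology)
  have cont: "continuous_map euclidean M r"
    unfolding M_def by (rule continuous_map_pullback') (use f in \<open>auto simp: o_def fr\<close>)
  have "compact_space M"
    using image_compactin[of euclidean UNIV M r] cont compact_space by (simp add: compact_space_def top)
  moreover have "Hausdorff_space M"
  proof -
    have "continuous_map M euclideanreal (id \<circ> f)"
      unfolding M_def by (rule continuous_map_pullback) simp
    moreover have "inj_on f (topspace M)"
    proof (rule inj_onI)
      fix a b assume "a \<in> topspace M" "b \<in> topspace M" "f a = f b"
      then obtain a' b' where "a = r a'" "b = r b'" using top by auto
      then show "a = b" using \<open>f a = f b\<close> rr[of a' b'] fr by simp
    qed
    ultimately show ?thesis using Hausdorff_space_injective_preimage[of euclideanreal M f] by simp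
  qed
  moreover have "\<forall>g. \<forall>x\<in>fibre (source g). r (act g x) = r x" by (simp add: rr[OF inv])
  moreover have "range r = topspace M" by (simp add: top)
  ultimately obtain m where "topspace M = {m}"
    using cont erg[unfolded topologically_ergodic_def, THEN spec, THEN spec, of M r] by blast
  then have "r x \<in> {m}" "r y \<in> {m}" unfolding top by blast+
  then have "r x = r y" by simp
  then show ?thesis using fr[of x] fr[of y] by simp
qed

end

section \<open>Invariant kernels\<close>

text \<open>
  The members of P are extensions of pseudometrics on the fibres to the whole square; between points of
  different fibres their values have no geometric meaning.
\<close>

locale isometric_action = groupoid_action mul ginv q act
  for mul :: "'g::t2_space \<Rightarrow> 'g \<Rightarrow> 'g" (infixl "\<cdot>" 70) and ginv :: "'g \<Rightarrow> 'g"
    and q :: "'k::t2_space \<Rightarrow> 'g" and act :: "'g \<Rightarrow> 'k \<Rightarrow> 'k" +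
  fixes P :: "('k \<times> 'k \<Rightarrow> real) set"
  assumes P_continuous: "p \<in> P \<Longrightarrow> continuous_on UNIV p"
    and P_nonneg: "p \<in> P \<Longrightarrow> 0 \<le> p z"
    and P_pseudometric: "p \<in> P \<Longrightarrow> u \<in> units \<Longrightarrow> pseudometric_on (fibre u) p"
    and P_separating: "q x = q y \<Longrightarrow> x \<noteq> y \<Longrightarrow> \<exists>p\<in>P. p (x, y) \<noteq> 0"
    and P_invariant: "p \<in> P \<Longrightarrow> q x = source g \<Longrightarrow> q y = source g \<Longrightarrow> p (act g x, act g y) = p (x, y)"

context groupoid_action
begin

lemma closed_fibre_product: "closed {(x, y). q x = q y}"
proof -
  have "continuous_on UNIV (\<lambda>z. q (fst z))" "continuous_on UNIV (\<lambda>z. q (snd z))"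
    by (rule continuous_on_compose2[OF continuous_on_q]; auto intro!: continuous_intros)+
  from closed_Collect_eq[OF this] show ?thesis by (simp add: case_prod_unfold)
qed

text \<open>
  Tietze's theorem extends each pseudometric from the fibre product to a continuous function on the
  whole square; uniform estimates are then available from compactness of the square.
\<close>

lemma pseudoisometric_imp_isometric_action:
  assumes pseudoisometric
  shows "\<exists>P. isometric_action mul ginv q act P"
proof -
  obtain P where P0: "\<forall>p\<in>P. continuous_on {(x, y). q x = q y} p"
      "\<forall>u\<in>units. (\<forall>p\<in>P. pseudometric_on (fibre u) p) \<and>
           pseudometric_topology (fibre u) P = top_of_set (fibre u)"
      "\<forall>p\<in>P. \<forall>g. \<forall>x\<in>fibre (source g). \<forall>y\<in>fibre (source g). p (act g x, act g y) = p (x, y)"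
    using assms unfolding pseudoisometric_def by (elim exE conjE)
  have P: "\<And>p. p \<in> P \<Longrightarrow> continuous_on {(x, y). q x = q y} p"
      "\<And>u p. u \<in> units \<Longrightarrow> p \<in> P \<Longrightarrow> pseudometric_on (fibre u) p"
      "\<And>u. u \<in> units \<Longrightarrow> pseudometric_topology (fibre u) P = top_of_set (fibre u)"
      "\<And>p g x y. p \<in> P \<Longrightarrow> q x = source g \<Longrightarrow> q y = source g \<Longrightarrow> p (act g x, act g y) = p (x, y)"
    using P0 by simp_all
  have sq: "compact (UNIV :: ('k \<times> 'k) set)" using compact_Times[OF compact_space compact_space] by simp
  have "\<exists>p'. continuous_on UNIV p' \<and> (\<forall>z. 0 \<le> p' z) \<and> (\<forall>x y. q x = q y \<longrightarrow> p' (x, y) = p (x, y))"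
    if p: "p \<in> P" for p
  proof -
    have "0 \<le> p z" if "z \<in> {(x, y). q x = q y}" for z
      using P(2)[OF q_in_units p] that by (auto simp: pseudometric_on_def)
    from Tietze_nonneg_compact_type[OF sq closed_fibre_product P(1)[OF p] this]
    obtain p' where "continuous_on UNIV p'" "\<And>z. 0 \<le> p' z"
      "\<And>z. z \<in> {(x, y). q x = q y} \<Longrightarrow> p' z = p z" by blast
    then show ?thesis by (intro exI[of _ p']) auto
  qed
  then obtain E where E: "\<And>p. p \<in> P \<Longrightarrow> continuous_on UNIV (E p)" "\<And>p z. p \<in> P \<Longrightarrow> 0 \<le> E p z"
      "\<And>p x y. p \<in> P \<Longrightarrow> q x = q y \<Longrightarrow> E p (x, y) = p (x, y)"
    by metis
  have sep: "\<exists>p\<in>P. p (x, y) \<noteq> 0" if xy: "q x = q y" "x \<noteq> y" for x y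
  proof (rule ccontr)
    assume "\<not> (\<exists>p\<in>P. p (x, y) \<noteq> 0)"
    then have zero: "p (x, y) = 0" if "p \<in> P" for p using that by blast
    let ?F = "fibre (q x)"
    have F: "x \<in> ?F" "y \<in> ?F" using xy by auto
    have same: "x \<in> U \<longleftrightarrow> y \<in> U"
      if "generate_topology_on (insert ?F {{y \<in> ?F. p (x, y) < e} | p x e. p \<in> P \<and> x \<in> ?F \<and> e > 0}) U" for U
      using that
    proof induction
      case (Basis S)
      show ?case
      proof (cases "S = ?F")
        case False
        then obtain p z e where S: "S = {y \<in> ?F. p (z, y) < e}" "p \<in> P" "z \<in> ?F" using Basis by auto
        note pm = P(2)[OF q_in_units S(2), of x, unfolded pseudometric_on_def]
        have "p (z, y) \<le> p (z, x) + p (x, y)" "p (z, x) \<le> p (z, y) + p (y, x)" "p (y, x) = p (x, y)"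
          using pm F S(3) by blast+
        then show ?thesis using S F zero[OF S(2)] by auto
      qed (use F in simp)
    qed auto
    obtain U where U: "open U" "x \<in> U" "y \<notin> U" using hausdorff[OF xy(2)] by blast
    have "openin (top_of_set ?F) (?F \<inter> U)" using U(1) by (simp add: openin_open_Int)
    then have "openin (pseudometric_topology ?F P) (?F \<inter> U)" using P(3)[OF q_in_units] by simp
    then have "x \<in> ?F \<inter> U \<longleftrightarrow> y \<in> ?F \<inter> U"
      unfolding pseudometric_topology_def openin_topology_generated_by_iff by (rule same)
    then show False using U F by blast
  qed
  have "isometric_action mul ginv q act (E ` P)"
  proof
    fix p assume "p \<in> E ` P"
    then obtain p0 where p: "p0 \<in> P" "p = E p0" by blast
    show "continuous_on UNIV p" "0 \<le> p z" for z using E p by auto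
    show "pseudometric_on (fibre u) p" if "u \<in> units" for u
      using P(2)[OF that p(1)] E(3)[OF p(1)] p(2) by (simp add: pseudometric_on_def)
    show "p (act g x, act g y) = p (x, y)" if "q x = source g" "q y = source g" for g x y
      using P(4)[OF p(1) that] E(3)[OF p(1)] p(2) that q_act[of g] by simp
  next
    show "\<exists>p\<in>E ` P. p (x, y) \<noteq> 0" if "q x = q y" "x \<noteq> y" for x y
      using sep[OF that] E(3) that by auto
  qed
  then show ?thesis by blast
qed

definition invariant_kernel :: "('k \<times> 'k \<Rightarrow> real) \<Rightarrow> bool" where
  "invariant_kernel k \<longleftrightarrow> continuous_on UNIV k \<and> (\<forall>z. 0 \<le> k z) \<and> (\<forall>x. 0 < k (x, x)) \<and>
     (\<forall>x y. q x = q y \<longrightarrow> k (x, y) = k (y, x)) \<and>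
     (\<forall>g x y. q x = source g \<longrightarrow> q y = source g \<longrightarrow> k (act g x, act g y) = k (x, y))"

lemma invariant_kernelD:
  assumes "invariant_kernel k"
  shows "continuous_on UNIV k" "\<And>z. 0 \<le> k z" "\<And>x. 0 < k (x, x)" "\<And>x y. q x = q y \<Longrightarrow> k (x, y) = k (y, x)"
    "\<And>g x y. q x = source g \<Longrightarrow> q y = source g \<Longrightarrow> k (act g x, act g y) = k (x, y)"
proof -
  note a = assms[unfolded invariant_kernel_def]
  show "continuous_on UNIV k" by (rule a[THEN conjunct1])
  show "\<And>z. 0 \<le> k z" by (rule a[THEN conjunct2, THEN conjunct1, rule_format])
  show "\<And>x. 0 < k (x, x)" by (rule a[THEN conjunct2, THEN conjunct2, THEN conjunct1, rule_format])
  show "\<And>x y. q x = q y \<Longrightarrow> k (x, y) = k (y, x)"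
    by (rule a[THEN conjunct2, THEN conjunct2, THEN conjunct2, THEN conjunct1, rule_format])
  show "\<And>g x y. q x = source g \<Longrightarrow> q y = source g \<Longrightarrow> k (act g x, act g y) = k (x, y)"
    by (rule a[THEN conjunct2, THEN conjunct2, THEN conjunct2, THEN conjunct2, rule_format])
qed

text \<open>The kernel is supported so close to the diagonal of each fibre that f does not vary by e on its support.\<close>

definition concentrated :: "('k \<Rightarrow> real) \<Rightarrow> real \<Rightarrow> ('k \<times> 'k \<Rightarrow> real) \<Rightarrow> bool" where
  "concentrated f e k \<longleftrightarrow> (\<forall>x y. q x = q y \<longrightarrow> 0 < k (x, y) \<longrightarrow> \<bar>f x - f y\<bar> < e)"

end

context isometric_action
begin

text \<open>
  A tent of height e around the diagonal, at the scale of the pseudometric that is the sum over F.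
\<close>

definition bump :: "('k \<times> 'k \<Rightarrow> real) set \<times> real \<Rightarrow> 'k \<times> 'k \<Rightarrow> real" where
  "bump = (\<lambda>(F, e) z. max 0 (e - (\<Sum>p\<in>F. p z)))"

text \<open>
  Kernels become finer when more pseudometrics are taken into account and when the radius shrinks.
\<close>

definition kernel_filter :: "('k \<times> 'k \<Rightarrow> real) filter" where
  "kernel_filter = filtermap bump (prod_filter (finite_subsets_at_top P) (at_right 0))"

lemma kernel_filter_neq_bot: "kernel_filter \<noteq> bot"
  by (simp add: kernel_filter_def filtermap_bot_iff prod_filter_eq_bot trivial_limit_at_right_real)

lemma invariant_bump:
  assumes "finite F" "F \<subseteq> P" "0 < e"
  shows "invariant_kernel (bump (F, e))"
  unfolding invariant_kernel_def bump_def prod.case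
proof (intro conjI allI impI)
  show "continuous_on UNIV (\<lambda>z. max 0 (e - (\<Sum>p\<in>F. p z)))"
    using assms P_continuous by (intro continuous_intros) auto
  show "0 \<le> max 0 (e - (\<Sum>p\<in>F. p z))" for z by simp
  show "0 < max 0 (e - (\<Sum>p\<in>F. p (x, x)))" for x
  proof -
    have "p (x, x) = 0" if "p \<in> F" for p
      using P_pseudometric[of p "q x"] that assms q_in_units by (auto simp: pseudometric_on_def)
    then have "(\<Sum>p\<in>F. p (x, x)) = 0" by (intro sum.neutral) blast
    then show ?thesis using assms(3) by simp
  qed
  show "max 0 (e - (\<Sum>p\<in>F. p (x, y))) = max 0 (e - (\<Sum>p\<in>F. p (y, x)))" if "q x = q y" for x y
  proof -
    have "p (x, y) = p (y, x)" if "p \<in> F" for p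
      using P_pseudometric[of p "q x"] that assms q_in_units \<open>q x = q y\<close> by (auto simp: pseudometric_on_def)
    then have "(\<Sum>p\<in>F. p (x, y)) = (\<Sum>p\<in>F. p (y, x))" by (intro sum.cong refl)
    then show ?thesis by (rule arg_cong)
  qed
  show "max 0 (e - (\<Sum>p\<in>F. p (act g x, act g y))) = max 0 (e - (\<Sum>p\<in>F. p (x, y)))"
    if "q x = source g" "q y = source g" for g x y
  proof -
    have "(\<Sum>p\<in>F. p (act g x, act g y)) = (\<Sum>p\<in>F. p (x, y))"
      using P_invariant[OF _ that] assms(2) by (intro sum.cong refl) blast
    then show ?thesis by (rule arg_cong)
  qed
qed

lemma eventually_kernel_filter:
  assumes "finite F0" "F0 \<subseteq> P" "0 < e0"
    and "\<And>F e. finite F \<Longrightarrow> F0 \<subseteq> F \<Longrightarrow> F \<subseteq> P \<Longrightarrow> 0 < e \<Longrightarrow> e < e0 \<Longrightarrow> Q (bump (F, e))"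
  shows "eventually Q kernel_filter"
  unfolding kernel_filter_def eventually_filtermap eventually_prod_filter
proof (intro exI conjI allI impI)
  show "\<forall>\<^sub>F F in finite_subsets_at_top P. finite F \<and> F0 \<subseteq> F \<and> F \<subseteq> P"
    using assms(1,2) by (auto simp: eventually_finite_subsets_at_top)
  show "\<forall>\<^sub>F e in at_right (0::real). 0 < e \<and> e < e0"
    using eventually_at_right_less[of 0] assms(3)
    by (intro eventually_conj eventually_at_right_real eventually_mono[OF eventually_at_right_real[OF assms(3)]]) auto
qed (use assms(4) in auto)

lemma eventually_invariant_kernel: "eventually invariant_kernel kernel_filter"
  by (rule eventually_kernel_filter[of "{}" 1]) (auto intro: invariant_bump)

text \<open>
  The pairs in a common fibre on which f oscillates by at least e form a compact set. Finitely many of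
  the pseudometrics have a sum that is positive, hence bounded away from 0, on it.
\<close>

lemma eventually_concentrated:
  assumes f: "continuous_on UNIV f" and e: "0 < e"
  shows "eventually (concentrated f e) kernel_filter"
proof -
  define B where "B = {(x, y). q x = q y} \<inter> {z. e \<le> \<bar>f (fst z) - f (snd z)\<bar>}"
  have sq: "compact (UNIV :: ('k \<times> 'k) set)" using compact_Times[OF compact_space compact_space] by simp
  have "continuous_on UNIV (\<lambda>z. f (fst z))" "continuous_on UNIV (\<lambda>z. f (snd z))"
    by (rule continuous_on_compose2[OF f]; auto intro!: continuous_intros)+
  then have "closed {z. e \<le> \<bar>f (fst z) - f (snd z)\<bar>}" by (intro closed_Collect_le continuous_intros)
  then have "closed B" unfolding B_def by (intro closed_Int closed_fibre_product)
  then have B: "compact B" using compact_Int_closed[OF sq] by simp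
  have "B \<subseteq> (\<Union>p\<in>P. {z. 0 < p z})"
  proof
    fix z assume "z \<in> B"
    then obtain x y where z: "z = (x, y)" "q x = q y" "e \<le> \<bar>f x - f y\<bar>"
      by (cases z) (simp add: B_def)
    then have "x \<noteq> y" using e by auto
    then obtain p where "p \<in> P" "p z \<noteq> 0" using P_separating z by blast
    then have "0 < p z" using P_nonneg[of p z] by simp
    then show "z \<in> (\<Union>p\<in>P. {z. 0 < p z})" using \<open>p \<in> P\<close> by blast
  qed
  moreover have "open {z. 0 < p z}" if "p \<in> P" for p
    using P_continuous[OF that] by (intro open_Collect_less continuous_intros)
  ultimately obtain F0 where F0: "F0 \<subseteq> P" "finite F0" "B \<subseteq> (\<Union>p\<in>F0. {z. 0 < p z})"
    using compactE_image[OF B, of P "\<lambda>p. {z. 0 < p z}"] by blast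
  have pos: "0 < (\<Sum>p\<in>F0. p z)" if "z \<in> B" for z
  proof -
    obtain p where "p \<in> F0" "0 < p z" using F0(3) \<open>z \<in> B\<close> by blast
    then show ?thesis using F0(1,2) P_nonneg by (intro sum_pos2[of _ p]) blast+
  qed
  have "\<exists>e0>0. \<forall>z\<in>B. e0 \<le> (\<Sum>p\<in>F0. p z)"
  proof (cases "B = {}")
    case False
    have "continuous_on B (\<lambda>z. \<Sum>p\<in>F0. p z)"
      using P_continuous F0(1) by (intro continuous_on_sum) (auto intro: continuous_on_subset)
    from continuous_attains_inf[OF B False this] show ?thesis using pos by metis
  qed (auto intro: exI[of _ 1])
  then obtain e0 where e0: "e0 > 0" "\<And>z. z \<in> B \<Longrightarrow> e0 \<le> (\<Sum>p\<in>F0. p z)" by blast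
  show ?thesis
  proof (rule eventually_kernel_filter[OF F0(2,1) e0(1)])
    fix F d assume F: "finite F" "F0 \<subseteq> F" "F \<subseteq> P" "0 < d" "d < e0"
    show "concentrated f e (bump (F, d))"
      unfolding concentrated_def
    proof (intro allI impI)
      fix x y assume xy: "q x = q y" "0 < bump (F, d) (x, y)"
      have "(\<Sum>p\<in>F0. p (x, y)) \<le> (\<Sum>p\<in>F. p (x, y))" using F P_nonneg by (intro sum_mono2) blast+
      then have "(\<Sum>p\<in>F0. p (x, y)) < e0" using xy(2) F by (simp add: bump_def)
      then have "(x, y) \<notin> B" using e0(2) by fastforce
      then show "\<bar>f x - f y\<bar> < e" using xy(1) by (simp add: B_def)
    qed
  qed
qed

end

section \<open>Covering functionals\<close>

lemma member_le_sum_list_nonneg: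
  fixes xs :: "real list"
  shows "x \<in> set xs \<Longrightarrow> (\<And>y. y \<in> set xs \<Longrightarrow> 0 \<le> y) \<Longrightarrow> x \<le> sum_list xs"
proof (induction xs)
  case (Cons a xs)
  have "0 \<le> sum_list xs" using Cons.prems(2) by (intro sum_list_nonneg) auto
  moreover have "0 \<le> a" using Cons.prems(2) by simp
  moreover have "x \<le> sum_list xs" if "x \<in> set xs"
    by (rule Cons.IH[OF that]) (use Cons.prems(2) in simp)
  ultimately show ?case using Cons.prems(1) by fastforce
qed simp

context groupoid_action
begin

text \<open>
  A list of weights and points of a fibre stands for the combination of translates of the kernel.
  As in Weil's construction of Haar measure, the least total weight that is needed to dominate f
  measures the size of f relative to the kernel.
\<close>

definition combination :: "('k \<times> 'k \<Rightarrow> real) \<Rightarrow> (real \<times> 'k) list \<Rightarrow> 'k \<Rightarrow> real" where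
  "combination k L y = (\<Sum>(c, x)\<leftarrow>L. c * k (x, y))"

definition cost :: "(real \<times> 'k) list \<Rightarrow> real" where
  "cost L = (\<Sum>(c, x)\<leftarrow>L. c)"

definition covers :: "('k \<times> 'k \<Rightarrow> real) \<Rightarrow> 'g \<Rightarrow> ('k \<Rightarrow> real) \<Rightarrow> (real \<times> 'k) list \<Rightarrow> bool" where
  "covers k u f L \<longleftrightarrow> (\<forall>(c, x)\<in>set L. 0 \<le> c \<and> q x = u) \<and> (\<forall>y\<in>fibre u. f y \<le> combination k L y)"

definition cov :: "('k \<times> 'k \<Rightarrow> real) \<Rightarrow> 'g \<Rightarrow> ('k \<Rightarrow> real) \<Rightarrow> real" where
  "cov k u f = Inf (cost ` {L. covers k u f L})"

lemma combination_append: "combination k (L @ L') y = combination k L y + combination k L' y"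
  by (simp add: combination_def)

lemma cost_append: "cost (L @ L') = cost L + cost L'"
  by (simp add: cost_def)

lemma cost_nonneg: "(\<forall>(c, x)\<in>set L. 0 \<le> c) \<Longrightarrow> 0 \<le> cost L"
  unfolding cost_def by (rule sum_list_nonneg) auto

lemma combination_map:
  "combination k (map (\<lambda>(c, x). (a * c, x)) L) y = a * combination k L y"
  "cost (map (\<lambda>(c, x). (a * c, x)) L) = a * cost L"
  by (induction L) (auto simp: combination_def cost_def algebra_simps)

text \<open>
  For moving combinations between fibres; two different kernels are allowed so that a kernel can also be
  compared with the constant 0.
\<close>

lemma combination_perturb:
  assumes "\<forall>(c, x)\<in>set L. 0 \<le> c \<and> k (x, y) \<le> k' (t x, y') + e"
  shows "combination k L y \<le> combination k' (map (\<lambda>(c, x). (c, t x)) L) y' + cost L * e"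
  using assms
proof (induction L)
  case (Cons p L)
  obtain c x where p: "p = (c, x)" by fastforce
  have "c * k (x, y) \<le> c * (k' (t x, y') + e)" using Cons.prems p by (intro mult_left_mono) auto
  then show ?case using Cons p by (simp add: combination_def cost_def algebra_simps)
qed (simp add: combination_def cost_def)

lemma combination_perturb_abs:
  assumes "\<And>c x. (c, x) \<in> set L \<Longrightarrow> 0 \<le> c" "\<And>c x. (c, x) \<in> set L \<Longrightarrow> \<bar>k (x, y) - k (t x, y')\<bar> \<le> e"
  shows "\<bar>combination k L y - combination k (map (\<lambda>(c, x). (c, t x)) L) y'\<bar> \<le> cost L * e"
  using assms
proof (induction L)
  case (Cons p L)
  obtain c x where p: "p = (c, x)" by fastforce
  have IH: "\<bar>combination k L y - combination k (map (\<lambda>(c, x). (c, t x)) L) y'\<bar> \<le> cost L * e"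
    by (rule Cons.IH) (use Cons.prems in \<open>auto intro: Cons.prems\<close>)
  have "\<bar>c * k (x, y) - c * k (t x, y')\<bar> = c * \<bar>k (x, y) - k (t x, y')\<bar>"
    using Cons.prems(1)[of c x] p by (simp add: abs_mult flip: right_diff_distrib)
  also have "\<dots> \<le> c * e" using Cons.prems[of c x] p by (intro mult_left_mono) auto
  finally have c: "\<bar>c * k (x, y) - c * k (t x, y')\<bar> \<le> c * e" .
  have "combination k (p # L) y - combination k (map (\<lambda>(c, x). (c, t x)) (p # L)) y'
      = (c * k (x, y) - c * k (t x, y')) + (combination k L y - combination k (map (\<lambda>(c, x). (c, t x)) L) y')"
    by (simp add: p combination_def)
  also have "\<bar>\<dots>\<bar> \<le> c * e + cost L * e"
    using abs_triangle_ineq c IH by (rule order_trans[OF _ add_mono])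
  finally show ?case by (simp add: p cost_def distrib_right)
qed (simp add: combination_def cost_def)

lemma cost_map_points: "cost (map (\<lambda>(c, x). (c, t x)) L) = cost L"
  by (induction L) (auto simp: cost_def)

lemma coversD:
  assumes "covers k u f L"
  shows "q y = u \<Longrightarrow> f y \<le> combination k L y" "(c, x) \<in> set L \<Longrightarrow> 0 \<le> c" "(c, x) \<in> set L \<Longrightarrow> q x = u"
  using assms unfolding covers_def by auto

lemma covers_cost_nonneg: "covers k u f L \<Longrightarrow> 0 \<le> cost L"
  by (rule cost_nonneg) (auto simp: covers_def)

lemma cov_le_cost: "covers k u f L \<Longrightarrow> cov k u f \<le> cost L"
  unfolding cov_def by (rule cInf_lower) (auto intro!: bdd_belowI[of _ 0] covers_cost_nonneg)

lemma covers_mono: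
  assumes "covers k u g L" "\<And>y. q y = u \<Longrightarrow> f y \<le> g y"
  shows "covers k u f L"
proof -
  have "f y \<le> combination k L y" if "q y = u" for y
    using assms(2)[OF that] coversD(1)[OF assms(1) that] by (rule order_trans)
  then show ?thesis using assms(1) by (simp add: covers_def)
qed

lemma covers_cong: "(\<And>y. q y = u \<Longrightarrow> f y = g y) \<Longrightarrow> covers k u f L \<longleftrightarrow> covers k u g L"
  unfolding covers_def by simp

lemma cov_cong: "(\<And>y. q y = u \<Longrightarrow> f y = g y) \<Longrightarrow> cov k u f = cov k u g"
  using covers_cong[of u f g k] by (simp add: cov_def)

lemma covers_scale: "covers k u f L \<Longrightarrow> 0 \<le> a \<Longrightarrow> covers k u (\<lambda>y. a * f y) (map (\<lambda>(c, x). (a * c, x)) L)"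
  unfolding covers_def by (auto simp: combination_map intro: mult_left_mono)

lemma covers_append: "covers k u f L \<Longrightarrow> covers k u g L' \<Longrightarrow> covers k u (\<lambda>y. f y + g y) (L @ L')"
  unfolding covers_def by (auto simp: combination_append intro: add_mono)

text \<open>
  Finitely many open sets cover the whole space on whose squares the kernel is at least half of its minimum on
  the diagonal. One point of the fibre in each of those that meet the fibre gives a cover, whose cost is
  bounded by a multiple of the number of the open sets.
\<close>

lemma uniform_cover:
  assumes k: "invariant_kernel k"
  obtains B where "B > 0" "\<And>u. \<exists>L. covers k u (\<lambda>_. 1) L \<and> cost L \<le> B"
proof -
  note kc = invariant_kernelD(1)[OF k] and k0 = invariant_kernelD(2)[OF k] and kd = invariant_kernelD(3)[OF k]
  have "continuous_on UNIV (\<lambda>x. k (x, x))"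
    by (rule continuous_on_compose2[OF kc continuous_on_Pair[OF continuous_on_id continuous_on_id]]) simp
  from continuous_attains_inf[OF compact_space _ this] obtain x1 where x1: "\<And>x. k (x1, x1) \<le> k (x, x)" by auto
  define m where "m = k (x1, x1)"
  have m: "m > 0" "\<And>x. m \<le> k (x, x)" using x1 kd by (auto simp: m_def)
  have "entourage (near k (m / 2))" using entourage_near[OF kc] m by simp
  then obtain \<V> where \<V>: "finite \<V>" "\<Union>\<V> = UNIV"
    "\<And>V y z. V \<in> \<V> \<Longrightarrow> y \<in> V \<Longrightarrow> z \<in> V \<Longrightarrow> near k (m / 2) y z"
    using entourage_finite_cover by metis
  obtain Vs where Vs: "set Vs = \<V>" using finite_list[OF \<V>(1)] by blast
  have "\<exists>L. covers k u (\<lambda>_. 1) L \<and> cost L \<le> 2 / m * length Vs" for u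
  proof (intro exI conjI)
    let ?W = "filter (\<lambda>V. fibre u \<inter> V \<noteq> {}) Vs"
    let ?x = "\<lambda>V. SOME x. x \<in> fibre u \<inter> V"
    let ?L = "map (\<lambda>V. (2 / m, ?x V)) ?W"
    have x: "?x V \<in> fibre u \<inter> V" if "fibre u \<inter> V \<noteq> {}" for V
      using that by (intro some_in_eq[THEN iffD2])
    show "cost ?L \<le> 2 / m * length Vs"
      using m(1) by (simp add: cost_def o_def sum_list_triv divide_right_mono)
    show "covers k u (\<lambda>_. 1) ?L"
      unfolding covers_def
    proof (intro conjI ballI)
      fix p assume "p \<in> set ?L"
      then obtain V where "p = (2 / m, ?x V)" "fibre u \<inter> V \<noteq> {}" by auto
      then show "case p of (c, x) \<Rightarrow> 0 \<le> c \<and> q x = u" using x[of V] m(1) by simp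
    next
      fix y assume y: "y \<in> fibre u"
      obtain V where V: "V \<in> \<V>" "y \<in> V" using \<V>(2) by blast
      then have V': "V \<in> set ?W" "fibre u \<inter> V \<noteq> {}" using y Vs by auto
      have "near k (m / 2) (?x V) y" using x[OF V'(2)] V by (intro \<V>(3)) auto
      then have "\<bar>k (?x V, y) - k (y, y)\<bar> < m / 2" unfolding near_def by blast
      then have "m / 2 \<le> k (?x V, y)" using m(2)[of y] by linarith
      then have "1 \<le> 2 / m * k (?x V, y)" using m(1) by (simp add: field_simps)
      also have "\<dots> \<le> sum_list (map (\<lambda>V. 2 / m * k (?x V, y)) ?W)"
        using V'(1) m(1) k0 by (intro member_le_sum_list_nonneg) auto
      also have "\<dots> = combination k ?L y" by (simp add: combination_def o_def)
      finally show "1 \<le> combination k ?L y" .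
    qed
  qed
  moreover have "Vs \<noteq> []" using \<V>(2) Vs by auto
  then have "0 < 2 / m * length Vs" using m(1) by simp
  ultimately show ?thesis using that by blast
qed

lemma covers_exists:
  assumes "invariant_kernel k" "\<And>y. q y = u \<Longrightarrow> f y \<le> b"
  shows "\<exists>L. covers k u f L"
proof -
  obtain L where L: "covers k u (\<lambda>_. 1) L" using uniform_cover[OF assms(1)] by metis
  have "f y \<le> max 0 b * 1" if "q y = u" for y using assms(2)[OF that] by simp
  then have "covers k u f (map (\<lambda>(c, x). (max 0 b * c, x)) L)"
    by (intro covers_mono[OF covers_scale[OF L]]) auto
  then show ?thesis by blast
qed

lemma cov_approx:
  assumes "covers k u f L0" "0 < e"
  obtains L where "covers k u f L" "cost L < cov k u f + e"
proof -
  have "cost ` {L. covers k u f L} \<noteq> {}" using assms(1) by blast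
  from cInf_lessD[OF this, of "cov k u f + e"] show ?thesis using assms(2) that by (auto simp: cov_def)
qed

lemma cov_greatest:
  assumes "covers k u f L0" "\<And>L. covers k u f L \<Longrightarrow> a \<le> cost L"
  shows "a \<le> cov k u f"
  unfolding cov_def by (rule cInf_greatest) (use assms in auto)

lemma cov_nonneg: "covers k u f L \<Longrightarrow> 0 \<le> cov k u f"
  by (erule cov_greatest) (rule covers_cost_nonneg)

lemma cov_mono:
  assumes "covers k u g L" "\<And>y. q y = u \<Longrightarrow> f y \<le> g y"
  shows "cov k u f \<le> cov k u g"
  by (rule cov_greatest[OF assms(1)]) (rule cov_le_cost, erule covers_mono[OF _ assms(2)])

lemma cov_add:
  assumes "covers k u f L" "covers k u g L'"
  shows "cov k u (\<lambda>y. f y + g y) \<le> cov k u f + cov k u g"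
proof (rule field_le_epsilon)
  fix e :: real assume e: "0 < e"
  obtain M where M: "covers k u f M" "cost M < cov k u f + e / 2" using cov_approx[OF assms(1), of "e / 2"] e by auto
  obtain N where N: "covers k u g N" "cost N < cov k u g + e / 2" using cov_approx[OF assms(2), of "e / 2"] e by auto
  show "cov k u (\<lambda>y. f y + g y) \<le> cov k u f + cov k u g + e"
    using cov_le_cost[OF covers_append[OF M(1) N(1)]] M(2) N(2) by (simp add: cost_append)
qed

lemma cov_scale_le:
  assumes "covers k u f L" "0 \<le> a"
  shows "cov k u (\<lambda>y. a * f y) \<le> a * cov k u f"
proof (rule field_le_epsilon)
  fix e :: real assume e: "0 < e"
  then have "0 < e / (a + 1)" using assms(2) by simp
  from cov_approx[OF assms(1) this] obtain M where M: "covers k u f M" "cost M < cov k u f + e / (a + 1)" .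
  have "cov k u (\<lambda>y. a * f y) \<le> a * cost M"
    using cov_le_cost[OF covers_scale[OF M(1) assms(2)]] by (simp add: combination_map)
  also have "\<dots> \<le> a * (cov k u f + e / (a + 1))" using M(2) assms(2) by (intro mult_left_mono) auto
  also have "\<dots> \<le> a * cov k u f + e"
  proof -
    have "a * (e / (a + 1)) \<le> e" using assms(2) e by (simp add: field_simps)
    then show ?thesis by (simp add: distrib_left)
  qed
  finally show "cov k u (\<lambda>y. a * f y) \<le> a * cov k u f + e" .
qed

lemma cov_scale:
  assumes "covers k u f L" "0 < a"
  shows "cov k u (\<lambda>y. a * f y) = a * cov k u f"
proof (rule antisym)
  show "cov k u (\<lambda>y. a * f y) \<le> a * cov k u f" using cov_scale_le assms by simp
  have "cov k u (\<lambda>y. (1 / a) * (a * f y)) \<le> (1 / a) * cov k u (\<lambda>y. a * f y)"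
    using cov_scale_le[OF covers_scale[OF assms(1), of a], of "1 / a"] assms(2) by simp
  then show "a * cov k u f \<le> cov k u (\<lambda>y. a * f y)" using assms(2) by (simp add: field_simps)
qed

text \<open>
  The kernel is bounded by some M, so a combination of cost c is at most c M, which must reach 1.
\<close>

lemma cov_one_pos:
  assumes k: "invariant_kernel k" and u: "u \<in> units"
  shows "0 < cov k u (\<lambda>_. 1)"
proof -
  note kc = invariant_kernelD(1)[OF k]
  have sq: "compact (UNIV :: ('k \<times> 'k) set)" using compact_Times[OF compact_space compact_space] by simp
  obtain M where M: "M > 0" "\<And>z. \<bar>k z\<bar> \<le> M" using bounded_continuous_compact_type[OF sq kc] by blast
  obtain y where y: "q y = u" using fibre_nonempty[OF u] by blast
  obtain L0 where L0: "covers k u (\<lambda>_. 1) L0" using uniform_cover[OF k] by metis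
  have "1 / M \<le> cov k u (\<lambda>_. 1)"
  proof (rule cov_greatest[OF L0])
    fix L assume L: "covers k u (\<lambda>_. 1) L"
    have "combination k L y \<le> combination (\<lambda>_. 0) (map (\<lambda>(c, x). (c, x)) L) y + cost L * M"
      using L M(2) by (intro combination_perturb) (auto simp: covers_def abs_le_iff)
    also have "combination (\<lambda>_. 0) (map (\<lambda>(c, x). (c, x)) L) y = 0"
      by (simp add: combination_def case_prod_unfold sum_list_triv)
    finally have "1 \<le> cost L * M" using coversD(1)[OF L y] by simp
    then show "1 / M \<le> cost L" using M(1) by (simp add: field_simps)
  qed
  then show ?thesis using M(1) by (meson divide_pos_pos less_le_trans zero_less_one)
qed

text \<open>
  Acting on the points of a cover gives a cover of the same cost in the target fibre.
\<close>

lemma cov_act_le: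
  assumes k: "invariant_kernel k" and f: "\<And>x. q x = source g \<Longrightarrow> f' x = f (act g x)"
    and L0: "covers k (source g) f' L0"
  shows "cov k (range_of g) f \<le> cov k (source g) f'"
proof (rule cov_greatest[OF L0])
  fix L assume L: "covers k (source g) f' L"
  let ?L = "map (\<lambda>(c, x). (c, act g x)) L"
  have "covers k (range_of g) f ?L"
    unfolding covers_def
  proof (intro conjI ballI)
    fix p assume "p \<in> set ?L"
    then show "case p of (c, x) \<Rightarrow> 0 \<le> c \<and> q x = range_of g" using L q_act by (auto simp: covers_def)
  next
    fix y assume "y \<in> fibre (range_of g)"
    then obtain x where x: "q x = source g" "act g x = y" using act_onto_fibre[of y g] by auto
    have "combination k L x \<le> combination k ?L y + cost L * 0"
      using L invariant_kernelD(5)[OF k _ x(1)] x(2) by (intro combination_perturb) (auto simp: covers_def)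
    then show "f y \<le> combination k ?L y" using coversD(1)[OF L x(1)] x(2) f[OF x(1)] by simp
  qed
  then show "cov k (range_of g) f \<le> cost L" using cov_le_cost cost_map_points by metis
qed

lemma cov_act:
  assumes k: "invariant_kernel k" and f: "\<And>x. q x = source g \<Longrightarrow> f' x = f (act g x)"
    and b: "\<And>x. f' x \<le> b'" "\<And>x. f x \<le> b"
  shows "cov k (range_of g) f = cov k (source g) f'"
proof (rule antisym)
  obtain L where "covers k (source g) f' L" using covers_exists[OF k, of "source g" f'] b(1) by blast
  then show "cov k (range_of g) f \<le> cov k (source g) f'"
    using f by (intro cov_act_le[OF k])
  have f': "f y = f' (act (ginv g) y)" if y: "q y = source (ginv g)" for y
    using f[of "act (ginv g) y"] act_inverse[OF y] q_act[of "ginv g" y] y by (simp add: ginv_ginv range_ginv)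
  obtain L' where L': "covers k (source (ginv g)) f L'"
    using covers_exists[OF k, of "source (ginv g)" f] b(2) by blast
  have "cov k (range_of (ginv g)) f' \<le> cov k (source (ginv g)) f"
    by (rule cov_act_le[OF k f' L'])
  then show "cov k (source g) f' \<le> cov k (range_of g) f" by (simp only: range_ginv source_ginv)
qed

text \<open>
  Moving the points of a cover to the nearby fibre loses at most 2 e in each kernel value and 2 e in \<open>\<psi>\<close>; a
  multiple of a cover of the constant 1 makes up for the total loss.
\<close>

lemma cov_transfer:
  assumes k: "invariant_kernel k" and \<psi>: "\<And>z. 0 \<le> \<psi> z"
    and B: "B > 0" "\<And>u. \<exists>L. covers k u (\<lambda>_. 1) L \<and> cost L \<le> B"
    and e: "0 < e" and x: "near \<psi> e x x'"
    and fwd: "\<And>y. q y = u \<Longrightarrow> \<exists>z. q z = u' \<and> near k e y z"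
    and bwd: "\<And>z. q z = u' \<Longrightarrow> \<exists>y. q y = u \<and> near k e y z \<and> near \<psi> e y z"
    and L: "covers k u (\<lambda>y. \<psi> (x, y)) L"
  shows "cov k u' (\<lambda>y. \<psi> (x', y)) \<le> cost L + (2 * cost L + 2) * e * B"
proof -
  obtain t where t: "\<And>y. q y = u \<Longrightarrow> q (t y) = u' \<and> near k e y (t y)" using fwd by metis
  let ?L = "map (\<lambda>(c, x). (c, t x)) L"
  have nn: "0 \<le> cost L" using L by (rule covers_cost_nonneg)
  obtain L1 where L1: "covers k u' (\<lambda>_. 1) L1" "cost L1 \<le> B" using B(2) by blast
  let ?a = "(2 * cost L + 2) * e"
  have a: "0 \<le> ?a" using nn e by simp
  have le: "\<psi> (x', z) \<le> combination k ?L z + ?a * 1" if z: "q z = u'" for z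
  proof -
    obtain y where y: "q y = u" "near k e y z" "near \<psi> e y z" using bwd[OF z] by blast
    have "\<bar>\<psi> (x, z) - \<psi> (x', z)\<bar> < e" using x unfolding near_def by blast
    moreover have "\<bar>\<psi> (x, y) - \<psi> (x, z)\<bar> < e" using y(3) unfolding near_def by blast
    moreover have "\<psi> (x, y) \<le> combination k L y" using L y(1) by (auto simp: covers_def)
    moreover have "combination k L y \<le> combination k ?L z + cost L * (2 * e)"
    proof (rule combination_perturb, safe)
      fix c p assume "(c, p) \<in> set L"
      then show "0 \<le> c" and "k (p, y) \<le> k (t p, z) + 2 * e"
      proof -
        assume "(c, p) \<in> set L"
        then have "0 \<le> c" "q p = u" using L by (auto simp: covers_def)
        have "\<bar>k (p, y) - k (p, z)\<bar> < e" using y(2) unfolding near_def by blast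
        moreover have "\<bar>k (p, z) - k (t p, z)\<bar> < e" using t[OF \<open>q p = u\<close>] unfolding near_def by blast
        ultimately show "k (p, y) \<le> k (t p, z) + 2 * e" by linarith
        show "0 \<le> c" by fact
      qed
    qed
    ultimately have "\<psi> (x', z) \<le> combination k ?L z + cost L * (2 * e) + 2 * e" by linarith
    then show ?thesis by (simp add: algebra_simps)
  qed
  have "covers k u' (\<lambda>z. combination k ?L z) ?L"
    unfolding covers_def using L t by (auto simp: covers_def)
  from covers_append[OF this covers_scale[OF L1(1) a]]
  have "covers k u' (\<lambda>y. \<psi> (x', y)) (?L @ map (\<lambda>(c, x). (?a * c, x)) L1)"
    using le by (rule covers_mono)
  from cov_le_cost[OF this] have "cov k u' (\<lambda>y. \<psi> (x', y)) \<le> cost L + ?a * cost L1"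
    by (simp add: cost_append cost_map_points combination_map)
  also have "\<dots> \<le> cost L + ?a * B" using L1(2) a by (intro add_mono mult_left_mono) auto
  finally show ?thesis by simp
qed

text \<open>
  Two nearby points x have uniformly close fibres and uniformly close functions \<open>\<psi> (x, \<cdot>)\<close>. Near-optimal
  covers have bounded cost, so transferring them in both directions changes the covering number little.
\<close>

lemma continuous_cov:
  assumes k: "invariant_kernel k" and \<psi>: "continuous_on UNIV \<psi>" "\<And>z. 0 \<le> \<psi> z"
  shows "continuous_on UNIV (\<lambda>x. cov k (q x) (\<lambda>y. \<psi> (x, y)))"
proof -
  note kc = invariant_kernelD(1)[OF k]
  have sq: "compact (UNIV :: ('k \<times> 'k) set)" using compact_Times[OF compact_space compact_space] by simp
  obtain b where b: "b > 0" "\<And>z. \<bar>\<psi> z\<bar> \<le> b" using bounded_continuous_compact_type[OF sq \<psi>(1)] by blast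
  obtain B where B: "B > 0" "\<And>u. \<exists>L. covers k u (\<lambda>_. 1) L \<and> cost L \<le> B" using uniform_cover[OF k] by blast
  let ?J = "\<lambda>x. cov k (q x) (\<lambda>y. \<psi> (x, y))"
  have ex: "\<exists>L. covers k (q x) (\<lambda>y. \<psi> (x, y)) L" for x
    using covers_exists[OF k, of "q x" "\<lambda>y. \<psi> (x, y)" b] b(2) by (auto simp: abs_le_iff)
  have Jb: "?J x \<le> b * B" for x
  proof -
    obtain L where L: "covers k (q x) (\<lambda>_. 1) L" "cost L \<le> B" using B(2) by blast
    have "covers k (q x) (\<lambda>y. \<psi> (x, y)) (map (\<lambda>(c, x). (b * c, x)) L)"
      using covers_scale[OF L(1), of b] b by (rule_tac covers_mono) (auto simp: abs_le_iff)
    from cov_le_cost[OF this] have "?J x \<le> b * cost L" by (simp add: combination_map)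
    also have "\<dots> \<le> b * B" using L(2) b(1) by simp
    finally show ?thesis .
  qed
  have close: "\<bar>?J x - ?J x'\<bar> \<le> (2 * (b * B + 1) + 2) * e * B"
    if e: "0 < e" and xx: "near \<psi> e x x'" "near \<psi> e x' x"
      and fwd: "\<And>y. q y = q x \<Longrightarrow> \<exists>z. q z = q x' \<and> near k e y z \<and> near k e z y \<and> near \<psi> e y z \<and> near \<psi> e z y"
      and bwd: "\<And>z. q z = q x' \<Longrightarrow> \<exists>y. q y = q x \<and> near k e y z \<and> near k e z y \<and> near \<psi> e y z \<and> near \<psi> e z y"
    for e x x'
  proof -
    have one: "?J p' \<le> ?J p + (2 * (b * B + 1) + 2) * e * B"
      if pp: "near \<psi> e p p'"
      and fwd: "\<And>y. q y = q p \<Longrightarrow> \<exists>z. q z = q p' \<and> near k e y z \<and> near k e z y \<and> near \<psi> e y z \<and> near \<psi> e z y"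
      and bwd: "\<And>z. q z = q p' \<Longrightarrow> \<exists>y. q y = q p \<and> near k e y z \<and> near k e z y \<and> near \<psi> e y z \<and> near \<psi> e z y"
      for p p'
    proof (rule field_le_epsilon)
      fix d :: real assume d: "0 < d"
      obtain L0 where "covers k (q p) (\<lambda>y. \<psi> (p, y)) L0" using ex by blast
      then obtain L where L: "covers k (q p) (\<lambda>y. \<psi> (p, y)) L" "cost L < ?J p + min d 1"
        using cov_approx[of k "q p" _ L0 "min d 1"] d by auto
      have "?J p' \<le> cost L + (2 * cost L + 2) * e * B"
        by (rule cov_transfer[OF k \<psi>(2) B e pp _ _ L(1)]) (use fwd bwd in blast)+
      moreover have "(2 * cost L + 2) * e * B \<le> (2 * (b * B + 1) + 2) * e * B"
        using L(2) Jb[of p] e B(1) by (intro mult_right_mono) auto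
      ultimately show "?J p' \<le> ?J p + (2 * (b * B + 1) + 2) * e * B + d" using L(2) by linarith
    qed
    have "?J x' \<le> ?J x + (2 * (b * B + 1) + 2) * e * B"
      by (rule one[OF xx(1) fwd bwd])
    moreover have "?J x \<le> ?J x' + (2 * (b * B + 1) + 2) * e * B"
      by (rule one[OF xx(2)]) (use fwd bwd in blast)+
    ultimately show ?thesis by (simp add: abs_le_iff)
  qed
  have "(?J \<longlongrightarrow> ?J x0) (nhds x0)" for x0
  proof (rule tendstoI)
    fix d :: real assume d: "0 < d"
    define C where "C = (2 * (b * B + 1) + 2) * B"
    have C: "C > 0" using b(1) B(1) by (auto simp: C_def intro!: mult_pos_pos add_pos_pos)
    define e where "e = d / (2 * C)"
    have e: "e > 0" "C * e < d" using C d by (auto simp: e_def field_simps)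
    have E: "entourage (\<lambda>x y. near k e x y \<and> near \<psi> e x y)"
      by (intro entourage_conj entourage_near kc \<psi>(1) e(1))
    show "eventually (\<lambda>x. dist (?J x) (?J x0) < d) (nhds x0)"
      using eventually_fibres_close[OF E, of x0] entourage_eventually[OF entourage_near[OF \<psi>(1) e(1)], of x0]
    proof eventually_elim
      case (elim x)
      have "\<bar>?J x0 - ?J x\<bar> \<le> (2 * (b * B + 1) + 2) * e * B"
        by (rule close[OF e(1)]) (use elim in \<open>auto simp: Bex_def\<close>)
      also have "\<dots> = C * e" by (simp add: C_def)
      finally show ?case using e(2) by (simp add: dist_real_def abs_minus_commute)
    qed
  qed
  then have "(?J \<longlongrightarrow> ?J x0) (at x0)" for x0 by (rule tendsto_mono[OF at_within_le_nhds])
  then show ?thesis by (simp add: continuous_on_def)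
qed

text \<open>
  Ergodicity compares points of different fibres and orbits here, which the action itself need not connect.
\<close>

lemma cov_kernel_constant:
  assumes erg: topologically_ergodic and k: "invariant_kernel k"
    and \<psi>: "continuous_on UNIV \<psi>" "\<And>z. 0 \<le> \<psi> z"
      "\<And>g x y. q x = source g \<Longrightarrow> q y = source g \<Longrightarrow> \<psi> (act g x, act g y) = \<psi> (x, y)"
  shows "cov k (q x) (\<lambda>y. \<psi> (x, y)) = cov k (q x') (\<lambda>y. \<psi> (x', y))"
proof (rule ergodic_invariant_constant[OF erg continuous_cov[OF k \<psi>(1,2)]])
  fix g x assume x: "q x = source g"
  have sq: "compact (UNIV :: ('k \<times> 'k) set)" using compact_Times[OF compact_space compact_space] by simp
  obtain b where b: "b > 0" "\<And>z. \<bar>\<psi> z\<bar> \<le> b" using bounded_continuous_compact_type[OF sq \<psi>(1)] by blast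
  have "cov k (range_of g) (\<lambda>y. \<psi> (act g x, y)) = cov k (source g) (\<lambda>y. \<psi> (x, y))"
    using b(2) by (intro cov_act[OF k, of g _ _ b b]) (auto simp: \<psi>(3) x abs_le_iff)
  then show "cov k (q (act g x)) (\<lambda>y. \<psi> (act g x, y)) = cov k (q x) (\<lambda>y. \<psi> (x, y))"
    using x q_act[of g x] by simp
qed

end

section \<open>The limit functional\<close>

text \<open>Tychonoff's theorem: a filter of functions with values in fixed intervals has a cluster point.\<close>

lemma function_filter_cluster_point:
  fixes F :: "('i \<Rightarrow> real) filter" and b :: "'i \<Rightarrow> real"
  assumes "F \<noteq> bot" "eventually (\<lambda>L. \<forall>i. L i \<in> {0..b i}) F"
  obtains L where "\<And>C. closed C \<Longrightarrow> eventually (\<lambda>L. L \<in> C) F \<Longrightarrow> L \<in> C"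
proof -
  let ?X = "PiE UNIV (\<lambda>i. {0..b i})"
  have "compactin (product_topology (\<lambda>i::'i. euclideanreal) UNIV) ?X"
    by (subst compactin_PiE) (simp add: compactin_euclidean_iff)
  then have X: "compact ?X" by (simp add: euclidean_product_topology compactin_euclidean_iff)
  have "eventually (\<lambda>L. L \<in> ?X) F" using assms(2) by (rule eventually_mono) (auto simp: PiE_iff)
  then obtain L where L: "inf (nhds L) F \<noteq> bot" using X[unfolded compact_filter] assms(1) by blast
  have "L \<in> C" if C: "closed C" "eventually (\<lambda>L. L \<in> C) F" for C
  proof (rule ccontr)
    assume "L \<notin> C"
    then have "eventually (\<lambda>M. M \<in> - C) (nhds L)"
      using C(1) by (intro eventually_nhds_in_open) (auto simp: open_Compl)
    then have "eventually (\<lambda>_. False) (inf (nhds L) F)"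
      unfolding eventually_inf using C(2) by (intro exI[of _ "\<lambda>M. M \<in> - C"] exI[of _ "\<lambda>L. L \<in> C"]) auto
    then show False using L by (simp add: eventually_False)
  qed
  then show ?thesis using that by blast
qed

context groupoid_action
begin

text \<open>
  The covering number of a fixed function may tend to infinity as the kernel concentrates; the quotient
  by the covering number of 1 stays bounded.
\<close>

definition size_ratio :: "('k \<times> 'k \<Rightarrow> real) \<Rightarrow> 'g \<Rightarrow> ('k \<Rightarrow> real) \<Rightarrow> real" where
  "size_ratio k u f = cov k u f / cov k u (\<lambda>_. 1)"

definition test_function :: "('k \<Rightarrow> real) \<Rightarrow> bool" where
  "test_function f \<longleftrightarrow> continuous_on UNIV f \<and> (\<forall>x. 0 \<le> f x)"

lemma test_functionD: "test_function f \<Longrightarrow> continuous_on UNIV f" "test_function f \<Longrightarrow> 0 \<le> f x"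
  by (auto simp: test_function_def)

lemma test_function_bounded:
  assumes "test_function f"
  obtains b where "b > 0" "\<And>x. f x \<le> b"
proof -
  obtain b where "b > 0" "\<And>x. \<bar>f x\<bar> \<le> b"
    using bounded_continuous_compact_type[OF compact_space test_functionD(1)[OF assms]] by blast
  then show ?thesis using that[of b] by (simp add: abs_le_iff)
qed

lemma test_function_add: "test_function f \<Longrightarrow> test_function g \<Longrightarrow> test_function (\<lambda>x. f x + g x)"
  by (auto simp: test_function_def intro: continuous_on_add)

lemma test_function_scale: "test_function f \<Longrightarrow> 0 \<le> c \<Longrightarrow> test_function (\<lambda>x. c * f x)"
  by (auto simp: test_function_def intro: continuous_on_mult continuous_on_const)

lemma test_function_const: "0 \<le> c \<Longrightarrow> test_function (\<lambda>_. c)"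
  by (simp add: test_function_def)

lemma test_function_kernel:
  fixes \<psi> :: "'k \<times> 'k \<Rightarrow> real"
  assumes "continuous_on UNIV \<psi>" "\<And>z. 0 \<le> \<psi> z"
  shows "test_function (\<lambda>y. \<psi> (x, y))"
  unfolding test_function_def using continuous_on_sections(1)[OF assms(1)] assms(2) by blast

lemma covers_test_function:
  assumes "invariant_kernel k" "test_function f"
  obtains L where "covers k u f L"
proof -
  obtain b where b: "\<And>x. f x \<le> b" using test_function_bounded[OF assms(2)] by blast
  from covers_exists[OF assms(1), of u f b] b that show ?thesis by blast
qed

lemma size_ratio_one: "invariant_kernel k \<Longrightarrow> u \<in> units \<Longrightarrow> size_ratio k u (\<lambda>_. 1) = 1"
  using cov_one_pos[of k u] by (simp add: size_ratio_def)

lemma size_ratio_scale: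
  assumes "invariant_kernel k" "test_function f" "0 < a"
  shows "size_ratio k u (\<lambda>y. a * f y) = a * size_ratio k u f"
proof -
  obtain L where "covers k u f L" using covers_test_function[OF assms(1,2)] .
  from cov_scale[OF this assms(3)] show ?thesis by (simp add: size_ratio_def)
qed

lemma size_ratio_nonneg:
  assumes "invariant_kernel k" "test_function f" "u \<in> units"
  shows "0 \<le> size_ratio k u f"
proof -
  obtain L where "covers k u f L" using covers_test_function[OF assms(1,2)] .
  then show ?thesis using cov_nonneg cov_one_pos[OF assms(1,3)] by (simp add: size_ratio_def)
qed

lemma size_ratio_le:
  assumes k: "invariant_kernel k" and f: "test_function f" and u: "u \<in> units" and b: "b > 0" "\<And>x. f x \<le> b"
  shows "size_ratio k u f \<le> b"
proof -
  obtain L where L: "covers k u (\<lambda>_. 1) L" using covers_test_function[OF k test_function_const[of 1]] by auto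
  have "cov k u f \<le> cov k u (\<lambda>y. b * 1)"
    using covers_scale[OF L, of b] b by (intro cov_mono) auto
  also have "\<dots> = b * cov k u (\<lambda>_. 1)" by (rule cov_scale[OF L b(1)])
  finally show ?thesis using cov_one_pos[OF k u] by (simp add: size_ratio_def pos_divide_le_eq)
qed

lemma size_ratio_add_le:
  assumes k: "invariant_kernel k" and f: "test_function f" and g: "test_function g" and u: "u \<in> units"
  shows "size_ratio k u (\<lambda>y. f y + g y) \<le> size_ratio k u f + size_ratio k u g"
proof -
  obtain L where L: "covers k u f L" using covers_test_function[OF k f] .
  obtain M where M: "covers k u g M" using covers_test_function[OF k g] .
  from cov_add[OF L M] cov_one_pos[OF k u] show ?thesis
    by (simp add: size_ratio_def divide_right_mono flip: add_divide_distrib)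
qed

lemma size_ratio_act:
  assumes k: "invariant_kernel k" and f: "test_function f" "test_function f'"
    and eq: "\<And>x. q x = source g \<Longrightarrow> f' x = f (act g x)"
  shows "size_ratio k (range_of g) f = size_ratio k (source g) f'"
proof -
  obtain b where b: "\<And>x. f x \<le> b" using test_function_bounded[OF f(1)] by blast
  obtain b' where b': "\<And>x. f' x \<le> b'" using test_function_bounded[OF f(2)] by blast
  have "cov k (range_of g) f = cov k (source g) f'" by (rule cov_act[OF k, of g f' f b' b]) (use eq b b' in blast)+
  moreover have "cov k (range_of g) (\<lambda>_. 1) = cov k (source g) (\<lambda>_. 1)"
    by (rule cov_act[OF k, of g _ _ 1 1]) auto
  ultimately show ?thesis by (simp add: size_ratio_def)
qed

text \<open>
  A kernel concentrated near the diagonal cannot see the variation of the quotients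
  f / (f + g + e) and g / (f + g + e); multiplying an optimal cover of f + g + e by these
  quotients gives almost optimal covers of f and of g.
\<close>

lemma size_ratio_superadditive:
  assumes k: "invariant_kernel k" and f: "test_function f" and g: "test_function g" and u: "u \<in> units"
    and e: "0 < e"
    and conc: "concentrated (\<lambda>x. f x / (f x + g x + e)) e k" "concentrated (\<lambda>x. g x / (f x + g x + e)) e k"
  shows "size_ratio k u f + size_ratio k u g \<le> (1 + 2 * e) * (size_ratio k u (\<lambda>y. f y + g y) + e)"
proof -
  let ?h = "\<lambda>y. f y + g y + e"
  have h0: "0 < ?h y" for y using test_functionD(2)[OF f, of y] test_functionD(2)[OF g, of y] e by linarith
  have th: "test_function ?h"
    using test_function_add[OF test_function_add[OF f g] test_function_const[of e]] e by simp
  obtain L0 where L0: "covers k u ?h L0" using covers_test_function[OF k th] .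
  note k0 = invariant_kernelD(2)[OF k]
  have part: "covers k u p (map (\<lambda>(c, x). ((p x / ?h x + e) * c, x)) L)"
    if L: "covers k u ?h L" and p: "test_function p" and conc: "concentrated (\<lambda>x. p x / ?h x) e k" for p L
    unfolding covers_def
  proof (intro conjI ballI)
    fix z assume "z \<in> set (map (\<lambda>(c, x). ((p x / ?h x + e) * c, x)) L)"
    then obtain c x where "z = ((p x / ?h x + e) * c, x)" "(c, x) \<in> set L" by auto
    then show "case z of (c, x) \<Rightarrow> 0 \<le> c \<and> q x = u"
      using coversD(2,3)[OF L] test_functionD(2)[OF p, of x] h0[of x] e
      by (auto intro!: mult_nonneg_nonneg add_nonneg_nonneg divide_nonneg_pos)
  next
    fix y assume y: "y \<in> fibre u"
    have le: "p y / ?h y * (c * k (x, y)) \<le> (p x / ?h x + e) * c * k (x, y)" if "(c, x) \<in> set L" for c x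
    proof (cases "0 < k (x, y)")
      case True
      have c: "0 \<le> c" "q x = u" using coversD(2,3)[OF L that] by auto
      have "\<bar>p x / ?h x - p y / ?h y\<bar> < e"
        using conc True c(2) y unfolding concentrated_def by auto
      then have "p y / ?h y \<le> p x / ?h x + e" by linarith
      then have "p y / ?h y * (c * k (x, y)) \<le> (p x / ?h x + e) * (c * k (x, y))"
        using c(1) True by (intro mult_right_mono) auto
      then show ?thesis by (simp add: mult.assoc)
    next
      case False
      then have "k (x, y) = 0" using k0[of "(x, y)"] by simp
      then show ?thesis by simp
    qed
    have "p y = p y / ?h y * ?h y" using h0[of y] by simp
    also have "\<dots> \<le> p y / ?h y * combination k L y"
      using coversD(1)[OF L, of y] y h0[of y] test_functionD(2)[OF p, of y]
      by (intro mult_left_mono) (auto intro: divide_nonneg_pos)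
    also have "\<dots> = (\<Sum>(c, x)\<leftarrow>L. p y / ?h y * (c * k (x, y)))"
      by (simp add: combination_def sum_list_const_mult[symmetric] case_prod_unfold)
    also have "\<dots> \<le> (\<Sum>(c, x)\<leftarrow>L. (p x / ?h x + e) * c * k (x, y))"
      using le by (intro sum_list_mono) auto
    also have "\<dots> = combination k (map (\<lambda>(c, x). ((p x / ?h x + e) * c, x)) L) y"
      by (simp add: combination_def case_prod_unfold o_def)
    finally show "p y \<le> combination k (map (\<lambda>(c, x). ((p x / ?h x + e) * c, x)) L) y" .
  qed
  have le: "cov k u f + cov k u g \<le> (1 + 2 * e) * cost L" if L: "covers k u ?h L" for L
  proof -
    have "cov k u f + cov k u g \<le> cost (map (\<lambda>(c, x). ((f x / ?h x + e) * c, x)) L)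
        + cost (map (\<lambda>(c, x). ((g x / ?h x + e) * c, x)) L)"
      using part[OF L f conc(1)] part[OF L g conc(2)] by (intro add_mono cov_le_cost)
    also have "\<dots> = (\<Sum>(c, x)\<leftarrow>L. (f x / ?h x + e) * c + (g x / ?h x + e) * c)"
      by (simp add: cost_def o_def case_prod_unfold sum_list_addf)
    also have "\<dots> \<le> (\<Sum>(c, x)\<leftarrow>L. (1 + 2 * e) * c)"
    proof (rule sum_list_mono, safe)
      fix c x assume "(c, x) \<in> set L"
      then have c: "0 \<le> c" using coversD(2)[OF L] by blast
      have "f x / ?h x + g x / ?h x \<le> 1"
        using h0[of x] e by (simp add: divide_le_eq flip: add_divide_distrib)
      then have "(f x / ?h x + e + (g x / ?h x + e)) * c \<le> (1 + 2 * e) * c"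
        using c by (intro mult_right_mono) auto
      then show "(f x / ?h x + e) * c + (g x / ?h x + e) * c \<le> (1 + 2 * e) * c"
        by (simp add: distrib_right)
    qed
    also have "\<dots> = (1 + 2 * e) * cost L"
      by (simp add: cost_def sum_list_const_mult[symmetric] case_prod_unfold)
    finally show ?thesis .
  qed
  have "cov k u f + cov k u g \<le> (1 + 2 * e) * cov k u ?h"
  proof -
    have "(cov k u f + cov k u g) / (1 + 2 * e) \<le> cov k u ?h"
      using le e by (intro cov_greatest[OF L0]) (simp add: divide_le_eq mult.commute)
    then show ?thesis using e by (simp add: divide_le_eq mult.commute)
  qed
  then have "size_ratio k u f + size_ratio k u g \<le> (1 + 2 * e) * size_ratio k u ?h"
    using cov_one_pos[OF k u] by (simp add: size_ratio_def divide_right_mono flip: add_divide_distrib)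
  also have "\<dots> \<le> (1 + 2 * e) * (size_ratio k u (\<lambda>y. f y + g y) + size_ratio k u (\<lambda>_. e))"
    using e by (intro mult_left_mono size_ratio_add_le[OF k test_function_add[OF f g] _ u]) (auto intro: test_function_const)
  also have "\<dots> \<le> (1 + 2 * e) * (size_ratio k u (\<lambda>y. f y + g y) + e)"
    using e by (intro mult_left_mono add_left_mono size_ratio_le[OF k _ u]) (auto intro: test_function_const)
  finally show ?thesis .
qed

end

locale ergodic_isometric_action = isometric_action mul ginv q act P
  for mul :: "'g::t2_space \<Rightarrow> 'g \<Rightarrow> 'g" (infixl "\<cdot>" 70) and ginv :: "'g \<Rightarrow> 'g"
    and q :: "'k::t2_space \<Rightarrow> 'g" and act :: "'g \<Rightarrow> 'k \<Rightarrow> 'k" and P :: "('k \<times> 'k \<Rightarrow> real) set" +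
  assumes ergodic: topologically_ergodic
begin

text \<open>
  The error factor 2 e multiplies size ratios that are bounded by the supremum of f + g for all kernels.
\<close>

lemma eventually_superadditive:
  assumes f: "test_function f" and g: "test_function g" and u: "u \<in> units" and d: "0 < d"
  shows "eventually (\<lambda>k. size_ratio k u f + size_ratio k u g \<le> size_ratio k u (\<lambda>y. f y + g y) + d) kernel_filter"
proof -
  obtain b where b: "b > 0" "\<And>x. f x + g x \<le> b" using test_function_bounded[OF test_function_add[OF f g]] by blast
  \<comment> \<open>With this e the total error \<open>2 e b + e + 2 e\<^sup>2\<close> is at most \<open>e (2 b + 4)\<close>, hence at most d.\<close>
  define e where "e = min 1 (d / (2 * b + 4))"
  have e: "e > 0" "2 * e * b + e + 2 * e * e \<le> d"
  proof -
    show "e > 0" using d b(1) by (simp add: e_def)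
    have "e \<le> d / (2 * b + 4)" by (simp add: e_def)
    then have "e * (2 * b + 4) \<le> d" using b(1) by (simp add: field_simps)
    then have "2 * (e * b) + 4 * e \<le> d" by (simp add: algebra_simps)
    moreover have "e * e \<le> e" by (rule mult_left_le) (use \<open>e > 0\<close> in \<open>simp_all add: e_def\<close>)
    ultimately have "2 * (e * b) + e + 2 * (e * e) \<le> d" using \<open>e > 0\<close> by linarith
    then show "2 * e * b + e + 2 * e * e \<le> d" by (simp only: mult.assoc)
  qed
  have h: "f x + g x + e \<noteq> 0" for x using test_functionD(2)[OF f, of x] test_functionD(2)[OF g, of x] e(1) by linarith
  have cont: "continuous_on UNIV (\<lambda>x. f x / (f x + g x + e))" "continuous_on UNIV (\<lambda>x. g x / (f x + g x + e))"
    using test_functionD(1)[OF f] test_functionD(1)[OF g] h by (auto intro!: continuous_intros)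
  show ?thesis
    using eventually_invariant_kernel eventually_concentrated[OF cont(1) e(1)] eventually_concentrated[OF cont(2) e(1)]
  proof eventually_elim
    case (elim k)
    have "size_ratio k u f + size_ratio k u g \<le> (1 + 2 * e) * (size_ratio k u (\<lambda>y. f y + g y) + e)"
      by (rule size_ratio_superadditive[OF elim(1) f g u e(1) elim(2,3)])
    also have "\<dots> = size_ratio k u (\<lambda>y. f y + g y) + (2 * e * size_ratio k u (\<lambda>y. f y + g y) + e + 2 * e * e)"
      by (simp add: algebra_simps)
    also have "\<dots> \<le> size_ratio k u (\<lambda>y. f y + g y) + (2 * e * b + e + 2 * e * e)"
      using size_ratio_le[OF elim(1) test_function_add[OF f g] u b] e(1) by (intro add_left_mono add_right_mono mult_left_mono) auto
    finally show ?case using e(2) by linarith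
  qed
qed

text \<open>
  One cluster point is taken for all fibres simultaneously: this is what makes the values of an
  invariant kernel agree across different fibres in the limit.
\<close>

lemma exists_invariant_functional:
  obtains \<Lambda> :: "'g \<Rightarrow> ('k \<Rightarrow> real) \<Rightarrow> real" where
    "\<And>u. u \<in> units \<Longrightarrow> normalized_positive_functional (\<Lambda> u)"
    "\<And>u f f'. u \<in> units \<Longrightarrow> test_function f \<Longrightarrow> test_function f' \<Longrightarrow> (\<And>y. q y = u \<Longrightarrow> f y = f' y) \<Longrightarrow>
       \<Lambda> u f = \<Lambda> u f'"
    "\<And>g f f'. test_function f \<Longrightarrow> test_function f' \<Longrightarrow> (\<And>x. q x = source g \<Longrightarrow> f' x = f (act g x)) \<Longrightarrow>
       \<Lambda> (range_of g) f = \<Lambda> (source g) f'"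
    "\<And>\<psi> x x'. invariant_kernel \<psi> \<Longrightarrow> \<Lambda> (q x) (\<lambda>y. \<psi> (x, y)) = \<Lambda> (q x') (\<lambda>y. \<psi> (x', y))"
proof -
  define ok where "ok = (\<lambda>(u, f). u \<in> units \<and> test_function f)"
  \<comment> \<open>Outside the meaningful arguments the value 0 keeps every coordinate in a bounded interval.\<close>
  define R where "R k = (\<lambda>(u, f). if ok (u, f) then size_ratio k u f else 0)" for k
  have "\<exists>b. \<forall>k. invariant_kernel k \<longrightarrow> R k i \<in> {0..b}" for i
  proof (cases "ok i")
    case True
    then obtain u f where i: "i = (u, f)" "u \<in> units" "test_function f" by (cases i) (auto simp: ok_def)
    obtain b where b: "b > 0" "\<And>x. f x \<le> b" using test_function_bounded[OF i(3)] by blast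
    show ?thesis
      using size_ratio_le[OF _ i(3,2) b] size_ratio_nonneg[OF _ i(3,2)] True
      by (intro exI[of _ b]) (simp add: R_def i(1))
  qed (auto simp: R_def split: prod.splits)
  then obtain b where b: "\<And>i k. invariant_kernel k \<Longrightarrow> R k i \<in> {0..b i}" by metis
  have "filtermap R kernel_filter \<noteq> bot" by (simp add: filtermap_bot_iff kernel_filter_neq_bot)
  moreover have "eventually (\<lambda>L. \<forall>i. L i \<in> {0..b i}) (filtermap R kernel_filter)"
    unfolding eventually_filtermap using eventually_invariant_kernel by (rule eventually_mono) (use b in blast)
  ultimately obtain L where
    "\<And>C. closed C \<Longrightarrow> eventually (\<lambda>L. L \<in> C) (filtermap R kernel_filter) \<Longrightarrow> L \<in> C"
    by (rule function_filter_cluster_point) blast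
  then have L: "L \<in> C" if "closed C" "eventually (\<lambda>k. R k \<in> C) kernel_filter" for C
    using that by (simp add: eventually_filtermap)
  have cont: "continuous_on UNIV (\<lambda>M :: 'g \<times> ('k \<Rightarrow> real) \<Rightarrow> real. M i)" for i
    by (rule continuous_on_product_coordinates)
  have Req: "R k (u, f) = size_ratio k u f" if "u \<in> units" "test_function f" for k u f
    using that by (simp add: R_def ok_def)
  \<comment> \<open>Linear relations that hold for all sufficiently fine kernels pass to the cluster point.\<close>
  have eq: "L i = c * L j" if "eventually (\<lambda>k. R k i = c * R k j) kernel_filter" for i j c
    using L[of "{M. M i = c * M j}"] that
    by (simp add: closed_Collect_eq[OF cont continuous_on_mult_left[OF cont]])
  have le: "L i \<le> c" if "eventually (\<lambda>k. R k i \<le> c) kernel_filter" for i c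
    using L[of "{M. M i \<le> c}"] that by (simp add: closed_Collect_le[OF cont continuous_on_const])
  have ge: "c \<le> L i" if "eventually (\<lambda>k. c \<le> R k i) kernel_filter" for i c
    using L[of "{M. c \<le> M i}"] that by (simp add: closed_Collect_le[OF continuous_on_const cont])
  have le3: "L i + L j \<le> L l + d" if "eventually (\<lambda>k. R k i + R k j \<le> R k l + d) kernel_filter" for i j l d
    using L[of "{M. M i + M j \<le> M l + d}"] that
    by (simp add: closed_Collect_le[OF continuous_on_add[OF cont cont] continuous_on_add[OF cont continuous_on_const]])
  have ge3: "L l \<le> L i + L j" if "eventually (\<lambda>k. R k l \<le> R k i + R k j) kernel_filter" for i j l
    using L[of "{M. M l \<le> M i + M j}"] that
    by (simp add: closed_Collect_le[OF cont continuous_on_add[OF cont cont]])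
  define \<Lambda> where "\<Lambda> u f = L (u, f)" for u f
  show ?thesis
  proof (rule that[of \<Lambda>])
    fix u assume u: "u \<in> units"
    show "normalized_positive_functional (\<Lambda> u)"
    proof
      show "compact (UNIV :: 'k set)" by (rule compact_space)
    next
      fix f :: "'k \<Rightarrow> real" assume "continuous_on UNIV f" "\<And>x. 0 \<le> f x"
      then have f: "test_function f" by (simp add: test_function_def)
      show "0 \<le> \<Lambda> u f" unfolding \<Lambda>_def
        by (rule ge, rule eventually_mono[OF eventually_invariant_kernel])
          (simp add: Req[OF u f] size_ratio_nonneg[OF _ f u])
      fix c :: real assume c: "0 \<le> c"
      show "\<Lambda> u (\<lambda>x. c * f x) = c * \<Lambda> u f"
      proof (cases "c = 0")
        case True
        \<comment> \<open>The homogeneity of covering numbers is available for positive factors; doubling 0 gives the value 0.\<close>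
        have z: "test_function (\<lambda>_. 0)" by (simp add: test_function_const)
        have "L (u, \<lambda>_. 0) = 2 * L (u, \<lambda>_. 0)"
          by (rule eq, rule eventually_mono[OF eventually_invariant_kernel])
            (use size_ratio_scale[OF _ z, of _ 2 u] in \<open>simp add: Req[OF u z]\<close>)
        then show ?thesis using True by (simp add: \<Lambda>_def)
      next
        case False
        then show ?thesis unfolding \<Lambda>_def using c
          by (intro eq eventually_mono[OF eventually_invariant_kernel])
            (simp add: Req[OF u f] Req[OF u test_function_scale[OF f c]] size_ratio_scale[OF _ f])
      qed
    next
      fix f g :: "'k \<Rightarrow> real"
      assume "continuous_on UNIV f" "continuous_on UNIV g" "\<And>x. 0 \<le> f x" "\<And>x. 0 \<le> g x"
      then have f: "test_function f" and g: "test_function g" by (simp_all add: test_function_def)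
      show "\<Lambda> u (\<lambda>x. f x + g x) = \<Lambda> u f + \<Lambda> u g"
      proof (rule antisym)
        show "\<Lambda> u (\<lambda>x. f x + g x) \<le> \<Lambda> u f + \<Lambda> u g" unfolding \<Lambda>_def
          by (rule ge3, rule eventually_mono[OF eventually_invariant_kernel])
            (simp add: Req[OF u f] Req[OF u g] Req[OF u test_function_add[OF f g]] size_ratio_add_le[OF _ f g u])
        show "\<Lambda> u f + \<Lambda> u g \<le> \<Lambda> u (\<lambda>x. f x + g x)" unfolding \<Lambda>_def
          by (rule field_le_epsilon, rule le3)
            (simp add: Req[OF u f] Req[OF u g] Req[OF u test_function_add[OF f g]] eventually_superadditive[OF f g u])
      qed
    next
      have o: "test_function (\<lambda>_. 1)" by (simp add: test_function_const)
      show "\<Lambda> u (\<lambda>_. 1) = 1" unfolding \<Lambda>_def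
        by (intro antisym le ge eventually_mono[OF eventually_invariant_kernel])
          (simp_all add: Req[OF u o] size_ratio_one[OF _ u])
    qed
  next
    fix u and f f' :: "'k \<Rightarrow> real"
    assume u: "u \<in> units" and f: "test_function f" "test_function f'" and ff: "\<And>y. q y = u \<Longrightarrow> f y = f' y"
    have "cov k u f = cov k u f'" for k by (rule cov_cong[OF ff])
    then have "size_ratio k u f = size_ratio k u f'" for k by (simp add: size_ratio_def)
    then have "L (u, f) = 1 * L (u, f')" by (intro eq) (simp add: Req[OF u f(1)] Req[OF u f(2)])
    then show "\<Lambda> u f = \<Lambda> u f'" by (simp add: \<Lambda>_def)
  next
    fix g and f f' :: "'k \<Rightarrow> real"
    assume f: "test_function f" "test_function f'" and ff: "\<And>x. q x = source g \<Longrightarrow> f' x = f (act g x)"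
    have "L (range_of g, f) = 1 * L (source g, f')"
      by (rule eq, rule eventually_mono[OF eventually_invariant_kernel])
        (simp add: Req[OF range_in_units f(1)] Req[OF source_in_units f(2)] size_ratio_act[OF _ f ff])
    then show "\<Lambda> (range_of g) f = \<Lambda> (source g) f'" by (simp add: \<Lambda>_def)
  next
    fix \<psi> :: "'k \<times> 'k \<Rightarrow> real" and x x' :: 'k
    assume \<psi>: "invariant_kernel \<psi>"
    note \<psi>' = invariant_kernelD(1,2,5)[OF \<psi>]
    note t = test_function_kernel[OF \<psi>'(1,2)]
    have "L (q x, \<lambda>y. \<psi> (x, y)) = 1 * L (q x', \<lambda>y. \<psi> (x', y))"
    proof (rule eq, rule eventually_mono[OF eventually_invariant_kernel])
      fix k assume k: "invariant_kernel k"
      have "cov k (q x) (\<lambda>y. \<psi> (x, y)) = cov k (q x') (\<lambda>y. \<psi> (x', y))"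
        by (rule cov_kernel_constant[OF ergodic k \<psi>'])
      moreover have "cov k (q x) (\<lambda>y. 1) = cov k (q x') (\<lambda>y. 1)"
        using cov_kernel_constant[OF ergodic k, of "\<lambda>_. 1" x x'] by simp
      ultimately show "R k (q x, \<lambda>y. \<psi> (x, y)) = 1 * R k (q x', \<lambda>y. \<psi> (x', y))"
        by (simp add: Req[OF q_in_units t] size_ratio_def)
    qed
    then show "\<Lambda> (q x) (\<lambda>y. \<psi> (x, y)) = \<Lambda> (q x') (\<lambda>y. \<psi> (x', y))" by (simp add: \<Lambda>_def)
  qed
qed

end

section \<open>Measures with constant kernel integrals\<close>

text \<open>
  A function that is continuous only on the carrier S of the measure is integrated through a
  continuous extension to the whole space.
\<close>

lemma integral_restrict_space_carrier:
  fixes f f' :: "'a::t2_space \<Rightarrow> real"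
  assumes M: "prob_space M" "sets M = sets borel" and S: "closed S" "measure M S = 1"
    and f': "continuous_on UNIV f'" and eq: "\<And>x. x \<in> S \<Longrightarrow> f x = f' x"
  shows "(LINT x|restrict_space M S. f x) = (LINT x|M. f' x)"
proof -
  interpret prob_space M by fact
  have space: "space M = UNIV" using sets_eq_imp_space_eq[OF M(2)] by simp
  have SM: "S \<in> sets M" using S(1) M(2) by simp
  have meas: "f' \<in> borel_measurable M"
    using borel_measurable_continuous_onI[OF f'] by (subst measurable_cong_sets[OF M(2) refl])
  have "(LINT x|restrict_space M S. f x) = (LINT x|restrict_space M S. f' x)"
    by (rule Bochner_Integration.integral_cong) (use eq in \<open>auto simp: space_restrict_space\<close>)
  also have "\<dots> = (LINT x|M. indicator S x *\<^sub>R f' x)"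
    using SM space by (intro integral_restrict_space) simp
  also have "\<dots> = (LINT x|M. f' x)"
  proof (rule integral_cong_AE)
    show "AE x in M. indicator S x *\<^sub>R f' x = f' x"
      using AE_prob_1[OF S(2)] by eventually_elim simp
  qed (use meas SM in measurable)
  finally show ?thesis .
qed

context groupoid_action
begin

definition on_fibre :: "'g \<Rightarrow> 'k measure \<Rightarrow> bool" where
  "on_fibre u M \<longleftrightarrow> regular_borel_prob M \<and> measure M (fibre u) = 1"

lemma on_fibreD:
  assumes "on_fibre u M"
  shows "regular_borel_prob M" "prob_space M" "sets M = sets borel" "space M = UNIV"
    "measure M (fibre u) = 1" "AE x in M. q x = u"
proof -
  show reg: "regular_borel_prob M" and one: "measure M (fibre u) = 1" using assms by (auto simp: on_fibre_def)
  show ps: "prob_space M" and "sets M = sets borel" "space M = UNIV" using regular_borel_prob_space[OF reg] by auto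
  show "AE x in M. q x = u" using prob_space.AE_prob_1[OF ps one] by eventually_elim simp
qed

lemma integrable_on_fibre:
  assumes "on_fibre u M" "continuous_on UNIV f"
  shows "integrable M (f :: 'k \<Rightarrow> real)"
  using integrable_continuous_compact_type[OF compact_space assms(2)] on_fibreD(2,3)[OF assms(1)]
  by (simp add: prob_space.finite_measure)

lemma integral_on_fibre_mono:
  assumes M: "on_fibre u M" and f: "continuous_on UNIV f" and g: "continuous_on UNIV g"
    and le: "\<And>y. q y = u \<Longrightarrow> f y \<le> (g y :: real)"
  shows "(LINT y|M. f y) \<le> (LINT y|M. g y)"
  using on_fibreD(6)[OF M]
  by (intro integral_mono_AE integrable_on_fibre[OF M] f g) (auto elim!: eventually_mono le)

lemma integral_on_fibre_const: "on_fibre u M \<Longrightarrow> (LINT y|M. c) = (c :: real)"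
  using prob_space.prob_space[OF on_fibreD(2)] by simp

lemma integral_on_fibre_cong:
  assumes M: "on_fibre u M" and f: "continuous_on UNIV f" and g: "continuous_on UNIV g"
    and eq: "\<And>y. q y = u \<Longrightarrow> f y = (g y :: real)"
  shows "(LINT y|M. f y) = (LINT y|M. g y)"
  by (rule antisym) (intro integral_on_fibre_mono[OF M] f g; simp add: eq)+

lemma integral_on_fibre_diff:
  assumes M: "on_fibre u M" and f: "continuous_on UNIV f" and g: "continuous_on UNIV g"
    and le: "\<And>y. q y = u \<Longrightarrow> \<bar>f y - (g y :: real)\<bar> \<le> e"
  shows "\<bar>(LINT y|M. f y) - (LINT y|M. g y)\<bar> \<le> e"
proof -
  have "(LINT y|M. f y) \<le> (LINT y|M. g y + e)" "(LINT y|M. g y) \<le> (LINT y|M. f y + e)"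
    using le by (intro integral_on_fibre_mono[OF M] f g continuous_intros; force simp: abs_le_iff)+
  moreover have "(LINT y|M. g y + e) = (LINT y|M. g y) + e" "(LINT y|M. f y + e) = (LINT y|M. f y) + e"
    using integrable_on_fibre[OF M f] integrable_on_fibre[OF M g] integral_on_fibre_const[OF M, of e] on_fibreD(2)[OF M]
    by (simp_all add: prob_space.finite_measure finite_measure.integrable_const)
  ultimately show ?thesis by (simp add: abs_le_iff)
qed

lemma continuous_combination:
  assumes "continuous_on UNIV k"
  shows "continuous_on UNIV (combination k L)"
proof (induction L)
  case (Cons p L)
  have "combination k (p # L) = (\<lambda>y. fst p * k (snd p, y) + combination k L y)"
    by (auto simp: combination_def case_prod_unfold)
  then show ?case using Cons continuous_on_sections(1)[OF assms]
    by (auto intro!: continuous_on_add continuous_on_mult continuous_on_const)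
qed (simp add: combination_def[abs_def])

text \<open>
  Integrating f against a combination of translates of a concentrated kernel nearly evaluates f at
  the points of the combination, provided that all translates have the same integral d.
\<close>

lemma integral_times_combination:
  assumes M: "on_fibre u M" and k: "invariant_kernel k" and f: "continuous_on UNIV f"
    and d: "\<And>x. q x = u \<Longrightarrow> (LINT y|M. k (x, y)) = d"
    and conc: "concentrated f \<delta> k" and L: "\<And>c x. (c, x) \<in> set L \<Longrightarrow> 0 \<le> c \<and> q x = u"
  shows "\<bar>(LINT y|M. f y * combination k L y) - d * (\<Sum>(c, x)\<leftarrow>L. c * f x)\<bar> \<le> \<delta> * d * cost L"
  using L
proof (induction L)
  case Nil
  then show ?case by (simp add: combination_def cost_def)
next
  case (Cons p L)
  obtain c x where p: "p = (c, x)" by fastforce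
  have cx: "0 \<le> c" "q x = u" using Cons.prems[of c x] p by auto
  note kc = invariant_kernelD(1)[OF k]
  have c1: "continuous_on UNIV (\<lambda>y. f y * k (x, y))" "continuous_on UNIV (\<lambda>y. f x * k (x, y))"
    using f continuous_on_sections(1)[OF kc] by (auto intro!: continuous_on_mult continuous_on_const)
  have c2: "continuous_on UNIV (\<lambda>y. f y * combination k L y)"
    using f continuous_combination[OF kc] by (intro continuous_on_mult)
  have IH: "\<bar>(LINT y|M. f y * combination k L y) - d * (\<Sum>(c, x)\<leftarrow>L. c * f x)\<bar> \<le> \<delta> * d * cost L"
    by (rule Cons.IH) (use Cons.prems in auto)
  have c3: "continuous_on UNIV (\<lambda>y. \<delta> * k (x, y))"
    using continuous_on_sections(1)[OF kc] by (intro continuous_on_mult continuous_on_const)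
  have osc: "\<bar>f y - f x\<bar> * k (x, y) \<le> \<delta> * k (x, y)" if "q y = u" for y
  proof (cases "0 < k (x, y)")
    case True
    then have "\<bar>f x - f y\<bar> < \<delta>" using conc cx(2) that unfolding concentrated_def by metis
    then show ?thesis using True by (intro mult_right_mono) auto
  next
    case False
    then have "k (x, y) = 0" using invariant_kernelD(2)[OF k, of "(x, y)"] by simp
    then show ?thesis by simp
  qed
  have ptw: "f y * k (x, y) \<le> f x * k (x, y) + \<delta> * k (x, y)" "f x * k (x, y) \<le> f y * k (x, y) + \<delta> * k (x, y)"
    if "q y = u" for y
  proof -
    have "(f y - f x) * k (x, y) \<le> \<bar>f y - f x\<bar> * k (x, y)" "(f x - f y) * k (x, y) \<le> \<bar>f y - f x\<bar> * k (x, y)"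
      using invariant_kernelD(2)[OF k, of "(x, y)"] by (intro mult_right_mono; simp)+
    then show "f y * k (x, y) \<le> f x * k (x, y) + \<delta> * k (x, y)" "f x * k (x, y) \<le> f y * k (x, y) + \<delta> * k (x, y)"
      using osc[OF that] by (simp_all add: left_diff_distrib)
  qed
  have fx: "(LINT y|M. f x * k (x, y)) = f x * d" using d[OF cx(2)] by simp
  have dk: "(LINT y|M. \<delta> * k (x, y)) = \<delta> * d" using d[OF cx(2)] by simp
  have "(LINT y|M. f y * k (x, y)) \<le> (LINT y|M. f x * k (x, y) + \<delta> * k (x, y))"
    by (rule integral_on_fibre_mono[OF M c1(1) continuous_on_add[OF c1(2) c3] ptw(1)])
  moreover have "(LINT y|M. f x * k (x, y)) \<le> (LINT y|M. f y * k (x, y) + \<delta> * k (x, y))"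
    by (rule integral_on_fibre_mono[OF M c1(2) continuous_on_add[OF c1(1) c3] ptw(2)])
  moreover have "(LINT y|M. f x * k (x, y) + \<delta> * k (x, y)) = f x * d + \<delta> * d"
    by (subst Bochner_Integration.integral_add[OF integrable_on_fibre[OF M c1(2)] integrable_on_fibre[OF M c3]])
      (simp only: fx dk)
  moreover have "(LINT y|M. f y * k (x, y) + \<delta> * k (x, y)) = (LINT y|M. f y * k (x, y)) + \<delta> * d"
    by (subst Bochner_Integration.integral_add[OF integrable_on_fibre[OF M c1(1)] integrable_on_fibre[OF M c3]])
      (simp only: dk)
  ultimately have one: "\<bar>(LINT y|M. f y * k (x, y)) - f x * d\<bar> \<le> \<delta> * d"
    using fx by linarith
  have "\<bar>c * (LINT y|M. f y * k (x, y)) - c * (f x * d)\<bar> = c * \<bar>(LINT y|M. f y * k (x, y)) - f x * d\<bar>"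
    using cx(1) by (simp add: abs_mult flip: right_diff_distrib)
  also have "\<dots> \<le> c * (\<delta> * d)" using one cx(1) by (rule mult_left_mono)
  finally have cone: "\<bar>c * (LINT y|M. f y * k (x, y)) - c * (f x * d)\<bar> \<le> c * (\<delta> * d)" .
  have "(LINT y|M. f y * combination k (p # L) y) = (LINT y|M. c * (f y * k (x, y)) + f y * combination k L y)"
    by (simp add: p combination_def algebra_simps)
  also have "\<dots> = c * (LINT y|M. f y * k (x, y)) + (LINT y|M. f y * combination k L y)"
    using integrable_on_fibre[OF M c1(1)] integrable_on_fibre[OF M c2] by simp
  finally have "(LINT y|M. f y * combination k (p # L) y) - d * (\<Sum>(c, x)\<leftarrow>p # L. c * f x)
      = (c * (LINT y|M. f y * k (x, y)) - c * (f x * d)) + ((LINT y|M. f y * combination k L y) - d * (\<Sum>(c, x)\<leftarrow>L. c * f x))"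
    by (simp add: p algebra_simps)
  also have "\<bar>\<dots>\<bar> \<le> c * (\<delta> * d) + \<delta> * d * cost L"
    using abs_triangle_ineq cone IH by (rule order_trans[OF _ add_mono])
  finally show ?case by (simp add: p cost_def algebra_simps)
qed

text \<open>
  Cutting the space into finitely many small Borel pieces replaces an integral over the first argument
  of a continuous function of two variables by a convex combination, uniformly in the second argument.
\<close>

lemma discretization:
  assumes M: "on_fibre u M" and u: "u \<in> units" and \<psi>: "continuous_on UNIV \<psi>" and e: "0 < e"
  obtains L where "\<And>c x. (c, x) \<in> set L \<Longrightarrow> 0 \<le> c \<and> q x = u" "cost L = 1"
    "\<And>y. \<bar>(LINT x|M. \<psi> (x, y)) - combination \<psi> L y\<bar> \<le> e"
proof -
  interpret prob_space M by (rule on_fibreD(2)[OF M])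
  obtain \<V> where \<V>: "finite \<V>" "\<Union>\<V> = UNIV" "\<And>V. V \<in> \<V> \<Longrightarrow> open V"
    "\<And>V y z. V \<in> \<V> \<Longrightarrow> y \<in> V \<Longrightarrow> z \<in> V \<Longrightarrow> near \<psi> e y z"
    using entourage_finite_cover[OF entourage_near[OF \<psi> e]] by blast
  obtain Vs where Vs: "set Vs = \<V>" using finite_list[OF \<V>(1)] by blast
  define n where "n = length Vs"
  define V where "V i = (if i < n then Vs ! i else {})" for i
  have Vmem: "V i \<in> \<V>" if "i < n" for i using that Vs nth_mem[of i Vs] by (simp add: V_def n_def)
  let ?D = "disjointed V"
  have cover: "\<exists>i<n. x \<in> ?D i" for x
  proof -
    obtain W where "W \<in> \<V>" "x \<in> W" using \<V>(2) by blast
    then obtain i where "i < n" "x \<in> V i" using Vs by (metis V_def in_set_conv_nth n_def)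
    then have "x \<in> (\<Union>i\<in>{0..<n}. V i)" by auto
    then have "x \<in> (\<Union>i\<in>{0..<n}. ?D i)" by (simp only: finite_UN_disjointed_eq)
    then show ?thesis by auto
  qed
  have unique: "i = j" if "x \<in> ?D i" "x \<in> ?D j" for x i j
    using that less_disjoint_disjointed[of i j V] less_disjoint_disjointed[of j i V]
    by (metis IntI empty_iff linorder_neqE_nat)
  have "open (V i)" for i
  proof (cases "i < n")
    case True
    then show ?thesis by (intro \<V>(3) Vmem)
  qed (simp add: V_def)
  then have VM: "V i \<in> sets M" for i using on_fibreD(3)[OF M] by simp
  have D: "?D i \<in> sets M" for i
    unfolding disjointed_def using VM by (intro sets.Diff sets.finite_UN) auto
  obtain x0 where x0: "q x0 = u" using fibre_nonempty[OF u] by blast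
  \<comment> \<open>Pieces that miss the fibre have measure 0; x0 serves them as a representative in the fibre.\<close>
  define t where "t i = (if fibre u \<inter> V i = {} then x0 else SOME x. x \<in> fibre u \<inter> V i)" for i
  have t: "q (t i) = u" "fibre u \<inter> V i \<noteq> {} \<Longrightarrow> t i \<in> V i" for i
  proof -
    have "(SOME x. x \<in> fibre u \<inter> V i) \<in> fibre u \<inter> V i" if "fibre u \<inter> V i \<noteq> {}"
      using that by (rule some_in_eq[THEN iffD2])
    then show "q (t i) = u" "fibre u \<inter> V i \<noteq> {} \<Longrightarrow> t i \<in> V i"
      using x0 unfolding t_def by (cases "fibre u \<inter> V i = {}"; simp)+
  qed
  have pick: "(\<Sum>i<n. indicator (?D i) x * a i) = a j" if "j < n" "x \<in> ?D j" for x j and a :: "nat \<Rightarrow> real"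
  proof -
    have "(\<Sum>i<n. indicator (?D i) x * a i) = (\<Sum>i<n. if i = j then a i else 0)"
    proof (intro sum.cong refl)
      show "indicator (?D i) x * a i = (if i = j then a i else 0)" for i
        using unique[OF _ that(2), of i] that(2) by (cases "x \<in> ?D i") auto
    qed
    then show ?thesis using that(1) by simp
  qed
  define L where "L = map (\<lambda>i. (measure M (?D i), t i)) [0..<n]"
  have ind: "integrable M (indicator (?D i) :: 'k \<Rightarrow> real)" for i
    using D by (intro integrable_real_indicator) (auto simp: emeasure_eq_measure)
  have sum_integral: "(\<Sum>i<n. measure M (?D i) * a i) = (LINT x|M. (\<Sum>i<n. indicator (?D i) x * a i))"
    for a :: "nat \<Rightarrow> real"
  proof -
    have "(LINT x|M. (\<Sum>i<n. indicator (?D i) x * a i)) = (\<Sum>i<n. LINT x|M. indicator (?D i) x * a i)"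
      using ind by (intro Bochner_Integration.integral_sum Bochner_Integration.integrable_mult_left)
    also have "\<dots> = (\<Sum>i<n. measure M (?D i) * a i)"
    proof (intro sum.cong refl)
      fix i
      have "(LINT x|M. indicator (?D i) x * a i) = (LINT x|M. indicator (?D i) x) * a i"
        using ind by (intro Bochner_Integration.integral_mult_left)
      then show "(LINT x|M. indicator (?D i) x * a i) = measure M (?D i) * a i"
        using on_fibreD(4)[OF M] by (simp only: Bochner_Integration.integral_indicator Int_UNIV_right)
    qed
    finally show ?thesis by (rule sym)
  qed
  have "cost L = (\<Sum>i<n. measure M (?D i) * 1)"
    by (simp add: L_def cost_def o_def sum_list_sum_nth atLeast0LessThan)
  also have "\<dots> = (LINT x|M. (\<Sum>i<n. indicator (?D i) x * 1))" by (rule sum_integral)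
  also have "\<dots> = (LINT x|M. 1)"
    using pick[of _ _ "\<lambda>_. 1"] cover by (intro Bochner_Integration.integral_cong refl) metis
  finally have cost: "cost L = 1" using prob_space by simp
  have approx: "\<bar>(LINT x|M. \<psi> (x, y)) - combination \<psi> L y\<bar> \<le> e" for y
  proof -
    let ?s = "\<lambda>x. \<Sum>i<n. indicator (?D i) x * \<psi> (t i, y)"
    have "combination \<psi> L y = (\<Sum>i<n. measure M (?D i) * \<psi> (t i, y))"
      by (simp add: L_def combination_def o_def sum_list_sum_nth atLeast0LessThan)
    also have "\<dots> = (LINT x|M. ?s x)" by (rule sum_integral)
    finally have comb: "combination \<psi> L y = (LINT x|M. ?s x)" .
    have int: "integrable M ?s" using ind by (intro Bochner_Integration.integrable_sum) simp
    have int': "integrable M (\<lambda>x. \<psi> (x, y))"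
      by (rule integrable_on_fibre[OF M continuous_on_sections(2)[OF \<psi>]])
    have ptw: "\<bar>\<psi> (x, y) - ?s x\<bar> \<le> e" if "q x = u" for x
    proof -
      obtain i where i: "i < n" "x \<in> ?D i" using cover by blast
      then have xV: "x \<in> V i" by (simp add: disjointed_def)
      moreover have "x \<in> fibre u" using that by simp
      ultimately have "t i \<in> V i" using t(2)[of i] by blast
      then have "near \<psi> e x (t i)" using \<V>(4)[OF Vmem[OF i(1)] xV] by blast
      then have "\<bar>\<psi> (x, y) - \<psi> (t i, y)\<bar> < e" unfolding near_def by blast
      then show ?thesis using pick[OF i, of "\<lambda>i. \<psi> (t i, y)"] by simp
    qed
    have AE: "AE x in M. \<bar>\<psi> (x, y) - ?s x\<bar> \<le> e"
      using on_fibreD(6)[OF M] by (rule eventually_mono) (rule ptw)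
    have "\<bar>LINT x|M. \<psi> (x, y) - ?s x\<bar> \<le> (LINT x|M. \<bar>\<psi> (x, y) - ?s x\<bar>)"
      by (rule integral_abs_bound)
    also have "\<dots> \<le> (LINT x|M. e)"
      using AE int int' by (intro integral_mono_AE) auto
    also have "\<dots> = e" using prob_space by simp
    finally show ?thesis using int int' by (simp add: comb)
  qed
  show ?thesis
  proof (rule that[OF _ cost approx])
    show "0 \<le> c \<and> q x = u" if "(c, x) \<in> set L" for c x using that t(1) by (auto simp: L_def)
  qed
qed

text \<open>
  The fibred form of a uniformly distributed measure: the mass seen by an invariant kernel is the same
  from every point of the whole space, not only from the points of one fibre.
\<close>

definition constant_kernel_integrals :: "('g \<Rightarrow> 'k measure) \<Rightarrow> bool" where
  "constant_kernel_integrals \<mu> \<longleftrightarrow> (\<forall>u\<in>units. on_fibre u (\<mu> u)) \<and>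
     (\<forall>k x x'. invariant_kernel k \<longrightarrow> (LINT y|\<mu> (q x). k (x, y)) = (LINT y|\<mu> (q x'). k (x', y)))"

lemma constant_kernel_integralsD:
  assumes "constant_kernel_integrals \<mu>"
  shows "u \<in> units \<Longrightarrow> on_fibre u (\<mu> u)"
    "invariant_kernel k \<Longrightarrow> (LINT y|\<mu> (q x). k (x, y)) = (LINT y|\<mu> (q x'). k (x', y))"
  using assms unfolding constant_kernel_integrals_def by blast+

text \<open>Finitely many translates of the kernel dominate 1 on the fibre, so their common integral is not 0.\<close>

lemma kernel_integral_pos:
  assumes \<mu>: "constant_kernel_integrals \<mu>" and k: "invariant_kernel k"
  shows "0 < (LINT y|\<mu> (q x). k (x, y))"
proof -
  let ?u = "q x" and ?M = "\<mu> (q x)"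
  define d where "d = (LINT y|?M. k (x, y))"
  have M: "on_fibre ?u ?M" using constant_kernel_integralsD(1)[OF \<mu> q_in_units] .
  have d: "(LINT y|?M. k (z, y)) = d" if "q z = ?u" for z
    using constant_kernel_integralsD(2)[OF \<mu> k, of z x] that by (simp add: d_def)
  obtain L where L: "covers k ?u (\<lambda>_. 1) L" using uniform_cover[OF k] by metis
  \<comment> \<open>The constant function 1 has no oscillation at all, so the general estimate applies to it with \<open>\<delta> = 1\<close>.\<close>
  have conc: "concentrated (\<lambda>_. 1) 1 k" by (simp add: concentrated_def)
  have "\<bar>(LINT y|?M. 1 * combination k L y) - d * (\<Sum>(c, x)\<leftarrow>L. c * 1)\<bar> \<le> 1 * d * cost L"
    using coversD(2,3)[OF L] by (intro integral_times_combination[OF M k _ d conc]) auto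
  then have "(LINT y|?M. combination k L y) \<le> 2 * d * cost L" by (simp add: cost_def abs_le_iff)
  moreover have "(LINT y|?M. 1) \<le> (LINT y|?M. combination k L y)"
    using coversD(1)[OF L]
    by (intro integral_on_fibre_mono[OF M] continuous_combination invariant_kernelD(1)[OF k]) auto
  ultimately have "1 \<le> 2 * d * cost L" using integral_on_fibre_const[OF M, of 1] by simp
  moreover have "0 \<le> cost L" by (rule covers_cost_nonneg[OF L])
  ultimately show ?thesis unfolding d_def[symmetric]
    by (smt (verit) mult_nonneg_nonneg mult_nonpos_nonneg)
qed

end

section \<open>Comparison of nearby fibres\<close>

context ergodic_isometric_action
begin

text \<open>
  A convex combination that is almost uniform on one fibre can be moved to nearby fibres, where it
  remains almost uniform. Hence integrals of f over nearby fibres, against measures from possibly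
  different families, are all close to the same average of values of f.
\<close>

lemma constant_kernel_integrals_close:
  fixes f :: "'k \<Rightarrow> real"
  assumes \<mu>: "constant_kernel_integrals \<mu>" and \<nu>: "constant_kernel_integrals \<nu>"
    and f: "continuous_on UNIV f" and \<epsilon>: "0 < \<epsilon>"
  shows "eventually (\<lambda>x. \<bar>(LINT y|\<nu> (q x). f y) - (LINT y|\<mu> (q x0). f y)\<bar> < \<epsilon>) (nhds x0)"
proof -
  obtain b where b: "b > 0" "\<And>x. \<bar>f x\<bar> \<le> b" using bounded_continuous_compact_type[OF compact_space f] by blast
  define \<delta> where "\<delta> = \<epsilon> / 6"
  have \<delta>: "0 < \<delta>" using \<epsilon> by (simp add: \<delta>_def)
  have "eventually (\<lambda>k. invariant_kernel k \<and> concentrated f \<delta> k) kernel_filter"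
    using eventually_invariant_kernel eventually_concentrated[OF f \<delta>] by (rule eventually_conj)
  then obtain k where k: "invariant_kernel k" and conc: "concentrated f \<delta> k"
    using eventually_happens'[OF kernel_filter_neq_bot] by blast
  note kc = invariant_kernelD(1)[OF k]
  define c where "c = (LINT y|\<mu> (q x0). k (x0, y))"
  define d where "d = (LINT y|\<nu> (q x0). k (x0, y))"
  have c0: "0 < c" unfolding c_def by (rule kernel_integral_pos[OF \<mu> k])
  have c: "(LINT y|\<mu> (q x). k (x, y)) = c" for x
    unfolding c_def by (rule constant_kernel_integralsD(2)[OF \<mu> k])
  have d: "(LINT y|\<nu> (q x). k (x, y)) = d" for x
    unfolding d_def by (rule constant_kernel_integralsD(2)[OF \<nu> k])
  have M: "on_fibre (q x) (\<mu> (q x))" and N: "on_fibre (q x) (\<nu> (q x))" for x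
    using constant_kernel_integralsD(1)[OF \<mu> q_in_units] constant_kernel_integralsD(1)[OF \<nu> q_in_units] by blast+
  \<comment> \<open>The integral of f times an almost constant combination, computed in two ways.\<close>
  have approx: "\<bar>c * (LINT y|m. f y) - e' * (\<Sum>(c, x)\<leftarrow>L. c * f x)\<bar> \<le> e * b + \<delta> * e' \<and> \<bar>c - e'\<bar> \<le> e"
    if m: "on_fibre u m" and e': "\<And>x. q x = u \<Longrightarrow> (LINT y|m. k (x, y)) = e'"
      and L: "\<And>c x. (c, x) \<in> set L \<Longrightarrow> 0 \<le> c \<and> q x = u" "cost L = 1"
      and unif: "\<And>y. q y = u \<Longrightarrow> \<bar>combination k L y - c\<bar> \<le> e"
    for u m e' e L
  proof
    note cont = continuous_combination[OF kc, of L]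
    have "\<bar>(LINT y|m. f y * combination k L y) - e' * (\<Sum>(c, x)\<leftarrow>L. c * f x)\<bar> \<le> \<delta> * e' * cost L"
      by (rule integral_times_combination[OF m k f e' conc L(1)])
    then have 1: "\<bar>(LINT y|m. f y * combination k L y) - e' * (\<Sum>(c, x)\<leftarrow>L. c * f x)\<bar> \<le> \<delta> * e'"
      using L(2) by simp
    have "\<bar>(LINT y|m. c * f y) - (LINT y|m. f y * combination k L y)\<bar> \<le> e * b"
    proof (rule integral_on_fibre_diff[OF m])
      fix y assume y: "q y = u"
      have "\<bar>c * f y - f y * combination k L y\<bar> = \<bar>combination k L y - c\<bar> * \<bar>f y\<bar>"
      proof -
        have "c * f y - f y * combination k L y = - ((combination k L y - c) * f y)" by (simp add: algebra_simps)
        then show ?thesis by (simp only: abs_minus_cancel abs_mult)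
      qed
      also have "\<dots> \<le> e * b" using unif[OF y] b(2) by (intro mult_mono) auto
      finally show "\<bar>c * f y - f y * combination k L y\<bar> \<le> e * b" .
    qed (intro continuous_on_mult continuous_on_const f cont)+
    then show "\<bar>c * (LINT y|m. f y) - e' * (\<Sum>(c, x)\<leftarrow>L. c * f x)\<bar> \<le> e * b + \<delta> * e'"
      using 1 by (simp only: Bochner_Integration.integral_mult_right_zero)
    have "\<bar>(LINT y|m. 1 * combination k L y) - e' * (\<Sum>(c, x)\<leftarrow>L. c * 1)\<bar> \<le> \<eta> * e' * cost L" if "0 < \<eta>" for \<eta>
      by (rule integral_times_combination[OF m k continuous_on_const e' _ L(1)]) (simp_all add: concentrated_def that)
    then have le: "\<bar>(LINT y|m. combination k L y) - e'\<bar> \<le> \<eta> * e'" if "0 < \<eta>" for \<eta>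
      using that L(2) by (simp add: cost_def)
    have "(LINT y|m. combination k L y) = e'"
    proof (rule ccontr)
      assume "(LINT y|m. combination k L y) \<noteq> e'"
      then have *: "0 < \<bar>(LINT y|m. combination k L y) - e'\<bar>" by simp
      then have "0 < e'" using le[of 1] by simp
      then show False using le[of "\<bar>(LINT y|m. combination k L y) - e'\<bar> / (2 * e')"] * by simp
    qed
    moreover have "\<bar>(LINT y|m. c) - (LINT y|m. combination k L y)\<bar> \<le> e"
      using unif by (intro integral_on_fibre_diff[OF m] continuous_on_const cont) (simp add: abs_minus_commute)
    ultimately show "\<bar>c - e'\<bar> \<le> e" by (simp only: integral_on_fibre_const[OF m])
  qed
  \<comment> \<open>Discretizing the measure on the fibre of x0 makes its kernel integrals, all equal to c, into a combination.\<close>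
  have start: "\<exists>L. (\<forall>c x. (c, x) \<in> set L \<longrightarrow> 0 \<le> c \<and> q x = q x0) \<and> cost L = 1 \<and>
      (\<forall>y. q y = q x0 \<longrightarrow> \<bar>combination k L y - c\<bar> \<le> e)" if e: "0 < e" for e
  proof -
    obtain L where L: "\<And>c x. (c, x) \<in> set L \<Longrightarrow> 0 \<le> c \<and> q x = q x0" "cost L = 1"
      "\<And>y. \<bar>(LINT x|\<mu> (q x0). k (x, y)) - combination k L y\<bar> \<le> e"
      using discretization[OF M q_in_units kc e] by blast
    have "(LINT x|\<mu> (q x0). k (x, y)) = c" if y: "q y = q x0" for y
    proof -
      have "(LINT x|\<mu> (q x0). k (x, y)) = (LINT x|\<mu> (q x0). k (y, x))"
        using invariant_kernelD(4)[OF k] y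
        by (intro integral_on_fibre_cong[OF M] continuous_on_sections kc) simp
      then show ?thesis using c[of y] y by simp
    qed
    then have "\<bar>combination k L y - c\<bar> \<le> e" if "q y = q x0" for y
      using L(3)[of y] that by (simp add: abs_minus_commute)
    then show ?thesis using L(1,2) by blast
  qed
  \<comment> \<open>On the fibre of x0 the combination has integral d against the second measure and is arbitrarily close to c.\<close>
  have cd: "d = c"
  proof -
    have "\<bar>c - d\<bar> \<le> 0 + e" if e: "0 < e" for e
    proof -
      obtain L where L: "\<And>c x. (c, x) \<in> set L \<Longrightarrow> 0 \<le> c \<and> q x = q x0" "cost L = 1"
        "\<And>y. q y = q x0 \<Longrightarrow> \<bar>combination k L y - c\<bar> \<le> e" using start[OF e] by blast
      have "(LINT y|\<nu> (q x0). k (x, y)) = d" if "q x = q x0" for x using d[of x] that by simp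
      from approx[OF N this L] show ?thesis by simp
    qed
    then have "\<bar>c - d\<bar> \<le> 0" by (rule field_le_epsilon)
    then show ?thesis by simp
  qed
  \<comment> \<open>The three errors below add up to \<open>4 e b + 3 \<delta> c\<close>; this e makes the total \<open>4 \<delta> c\<close>, and \<open>4 \<delta> < \<epsilon>\<close>.\<close>
  define e where "e = \<delta> * c / (4 * b)"
  have e: "0 < e" using \<delta> c0 b(1) by (simp add: e_def)
  obtain L where L: "\<And>c x. (c, x) \<in> set L \<Longrightarrow> 0 \<le> c \<and> q x = q x0" "cost L = 1"
    "\<And>y. q y = q x0 \<Longrightarrow> \<bar>combination k L y - c\<bar> \<le> e" using start[OF e] by blast
  have E: "entourage (\<lambda>x y. near k e x y \<and> \<bar>f x - f y\<bar> < \<delta>)"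
    by (intro entourage_conj entourage_near[OF kc e] entourage_continuous[OF f \<delta>])
  show ?thesis
    using eventually_fibres_close[OF E, of x0]
  proof eventually_elim
    case (elim x)
    note close = elim[unfolded Ball_def Bex_def mem_fibre]
    then have "\<forall>y. q y = q x0 \<longrightarrow> (\<exists>z. q z = q x \<and> near k e y z \<and> \<bar>f y - f z\<bar> < \<delta>)" by blast
    then obtain t where t: "\<And>y. q y = q x0 \<Longrightarrow> q (t y) = q x"
      "\<And>y. q y = q x0 \<Longrightarrow> near k e y (t y)" "\<And>y. q y = q x0 \<Longrightarrow> \<bar>f y - f (t y)\<bar> < \<delta>"
      by metis
    let ?L = "map (\<lambda>(c, x). (c, t x)) L"
    have L': "0 \<le> c \<and> q z = q x" if "(c, z) \<in> set ?L" for c z using that L(1) t(1) by auto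
    have cost': "cost ?L = 1" using L(2) by (simp add: cost_map_points)
    have unif': "\<bar>combination k ?L z - c\<bar> \<le> 3 * e" if z: "q z = q x" for z
    proof -
      obtain y where y: "q y = q x0" "near k e y z" using close z by blast
      have "\<bar>combination k L y - combination k ?L z\<bar> \<le> cost L * (2 * e)"
      proof (rule combination_perturb_abs)
        fix c p assume cp: "(c, p) \<in> set L"
        then show "0 \<le> c" using L(1) by blast
        have p: "q p = q x0" using cp L(1) by blast
        have "\<bar>k (p, y) - k (p, z)\<bar> < e" using y(2) unfolding near_def by blast
        moreover have "\<bar>k (p, z) - k (t p, z)\<bar> < e" using t(2)[OF p] unfolding near_def by blast
        ultimately show "\<bar>k (p, y) - k (t p, z)\<bar> \<le> 2 * e" by linarith
      qed
      then show ?thesis using L(2) L(3)[OF y(1)] by simp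
    qed
    have s: "\<bar>(\<Sum>(c, x)\<leftarrow>L. c * f x) - (\<Sum>(c, x)\<leftarrow>?L. c * f x)\<bar> \<le> \<delta>"
    proof -
      have "\<bar>combination (\<lambda>(x, _). f x) L x0 - combination (\<lambda>(x, _). f x) ?L x0\<bar> \<le> cost L * \<delta>"
        using L(1) t(3) by (intro combination_perturb_abs) (auto intro: less_imp_le)
      then show ?thesis using L(2) by (simp add: combination_def)
    qed
    have dx: "(LINT y|\<nu> (q x). k (z, y)) = c" if "q z = q x" for z using d[of z] cd that by simp
    have cx: "(LINT y|\<mu> (q x0). k (z, y)) = c" if "q z = q x0" for z using c[of z] that by simp
    have A: "\<bar>c * (LINT y|\<nu> (q x). f y) - c * (\<Sum>(c, x)\<leftarrow>?L. c * f x)\<bar> \<le> 3 * e * b + \<delta> * c"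
      using approx[OF N dx L' cost' unif'] by blast
    have B: "\<bar>c * (LINT y|\<mu> (q x0). f y) - c * (\<Sum>(c, x)\<leftarrow>L. c * f x)\<bar> \<le> e * b + \<delta> * c"
      using approx[OF M cx L] by blast
    have C: "\<bar>c * (\<Sum>(c, x)\<leftarrow>L. c * f x) - c * (\<Sum>(c, x)\<leftarrow>?L. c * f x)\<bar> \<le> \<delta> * c"
      using mult_left_mono[OF s, of c] c0 by (simp add: abs_mult mult.commute flip: right_diff_distrib)
    have "c * \<bar>(LINT y|\<nu> (q x). f y) - (LINT y|\<mu> (q x0). f y)\<bar>
        = \<bar>c * (LINT y|\<nu> (q x). f y) - c * (LINT y|\<mu> (q x0). f y)\<bar>"
      using c0 by (simp add: abs_mult flip: right_diff_distrib)
    also have "\<dots> \<le> 4 * (e * b) + 3 * (\<delta> * c)" using A B C by linarith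
    also have "\<dots> = c * (4 * \<delta>)" using b(1) by (simp add: e_def)
    finally have "\<bar>(LINT y|\<nu> (q x). f y) - (LINT y|\<mu> (q x0). f y)\<bar> \<le> 4 * \<delta>"
      using c0 by (simp only: mult_le_cancel_left_pos)
    then show ?case using \<epsilon> by (simp add: \<delta>_def)
  qed
qed

text \<open>
  Both families are compared on the fibre of x0 itself.
\<close>

lemma constant_kernel_integrals_unique:
  assumes \<mu>: "constant_kernel_integrals \<mu>" and \<nu>: "constant_kernel_integrals \<nu>" and u: "u \<in> units"
  shows "\<mu> u = \<nu> u"
proof -
  obtain x0 where x0: "q x0 = u" using fibre_nonempty[OF u] by blast
  show ?thesis
  proof (rule regular_borel_prob_eqI[OF compact_space])
    show "regular_borel_prob (\<mu> u)" "regular_borel_prob (\<nu> u)"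
      using constant_kernel_integralsD(1)[OF \<mu> u] constant_kernel_integralsD(1)[OF \<nu> u] by (auto simp: on_fibre_def)
    fix f :: "'k \<Rightarrow> real" assume f: "continuous_on UNIV f"
    have "\<bar>(LINT y|\<nu> u. f y) - (LINT y|\<mu> u. f y)\<bar> \<le> 0 + \<epsilon>" if "0 < \<epsilon>" for \<epsilon>
      using eventually_nhds_x_imp_x[OF constant_kernel_integrals_close[OF \<mu> \<nu> f that, of x0]] x0 by simp
    then have "\<bar>(LINT y|\<nu> u. f y) - (LINT y|\<mu> u. f y)\<bar> \<le> 0" by (rule field_le_epsilon)
    then show "(LINT y|\<mu> u. f y) = (LINT y|\<nu> u. f y)" by simp
  qed
qed

lemma constant_kernel_integrals_continuous:
  assumes \<mu>: "constant_kernel_integrals \<mu>" and f: "continuous_on UNIV (f :: 'k \<Rightarrow> real)"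
  shows "continuous_on UNIV (\<lambda>x. LINT y|\<mu> (q x). f y)"
proof -
  have "((\<lambda>x. LINT y|\<mu> (q x). f y) \<longlongrightarrow> (LINT y|\<mu> (q x0). f y)) (nhds x0)" for x0
    by (rule tendstoI) (simp only: dist_real_def, rule constant_kernel_integrals_close[OF \<mu> \<mu> f])
  then have "((\<lambda>x. LINT y|\<mu> (q x). f y) \<longlongrightarrow> (LINT y|\<mu> (q x0). f y)) (at x0)" for x0
    by (rule tendsto_mono[OF at_within_le_nhds])
  then show ?thesis by (simp add: continuous_on_def)
qed

text \<open>
  Continuity is known after composition with q and descends because q is open and surjective.
\<close>

lemma constant_kernel_integrals_weak_star:
  assumes \<mu>: "constant_kernel_integrals \<mu>"
  shows "continuous_map (top_of_set units) weak_star \<mu>"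
  unfolding weak_star_def
proof (rule continuous_on_generated_topo)
  fix W :: "'k measure set"
  assume "W \<in> {{M. regular_borel_prob M \<and> (LINT x|M. f x) \<in> U} | (f :: 'k \<Rightarrow> real) U. continuous_on UNIV f \<and> open U}"
  then obtain f :: "'k \<Rightarrow> real" and U where
    W: "W = {M. regular_borel_prob M \<and> (LINT x|M. f x) \<in> U}" "continuous_on UNIV f" "open U" by blast
  have "open {x. (LINT y|\<mu> (q x). f y) \<in> U}"
    using continuous_open_preimage[OF constant_kernel_integrals_continuous[OF \<mu> W(2)] open_UNIV W(3)]
    by (simp add: vimage_def)
  then have "openin (top_of_set units) (q ` {x. (LINT y|\<mu> (q x). f y) \<in> U})"
    using open_q by (simp add: open_map_def)
  moreover have "q ` {x. (LINT y|\<mu> (q x). f y) \<in> U} = \<mu> -` W \<inter> topspace (top_of_set units)"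
  proof -
    have "regular_borel_prob (\<mu> u)" if "u \<in> units" for u
      using constant_kernel_integralsD(1)[OF \<mu> that] by (simp add: on_fibre_def)
    then have "\<mu> -` W \<inter> topspace (top_of_set units) = {u \<in> units. (LINT y|\<mu> u. f y) \<in> U}"
      by (auto simp: W(1))
    also have "\<dots> = q ` {x. (LINT y|\<mu> (q x). f y) \<in> U}"
      using q_in_units fibre_nonempty by (force simp: image_iff)
    finally show ?thesis by simp
  qed
  ultimately show "openin (top_of_set units) (\<mu> -` W \<inter> topspace (top_of_set units))" by simp
next
  show "\<mu> ` topspace (top_of_set units)
      \<subseteq> \<Union>{{M. regular_borel_prob M \<and> (LINT x|M. f x) \<in> U} | (f :: 'k \<Rightarrow> real) U. continuous_on UNIV f \<and> open U}"
  proof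
    fix M assume "M \<in> \<mu> ` topspace (top_of_set units)"
    then have "regular_borel_prob M" using constant_kernel_integralsD(1)[OF \<mu>] by (auto simp: on_fibre_def)
    then have "M \<in> {M. regular_borel_prob M \<and> (LINT x|M. (\<lambda>_. 0) x) \<in> (UNIV :: real set)}" by simp
    moreover have "continuous_on UNIV (\<lambda>_ :: 'k. 0 :: real)" "open (UNIV :: real set)" by auto
    ultimately show "M \<in> \<Union>{{M. regular_borel_prob M \<and> (LINT x|M. f x) \<in> U} | (f :: 'k \<Rightarrow> real) U. continuous_on UNIV f \<and> open U}"
      by blast
  qed
qed

text \<open>
  A kernel that is concentrated with respect to a Urysohn function vanishes, as seen from x within its fibre,
  outside a given neighbourhood of x, yet its integral is positive.
\<close>

lemma constant_kernel_integrals_fully_supported: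
  assumes \<mu>: "constant_kernel_integrals \<mu>"
  shows "fully_supported \<mu>"
  unfolding fully_supported_def
proof
  fix u assume u: "u \<in> units"
  have M: "on_fibre u (\<mu> u)" using constant_kernel_integralsD(1)[OF \<mu> u] .
  interpret prob_space "\<mu> u" by (rule on_fibreD(2)[OF M])
  show "measure_support (\<mu> u) = fibre u"
  proof (intro equalityI subsetI)
    fix x assume x: "x \<in> measure_support (\<mu> u)"
    show "x \<in> fibre u"
    proof (rule ccontr)
      assume "x \<notin> fibre u"
      then have "emeasure (\<mu> u) (- fibre u) > 0"
        using x closed_fibre[of u] unfolding measure_support_def by (simp add: open_Compl)
      moreover have "prob (- fibre u) = 0"
        using prob_compl[of "fibre u"] closed_fibre[of u] on_fibreD[OF M] by (simp add: Compl_eq_Diff_UNIV)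
      ultimately show False by (simp add: emeasure_eq_measure)
    qed
  next
    fix x assume x: "x \<in> fibre u"
    have "emeasure (\<mu> u) U > 0" if U: "open U" "x \<in> U" for U
    proof -
      obtain f where f: "continuous_on UNIV f" "\<And>x. 0 \<le> f x" "\<And>x. f x \<le> 1"
        "\<And>y. y \<in> - U \<Longrightarrow> f y = 0" "\<And>y. y \<in> {x} \<Longrightarrow> f y = (1::real)"
        using Urysohn_compact_type[OF compact_space, of "- U" "{x}"] U by auto
      have "eventually (\<lambda>k. invariant_kernel k \<and> concentrated f 1 k) kernel_filter"
        using eventually_invariant_kernel eventually_concentrated[OF f(1)] by (simp add: eventually_conj)
      then obtain k where k: "invariant_kernel k" "concentrated f 1 k"
        using eventually_happens'[OF kernel_filter_neq_bot] by blast
      have sec: "continuous_on UNIV (\<lambda>y. k (x, y))" by (rule continuous_on_sections(1)[OF invariant_kernelD(1)[OF k(1)]])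
      have pos: "0 < (LINT y|\<mu> u. k (x, y))" using kernel_integral_pos[OF \<mu> k(1), of x] x by simp
      have off: "k (x, y) = 0" if "q y = u" "y \<notin> U" for y
      proof (rule ccontr)
        assume "k (x, y) \<noteq> 0"
        then have "0 < k (x, y)" using invariant_kernelD(2)[OF k(1), of "(x, y)"] by simp
        then have "\<bar>f x - f y\<bar> < 1" using k(2) x \<open>q y = u\<close> unfolding concentrated_def by auto
        then show False using f(4)[of y] f(5)[of x] \<open>y \<notin> U\<close> by simp
      qed
      show ?thesis
      proof (rule ccontr)
        assume "\<not> 0 < emeasure (\<mu> u) U"
        moreover have "U \<in> events" using U on_fibreD(3)[OF M] by simp
        ultimately have "AE y in \<mu> u. y \<notin> U" by (intro AE_not_in) (simp add: null_setsI)
        then have "AE y in \<mu> u. k (x, y) = 0" using on_fibreD(6)[OF M] by eventually_elim (rule off)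
        then have "(LINT y|\<mu> u. k (x, y)) = (LINT y|\<mu> u. 0)"
          using integrable_on_fibre[OF M sec] by (intro integral_cong_AE) auto
        then show False using pos by simp
      qed
    qed
    then show "x \<in> measure_support (\<mu> u)" by (simp add: measure_support_def)
  qed
qed

end

section \<open>Relatively invariant measures\<close>

context groupoid_action
begin

lemma relatively_invariantD:
  assumes "relatively_invariant_measure \<mu>"
  shows "\<mu> \<in> extensional units" "continuous_map (top_of_set units) weak_star \<mu>"
    "u \<in> units \<Longrightarrow> distr (\<mu> u) (restrict_space borel units) q = return (restrict_space borel units) u"
    "distr (restrict_space (\<mu> (source g)) (fibre (source g))) borel (act g) = \<mu> (range_of g)"
  using assms unfolding relatively_invariant_measure_def by blast+

lemma measurable_q:
  assumes "sets M = sets borel"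
  shows "q \<in> M \<rightarrow>\<^sub>M restrict_space borel units"
proof (rule measurable_restrict_space2)
  show "q \<in> space M \<rightarrow> units" using q_in_units by blast
  show "q \<in> M \<rightarrow>\<^sub>M borel"
    using borel_measurable_continuous_onI[OF continuous_on_q] by (subst measurable_cong_sets[OF assms refl])
qed

lemma relatively_invariant_on_fibre:
  assumes \<mu>: "relatively_invariant_measure \<mu>" and u: "u \<in> units"
  shows "on_fibre u (\<mu> u)"
proof -
  have "\<mu> u \<in> topspace weak_star"
    using relatively_invariantD(2)[OF \<mu>] u by (auto simp: continuous_map_def)
  then have reg: "regular_borel_prob (\<mu> u)" unfolding weak_star_def by auto
  interpret prob_space "\<mu> u" by (rule regular_borel_prob_space(1)[OF reg])
  note sM = regular_borel_prob_space(2,3)[OF reg]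
  have su: "{u} \<in> sets (restrict_space borel units)"
    using u closed_units by (subst sets_restrict_space_iff) auto
  have "emeasure (distr (\<mu> u) (restrict_space borel units) q) {u} = emeasure (return (restrict_space borel units) u) {u}"
    by (simp only: relatively_invariantD(3)[OF \<mu> u])
  also have "\<dots> = 1" using su by simp
  finally have "emeasure (distr (\<mu> u) (restrict_space borel units) q) {u} = 1" .
  moreover have "emeasure (distr (\<mu> u) (restrict_space borel units) q) {u} = emeasure (\<mu> u) (q -` {u} \<inter> space (\<mu> u))"
    by (rule emeasure_distr[OF measurable_q[OF sM(1)] su])
  ultimately have "prob (fibre u) = 1" using sM by (simp add: fibre_def emeasure_eq_measure)
  then show ?thesis using reg by (simp add: on_fibre_def)
qed

text \<open>
  Near x0 the integrand changes uniformly little, and for the fixed integrand \<open>\<psi> (x0, \<cdot>)\<close> the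
  integral varies continuously by definition of the weak* topology.
\<close>

lemma continuous_on_kernel_integral:
  fixes \<mu> :: "'g \<Rightarrow> 'k measure" and \<psi> :: "'k \<times> 'k \<Rightarrow> real"
  assumes \<mu>: "continuous_map (top_of_set units) weak_star \<mu>" "\<And>u. u \<in> units \<Longrightarrow> on_fibre u (\<mu> u)"
    and \<psi>: "continuous_on UNIV \<psi>"
  shows "continuous_on UNIV (\<lambda>x. LINT y|\<mu> (q x). \<psi> (x, y))"
proof -
  have int: "continuous_on UNIV (\<lambda>x. LINT y|\<mu> (q x). f y)" if f: "continuous_on UNIV f" for f :: "'k \<Rightarrow> real"
  proof -
    have comp: "continuous_map euclidean weak_star (\<mu> \<circ> q)"
      by (rule continuous_map_compose[OF continuous_q \<mu>(1)])
    have "open {x. (LINT y|\<mu> (q x). f y) \<in> U}" if U: "open U" for U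
    proof -
      let ?W = "{M. regular_borel_prob M \<and> (LINT x|M. f x) \<in> U}"
      have "openin weak_star ?W"
        unfolding weak_star_def by (rule topology_generated_by_Basis) (use f U in blast)
      then have "openin euclidean {x \<in> topspace euclidean. (\<mu> \<circ> q) x \<in> ?W}"
        by (rule openin_continuous_map_preimage[OF comp])
      moreover have "regular_borel_prob (\<mu> (q x))" for x using \<mu>(2)[OF q_in_units] by (simp add: on_fibre_def)
      ultimately show ?thesis by simp
    qed
    then show ?thesis by (simp add: continuous_on_open_vimage vimage_def)
  qed
  have "((\<lambda>x. LINT y|\<mu> (q x). \<psi> (x, y)) \<longlongrightarrow> (LINT y|\<mu> (q x0). \<psi> (x0, y))) (at x0)" for x0
  proof (rule tendstoI)
    fix e :: real assume e: "0 < e"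
    then have e2: "0 < e / 2" by simp
    have "isCont (\<lambda>x. LINT y|\<mu> (q x). \<psi> (x0, y)) x0"
      using int[OF continuous_on_sections(1)[OF \<psi>]] by (simp add: continuous_on_eq_continuous_at)
    then have "eventually (\<lambda>x. dist (LINT y|\<mu> (q x). \<psi> (x0, y)) (LINT y|\<mu> (q x0). \<psi> (x0, y)) < e / 2) (at x0)"
      unfolding isCont_def using e2 by (rule tendstoD)
    moreover have "eventually (\<lambda>x. near \<psi> (e / 2) x x0 \<and> near \<psi> (e / 2) x0 x) (at x0)"
      by (rule filter_leD[OF at_within_le_nhds entourage_eventually[OF entourage_near[OF \<psi> e2]]])
    ultimately show "eventually (\<lambda>x. dist (LINT y|\<mu> (q x). \<psi> (x, y)) (LINT y|\<mu> (q x0). \<psi> (x0, y)) < e) (at x0)"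
    proof eventually_elim
      case (elim x)
      have "\<bar>(LINT y|\<mu> (q x). \<psi> (x, y)) - (LINT y|\<mu> (q x). \<psi> (x0, y))\<bar> \<le> e / 2"
        using elim(2) by (intro integral_on_fibre_diff[OF \<mu>(2)[OF q_in_units]] continuous_on_sections \<psi>)
          (auto simp: near_def intro: less_imp_le)
      then show ?case using elim(1) unfolding dist_real_def by linarith
    qed
  qed
  then show ?thesis by (simp add: continuous_on_def)
qed

lemma integral_distr_act:
  assumes M: "on_fibre (source g) M" and f: "continuous_on UNIV (f :: 'k \<Rightarrow> real)"
    and f': "continuous_on UNIV f'" "\<And>x. q x = source g \<Longrightarrow> f (act g x) = f' x"
  shows "(LINT y|distr (restrict_space M (fibre (source g))) borel (act g). f y) = (LINT x|M. f' x)"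
proof -
  have "act g \<in> restrict_space M (fibre (source g)) \<rightarrow>\<^sub>M borel"
    using borel_measurable_continuous_on_restrict[OF continuous_act_fibre[of g]]
      sets_restrict_space_cong[OF on_fibreD(3)[OF M], of "fibre (source g)"]
    by (subst measurable_cong_sets[where M' = "restrict_space borel (fibre (source g))"]) auto
  then have "(LINT y|distr (restrict_space M (fibre (source g))) borel (act g). f y)
      = (LINT x|restrict_space M (fibre (source g)). f (act g x))"
    by (rule integral_distr) (rule borel_measurable_continuous_onI[OF f])
  also have "\<dots> = (LINT x|M. f' x)"
    using f'(2) by (intro integral_restrict_space_carrier[OF on_fibreD(2,3)[OF M] closed_fibre on_fibreD(5)[OF M] f'(1)]) simp
  finally show ?thesis .
qed

text \<open>
  The integral of an invariant kernel over its second argument is an invariant continuous function of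
  the first, so ergodicity makes it constant.
\<close>

lemma relatively_invariant_constant_kernel_integrals:
  assumes erg: topologically_ergodic and \<mu>: "relatively_invariant_measure \<mu>"
  shows "constant_kernel_integrals \<mu>"
  unfolding constant_kernel_integrals_def
proof (intro conjI ballI allI impI)
  fix u assume "u \<in> units"
  then show "on_fibre u (\<mu> u)" by (rule relatively_invariant_on_fibre[OF \<mu>])
next
  fix k x x' assume k: "invariant_kernel k"
  note kc = invariant_kernelD(1)[OF k]
  show "(LINT y|\<mu> (q x). k (x, y)) = (LINT y|\<mu> (q x'). k (x', y))"
  proof (rule ergodic_invariant_constant[OF erg])
    show "continuous_on UNIV (\<lambda>x. LINT y|\<mu> (q x). k (x, y))"
      by (rule continuous_on_kernel_integral[OF relatively_invariantD(2)[OF \<mu>] relatively_invariant_on_fibre[OF \<mu>] kc])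
    fix g x assume x: "q x = source g"
    have "(LINT y|\<mu> (q (act g x)). k (act g x, y))
        = (LINT y|distr (restrict_space (\<mu> (source g)) (fibre (source g))) borel (act g). k (act g x, y))"
      using q_act[of g x] x by (simp add: relatively_invariantD(4)[OF \<mu>])
    also have "\<dots> = (LINT y|\<mu> (source g). k (x, y))"
      using invariant_kernelD(5)[OF k x]
      by (intro integral_distr_act[OF relatively_invariant_on_fibre[OF \<mu> source_in_units]] continuous_on_sections kc)
    finally show "(LINT y|\<mu> (q (act g x)). k (act g x, y)) = (LINT y|\<mu> (q x). k (x, y))" by (simp add: x)
  qed
qed

end

context ergodic_isometric_action
begin

text \<open>
  The Riesz measures of the limit functionals. They live on the fibres because the functionals see only
  the values on the fibre; weak* continuity comes from their constant kernel integrals, and invariance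
  from the invariance of the functionals.
\<close>

lemma exists_relatively_invariant_measure: "\<exists>\<mu>. relatively_invariant_measure \<mu>"
proof -
  obtain \<Lambda> :: "'g \<Rightarrow> ('k \<Rightarrow> real) \<Rightarrow> real" where
    functional: "\<And>u. u \<in> units \<Longrightarrow> normalized_positive_functional (\<Lambda> u)"
    and local: "\<And>u f f'. u \<in> units \<Longrightarrow> test_function f \<Longrightarrow> test_function f' \<Longrightarrow> (\<And>y. q y = u \<Longrightarrow> f y = f' y) \<Longrightarrow>
       \<Lambda> u f = \<Lambda> u f'"
    and inv: "\<And>g f f'. test_function f \<Longrightarrow> test_function f' \<Longrightarrow> (\<And>x. q x = source g \<Longrightarrow> f' x = f (act g x)) \<Longrightarrow>
       \<Lambda> (range_of g) f = \<Lambda> (source g) f'"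
    and kernel: "\<And>\<psi> x x'. invariant_kernel \<psi> \<Longrightarrow> \<Lambda> (q x) (\<lambda>y. \<psi> (x, y)) = \<Lambda> (q x') (\<lambda>y. \<psi> (x', y))"
    using exists_invariant_functional by blast
  define \<mu> where "\<mu> = restrict (\<lambda>u. normalized_positive_functional.riesz_measure (\<Lambda> u)) units"
  have reg: "regular_borel_prob (\<mu> u)" if "u \<in> units" for u
    using normalized_positive_functional.regular_riesz_measure[OF functional[OF that]] that by (simp add: \<mu>_def)
  have int: "(LINT y|\<mu> u. f y) = \<Lambda> u f" if "u \<in> units" "test_function f" for u f
    using normalized_positive_functional.integral_riesz_measure[OF functional[OF that(1)], of f]
      test_functionD[OF that(2)] that(1) by (simp add: \<mu>_def)
  have fib: "on_fibre u (\<mu> u)" if u: "u \<in> units" for u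
  proof -
    interpret prob_space "\<mu> u" by (rule regular_borel_prob_space(1)[OF reg[OF u]])
    note sM = regular_borel_prob_space(2,3)[OF reg[OF u]]
    have null: "prob C = 0" if C: "compact C" "C \<subseteq> - fibre u" for C
    proof -
      obtain f where f: "continuous_on UNIV f" "\<And>x. 0 \<le> f x" "\<And>x. f x \<le> 1"
        "\<And>x. x \<in> fibre u \<Longrightarrow> f x = (0::real)" "\<And>x. x \<in> C \<Longrightarrow> f x = 1"
        using Urysohn_compact_type[OF compact_space closed_fibre compact_imp_closed[OF C(1)], of u] C(2) by blast
      have t: "test_function f" "test_function (\<lambda>_. 0)" using f by (auto simp: test_function_def)
      have CM: "C \<in> events" using C(1) sM by (simp add: compact_imp_closed borel_closed)
      have "prob C = (LINT x|\<mu> u. indicator C x)" using sM by simp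
      also have "\<dots> \<le> (LINT x|\<mu> u. f x)"
      proof (rule integral_mono)
        show "integrable (\<mu> u) (indicator C :: 'k \<Rightarrow> real)"
          using CM by (intro integrable_real_indicator) (auto simp: emeasure_eq_measure)
        show "integrable (\<mu> u) f"
          using sM by (intro integrable_continuous_compact_type[OF compact_space f(1)] finite_measure_axioms)
        show "indicator C x \<le> f x" for x using f(2,5) by (simp add: indicator_def)
      qed
      also have "\<dots> = \<Lambda> u f" by (rule int[OF u t(1)])
      also have "\<dots> = \<Lambda> u (\<lambda>_. 0)" using f(4) by (intro local[OF u t]) simp
      also have "\<dots> = 0" using int[OF u t(2)] by simp
      finally show ?thesis by (simp add: measure_le_0_iff)
    qed
    have meas: "- fibre u \<in> sets borel" using closed_fibre[of u] by auto
    have "prob (- fibre u) \<le> 0 + e" if e: "0 < e" for e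
    proof -
      obtain C where "compact C" "C \<subseteq> - fibre u" "prob (- fibre u) \<le> prob C + e"
        using regular_borel_prob_inner[OF reg[OF u] meas e] by blast
      then show ?thesis using null[of C] by simp
    qed
    then have "prob (- fibre u) \<le> 0" by (rule field_le_epsilon)
    then have "1 \<le> prob (fibre u)"
      using prob_compl[of "fibre u"] closed_fibre[of u] sM by (simp add: Compl_eq_Diff_UNIV)
    then have "prob (fibre u) = 1" by (rule antisym[OF prob_le_1])
    then show ?thesis using reg[OF u] by (simp add: on_fibre_def)
  qed
  have const: "constant_kernel_integrals \<mu>"
    unfolding constant_kernel_integrals_def
  proof (intro conjI ballI allI impI fib)
    fix k x x' assume k: "invariant_kernel k"
    have t: "test_function (\<lambda>y. k (z, y))" for z
      using invariant_kernelD(1,2)[OF k] by (rule test_function_kernel)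
    show "(LINT y|\<mu> (q x). k (x, y)) = (LINT y|\<mu> (q x'). k (x', y))"
      using kernel[OF k, of x x'] by (simp add: int[OF q_in_units t])
  qed
  have "relatively_invariant_measure \<mu>"
    unfolding relatively_invariant_measure_def
  proof (intro conjI ballI allI)
    show "\<mu> \<in> extensional units" by (simp add: \<mu>_def)
    show "continuous_map (top_of_set units) weak_star \<mu>" by (rule constant_kernel_integrals_weak_star[OF const])
  next
    fix u assume u: "u \<in> units"
    note mu_prob = on_fibreD(2)[OF fib[OF u]]
    show "distr (\<mu> u) (restrict_space borel units) q = return (restrict_space borel units) u"
    proof (rule measure_eqI)
      fix A assume "A \<in> sets (distr (\<mu> u) (restrict_space borel units) q)"
      then have A: "A \<in> sets (restrict_space borel units)" by simp
      note mq = measurable_q[OF on_fibreD(3)[OF fib[OF u]]]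
      have "emeasure (distr (\<mu> u) (restrict_space borel units) q) A = emeasure (\<mu> u) (q -` A \<inter> space (\<mu> u))"
        by (rule emeasure_distr[OF mq A])
      also have "\<dots> = indicator A u"
      proof (cases "u \<in> A")
        case True
        have "AE x in \<mu> u. x \<in> q -` A \<inter> space (\<mu> u)"
          using on_fibreD(6)[OF fib[OF u]] by eventually_elim (use True on_fibreD(4)[OF fib[OF u]] in simp)
        then have "emeasure (\<mu> u) (q -` A \<inter> space (\<mu> u)) = 1"
          by (rule prob_space.emeasure_eq_1_AE[OF mu_prob measurable_sets[OF mq A]])
        then show ?thesis using True by simp
      next
        case False
        have "AE x in \<mu> u. x \<notin> q -` A \<inter> space (\<mu> u)"
          using on_fibreD(6)[OF fib[OF u]] by eventually_elim (use False in auto)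
        then have "emeasure (\<mu> u) (q -` A \<inter> space (\<mu> u)) = 0"
          unfolding AE_iff_null_sets[OF measurable_sets[OF mq A], symmetric] by (rule null_setsD1)
        then show ?thesis using False by simp
      qed
      also have "\<dots> = emeasure (return (restrict_space borel units) u) A" using A by simp
      finally show "emeasure (distr (\<mu> u) (restrict_space borel units) q) A = emeasure (return (restrict_space borel units) u) A" .
    qed simp
  next
    fix g
    note F = fib[OF source_in_units, of g]
    show "distr (restrict_space (\<mu> (source g)) (fibre (source g))) borel (act g) = \<mu> (range_of g)"
    proof (rule regular_borel_prob_eqI[OF compact_space])
      show "regular_borel_prob (distr (restrict_space (\<mu> (source g)) (fibre (source g))) borel (act g))"
        by (rule regular_borel_prob_distr[OF compact_space on_fibreD(1)[OF F] compact_fibre on_fibreD(5)[OF F] continuous_act_fibre])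
      show "regular_borel_prob (\<mu> (range_of g))" by (rule reg[OF range_in_units])
      fix f :: "'k \<Rightarrow> real" assume f: "continuous_on UNIV f" "\<And>x. 0 \<le> f x"
      have "continuous_on (fibre (source g)) (\<lambda>x. f (act g x))"
        by (rule continuous_on_compose2[OF f(1) continuous_act_fibre]) simp
      from Tietze_nonneg_compact_type[OF compact_space closed_fibre this f(2)]
      obtain f' where f': "continuous_on UNIV f'" "\<And>x. 0 \<le> f' x" "\<And>x. x \<in> fibre (source g) \<Longrightarrow> f' x = f (act g x)"
        by blast
      have t: "test_function f" "test_function f'" using f f'(1,2) by (auto simp: test_function_def)
      have "(LINT y|distr (restrict_space (\<mu> (source g)) (fibre (source g))) borel (act g). f y) = (LINT x|\<mu> (source g). f' x)"
        by (rule integral_distr_act[OF F f(1) f'(1)]) (simp add: f'(3))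
      also have "\<dots> = \<Lambda> (source g) f'" by (rule int[OF source_in_units t(2)])
      also have "\<dots> = \<Lambda> (range_of g) f" using f'(3) by (intro inv[OF t, symmetric]) simp
      also have "\<dots> = (LINT y|\<mu> (range_of g). f y)" by (rule int[OF range_in_units t(1), symmetric])
      finally show "(LINT y|distr (restrict_space (\<mu> (source g)) (fibre (source g))) borel (act g). f y)
          = (LINT y|\<mu> (range_of g). f y)" .
    qed
  qed
  then show ?thesis by blast
qed

lemma unique_relatively_invariant_measure: "\<exists>!\<mu>. relatively_invariant_measure \<mu>"
proof (rule ex_ex1I)
  show "\<exists>\<mu>. relatively_invariant_measure \<mu>" by (rule exists_relatively_invariant_measure)
  fix \<mu> \<nu> assume \<mu>: "relatively_invariant_measure \<mu>" and \<nu>: "relatively_invariant_measure \<nu>"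
  show "\<mu> = \<nu>"
  proof (rule extensionalityI[OF relatively_invariantD(1)[OF \<mu>] relatively_invariantD(1)[OF \<nu>]])
    show "\<mu> u = \<nu> u" if "u \<in> units" for u
      using constant_kernel_integrals_unique[OF _ _ that] relatively_invariant_constant_kernel_integrals[OF ergodic]
        \<mu> \<nu> by blast
  qed
qed

end

theorem theorem5p12:
  fixes mul :: "'g::t2_space \<Rightarrow> 'g \<Rightarrow> 'g" and ginv :: "'g \<Rightarrow> 'g"
    and q :: "'k::t2_space \<Rightarrow> 'g" and act :: "'g \<Rightarrow> 'k \<Rightarrow> 'k"
  assumes "groupoid_action mul ginv q act"
    and "groupoid_action.pseudoisometric mul ginv q act"
    and "groupoid_action.topologically_ergodic mul ginv q act"
  shows "(\<exists>!\<mu>. groupoid_action.relatively_invariant_measure mul ginv q act \<mu>) \<and>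
         (\<forall>\<mu>. groupoid_action.relatively_invariant_measure mul ginv q act \<mu> \<longrightarrow>
               groupoid_action.fully_supported mul ginv q \<mu>)"
proof -
  interpret groupoid_action mul ginv q act by fact
  obtain P where "isometric_action mul ginv q act P"
    using pseudoisometric_imp_isometric_action assms(2) by blast
  then interpret isometric_action mul ginv q act P .
  interpret ergodic_isometric_action mul ginv q act P by unfold_locales (rule assms(3))
  show ?thesis
    using unique_relatively_invariant_measure constant_kernel_integrals_fully_supported
      relatively_invariant_constant_kernel_integrals[OF ergodic] by blast
qed

end
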